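(* Let $R'$ be a commutative $\mathbb Z[\rho]$-algebra, let $\psi:R_0=\mathbb Z[\rho][a]\to R'$ be any $\mathbb Z[\rho]$-algebra homomorphism, and set $b=\psi(a)$. Then the polynomial $Z^p+g(Z)-b\in R'[Z]$ is separable if and only if $1+b\eta^p$ is invertible in $R'$. In particular, the extension $T/R$ is Galois with group $G$ generated by $\sigma$, where $R=R_0(1/(1+a\eta^p))$, $T=R[Z]/(Z^p+g(Z)-a)$, and $\sigma(\theta)=\rho\theta+1$ for $\theta$ the image of $Z$. If $1+b\eta^p$ is invertible in $R'$ then $\psi$ extends to $\psi:R\to R'$ and $T'=T\otimes_{\psi}R'$ is $G$-Galois over $R'$. If moreover $\eta$ is invertible in $R'$ then $T'\cong R'[Z]/(Z^p-(1+b\eta^p))$.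
   Context: $p$ is a prime, $\rho$ is a primitive $p$-th root of one ($\rho=-1$, $\mathbb Z[\rho]=\mathbb Z$ when $p=2$), $\eta=\rho-1$; $R_0=\mathbb Z[\rho][a]$ is the polynomial ring in one variable $a$. The polynomial $g(Z)\in\mathbb Z[\rho][Z]$, of degree less than $p$, is defined by $(1+\eta Z)^p=1+(g(Z)+Z^p)\eta^p$. (Thus $g(Z)\equiv -Z$ modulo $\eta$.) The notation $A(1/s)$ means the localization of $A$ inverting $s$. For a finite group $G$, a commutative ring extension $T/R$ with $G$ acting by $R$-automorphisms is $G$-Galois if $T$ is finitely generated projective over $R$ and $T\otimes_RT\to\bigoplus_{g\in G}T$, $t\otimes t'\mapsto(t\,g(t'))_g$, is an isomorphism. A monic polynomial $f\in R'[Z]$ is separable if $R'[Z]/(f)$ is a separable $R'$-algebra (equivalently its discriminant is a unit). *)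

theory Defs
  imports "HOL-Algebra.Algebra" "HOL-Algebra.Algebraic_Closure_Type" Complex_Main
begin

section \<open>Modules\<close>

definition module_hom ::
    "('r, 'k) ring_scheme \<Rightarrow> ('r, 'm, 'k1) module_scheme \<Rightarrow> ('r, 'n, 'k2) module_scheme \<Rightarrow> ('m \<Rightarrow> 'n) set"
  where "module_hom R M N =
    {f \<in> carrier M \<rightarrow> carrier N.
       (\<forall>x\<in>carrier M. \<forall>y\<in>carrier M. f (x \<oplus>\<^bsub>M\<^esub> y) = f x \<oplus>\<^bsub>N\<^esub> f y) \<and>
       (\<forall>r\<in>carrier R. \<forall>x\<in>carrier M. f (r \<odot>\<^bsub>M\<^esub> x) = r \<odot>\<^bsub>N\<^esub> f x)}"

text \<open>
  The free module with basis \<open>I\<close>: finitely supported families.  The record type of modules extends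
  that of rings; the fields \<open>mult\<close> and \<open>one\<close> play no role for modules.
\<close>

definition free_module :: "('r, 'k) ring_scheme \<Rightarrow> 'i set \<Rightarrow> ('r, 'i \<Rightarrow> 'r) module"
  where "free_module R I =
    \<lparr>carrier = {f \<in> I \<rightarrow>\<^sub>E carrier R. finite {i \<in> I. f i \<noteq> \<zero>\<^bsub>R\<^esub>}},
     monoid.mult = undefined, monoid.one = undefined,
     ring.zero = (\<lambda>i\<in>I. \<zero>\<^bsub>R\<^esub>), ring.add = (\<lambda>f g. \<lambda>i\<in>I. f i \<oplus>\<^bsub>R\<^esub> g i),
     module.smult = (\<lambda>r f. \<lambda>i\<in>I. r \<otimes>\<^bsub>R\<^esub> f i)\<rparr>"

text \<open>
  Projective means: direct summand of a free module.  Index sets \<open>I\<close> in the type of elements of \<open>M\<close>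
  suffice, because if \<open>M\<close> is projective then it is a summand of the free module on its own carrier.
\<close>

definition projective_module :: "('r, 'k) ring_scheme \<Rightarrow> ('r, 'm, 'l) module_scheme \<Rightarrow> bool"
  where "projective_module R M \<longleftrightarrow> module R M \<and>
    (\<exists>I :: 'm set. \<exists>i \<in> module_hom R M (free_module R I). \<exists>q \<in> module_hom R (free_module R I) M.
       \<forall>x\<in>carrier M. q (i x) = x)"

definition finitely_generated_module :: "('r, 'k) ring_scheme \<Rightarrow> ('r, 'm, 'l) module_scheme \<Rightarrow> bool"
  where "finitely_generated_module R M \<longleftrightarrow> module R M \<and>
    (\<exists>S. finite S \<and> S \<subseteq> carrier M \<and>
       (\<forall>x\<in>carrier M. \<exists>c \<in> S \<rightarrow> carrier R. x = (\<Oplus>\<^bsub>M\<^esub>s\<in>S. c s \<odot>\<^bsub>M\<^esub> s)))"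

section \<open>Commutative algebras and their tensor products\<close>

text \<open>
  A commutative \<open>R\<close>-algebra is a commutative ring \<open>A\<close> with a structure map \<open>h \<in> ring_hom R A\<close>.
\<close>

definition comm_algebra :: "('r, 'k) ring_scheme \<Rightarrow> ('a, 'l) ring_scheme \<Rightarrow> ('r \<Rightarrow> 'a) \<Rightarrow> bool"
  where "comm_algebra R A h \<longleftrightarrow> cring R \<and> cring A \<and> h \<in> ring_hom R A"

definition alg_module :: "('a, 'l) ring_scheme \<Rightarrow> ('r \<Rightarrow> 'a) \<Rightarrow> ('r, 'a) module"
  where "alg_module A h =
    \<lparr>carrier = carrier A, monoid.mult = monoid.mult A, monoid.one = monoid.one A,
     ring.zero = ring.zero A, ring.add = ring.add A,
     module.smult = (\<lambda>r x. h r \<otimes>\<^bsub>A\<^esub> x)\<rparr>"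

definition algebra_isomorphic ::
    "('r, 'k) ring_scheme \<Rightarrow> ('a, 'l) ring_scheme \<Rightarrow> ('r \<Rightarrow> 'a) \<Rightarrow> ('b, 'm) ring_scheme \<Rightarrow> ('r \<Rightarrow> 'b) \<Rightarrow> bool"
  where "algebra_isomorphic R A h B k \<longleftrightarrow> (\<exists>f \<in> ring_iso A B. \<forall>r\<in>carrier R. f (h r) = k r)"

text \<open>
  The additive group of \<open>A \<otimes>\<^sub>R B\<close> is the free abelian group on the pairs \<open>(a, b)\<close> modulo the bilinear
  relations.  Here the free abelian group carries the multiplication with
  \<open>(a, b) \<cdot> (a', b') = (a a', b b')\<close> on basis elements.  A multiple of a bilinear relation by a basis
  element is again such a relation, so the ideal they generate is the subgroup they generate.
\<close>

definition pair_ring ::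
    "('a, 'l) ring_scheme \<Rightarrow> ('b, 'm) ring_scheme \<Rightarrow> ('a \<times> 'b \<Rightarrow>\<^sub>0 int) ring"
  where "pair_ring A B =
    \<lparr>carrier = {x. Poly_Mapping.keys x \<subseteq> carrier A \<times> carrier B},
     monoid.mult = (\<lambda>x y. frag_extend (\<lambda>(a, b). frag_extend (\<lambda>(a', b').
               frag_of (a \<otimes>\<^bsub>A\<^esub> a', b \<otimes>\<^bsub>B\<^esub> b')) y) x),
     monoid.one = frag_of (\<one>\<^bsub>A\<^esub>, \<one>\<^bsub>B\<^esub>), ring.zero = 0, ring.add = (+)\<rparr>"

definition bilinear_relations ::
    "('r, 'k) ring_scheme \<Rightarrow> ('a, 'l) ring_scheme \<Rightarrow> ('r \<Rightarrow> 'a) \<Rightarrow>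
     ('b, 'm) ring_scheme \<Rightarrow> ('r \<Rightarrow> 'b) \<Rightarrow> ('a \<times> 'b \<Rightarrow>\<^sub>0 int) set"
  where "bilinear_relations R A h B k =
    {frag_of (a \<oplus>\<^bsub>A\<^esub> a', b) - frag_of (a, b) - frag_of (a', b) |a a' b.
       a \<in> carrier A \<and> a' \<in> carrier A \<and> b \<in> carrier B} \<union>
    {frag_of (a, b \<oplus>\<^bsub>B\<^esub> b') - frag_of (a, b) - frag_of (a, b') |a b b'.
       a \<in> carrier A \<and> b \<in> carrier B \<and> b' \<in> carrier B} \<union>
    {frag_of (h r \<otimes>\<^bsub>A\<^esub> a, b) - frag_of (a, k r \<otimes>\<^bsub>B\<^esub> b) |r a b.
       r \<in> carrier R \<and> a \<in> carrier A \<and> b \<in> carrier B}"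

definition tensor_ideal ::
    "('r, 'k) ring_scheme \<Rightarrow> ('a, 'l) ring_scheme \<Rightarrow> ('r \<Rightarrow> 'a) \<Rightarrow>
     ('b, 'm) ring_scheme \<Rightarrow> ('r \<Rightarrow> 'b) \<Rightarrow> ('a \<times> 'b \<Rightarrow>\<^sub>0 int) set"
  where "tensor_ideal R A h B k = genideal (pair_ring A B) (bilinear_relations R A h B k)"

definition tensor_ring ::
    "('r, 'k) ring_scheme \<Rightarrow> ('a, 'l) ring_scheme \<Rightarrow> ('r \<Rightarrow> 'a) \<Rightarrow>
     ('b, 'm) ring_scheme \<Rightarrow> ('r \<Rightarrow> 'b) \<Rightarrow> ('a \<times> 'b \<Rightarrow>\<^sub>0 int) set ring"
  where "tensor_ring R A h B k = pair_ring A B Quot tensor_ideal R A h B k"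

definition pure_tensor ::
    "('r, 'k) ring_scheme \<Rightarrow> ('a, 'l) ring_scheme \<Rightarrow> ('r \<Rightarrow> 'a) \<Rightarrow>
     ('b, 'm) ring_scheme \<Rightarrow> ('r \<Rightarrow> 'b) \<Rightarrow> 'a \<Rightarrow> 'b \<Rightarrow> ('a \<times> 'b \<Rightarrow>\<^sub>0 int) set"
  where "pure_tensor R A h B k a b = tensor_ideal R A h B k +>\<^bsub>pair_ring A B\<^esub> frag_of (a, b)"

section \<open>Separable algebras and Galois extensions\<close>

text \<open>
  \<open>A\<close> is separable over \<open>R\<close> if it is projective over its enveloping algebra, which for commutative \<open>A\<close>
  is \<open>A \<otimes>\<^sub>R A\<close>, acting on \<open>A\<close> through the multiplication map \<open>A \<otimes>\<^sub>R A \<rightarrow> A\<close>.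
\<close>

definition separable_algebra :: "('r, 'k) ring_scheme \<Rightarrow> ('a, 'l) ring_scheme \<Rightarrow> ('r \<Rightarrow> 'a) \<Rightarrow> bool"
  where "separable_algebra R A h \<longleftrightarrow> comm_algebra R A h \<and>
    (\<exists>m \<in> ring_hom (tensor_ring R A h A h) A.
       (\<forall>a\<in>carrier A. \<forall>b\<in>carrier A. m (pure_tensor R A h A h a b) = a \<otimes>\<^bsub>A\<^esub> b) \<and>
       projective_module (tensor_ring R A h A h) (alg_module A m))"

definition power_ring :: "'g set \<Rightarrow> ('a, 'l) ring_scheme \<Rightarrow> ('g \<Rightarrow> 'a) ring"
  where "power_ring I A =
    \<lparr>carrier = I \<rightarrow>\<^sub>E carrier A,
     monoid.mult = (\<lambda>x y. \<lambda>g\<in>I. x g \<otimes>\<^bsub>A\<^esub> y g), monoid.one = (\<lambda>g\<in>I. \<one>\<^bsub>A\<^esub>),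
     ring.zero = (\<lambda>g\<in>I. \<zero>\<^bsub>A\<^esub>), ring.add = (\<lambda>x y. \<lambda>g\<in>I. x g \<oplus>\<^bsub>A\<^esub> y g)\<rparr>"

text \<open>
  The group \<open>G\<close> acts through \<open>act\<close>, which need not be faithful.  As \<open>T\<close> is an extension of \<open>R\<close>, the
  structure map is required to be injective; this excludes \<open>T = 0\<close> over \<open>R \<noteq> 0\<close>.
\<close>

definition galois_extension ::
    "('r, 'k) ring_scheme \<Rightarrow> ('a, 'l) ring_scheme \<Rightarrow> ('r \<Rightarrow> 'a) \<Rightarrow>
     ('g, 'm) monoid_scheme \<Rightarrow> ('g \<Rightarrow> 'a \<Rightarrow> 'a) \<Rightarrow> bool"
  where "galois_extension R T h G act \<longleftrightarrow>
    comm_algebra R T h \<and> inj_on h (carrier R) \<and>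
    finite (carrier G) \<and> group_action G (carrier T) act \<and>
    (\<forall>g\<in>carrier G. act g \<in> ring_hom T T \<and> (\<forall>r\<in>carrier R. act g (h r) = h r)) \<and>
    finitely_generated_module R (alg_module T h) \<and> projective_module R (alg_module T h) \<and>
    (\<exists>f \<in> ring_iso (tensor_ring R T h T h) (power_ring (carrier G) T).
       \<forall>t\<in>carrier T. \<forall>t'\<in>carrier T.
         f (pure_tensor R T h T h t t') = (\<lambda>g\<in>carrier G. t \<otimes>\<^bsub>T\<^esub> act g t'))"

definition algebra_automorphisms ::
    "('r, 'k) ring_scheme \<Rightarrow> ('a, 'l) ring_scheme \<Rightarrow> ('r \<Rightarrow> 'a) \<Rightarrow> ('a \<Rightarrow> 'a) set"
  where "algebra_automorphisms R T h =
    {s \<in> carrier (BijGroup (carrier T)). s \<in> ring_hom T T \<and> (\<forall>r\<in>carrier R. s (h r) = h r)}"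

definition generated_group :: "('a, 'l) ring_scheme \<Rightarrow> ('a \<Rightarrow> 'a) \<Rightarrow> ('a \<Rightarrow> 'a) monoid"
  where "generated_group T s = subgroup_generated (BijGroup (carrier T)) {s}"

section \<open>Localization at one element\<close>

definition powers_of :: "('a, 'l) ring_scheme \<Rightarrow> 'a \<Rightarrow> 'a set"
  where "powers_of A s = {s [^]\<^bsub>A\<^esub> n |n :: nat. True}"

definition loc_rel :: "('a, 'l) ring_scheme \<Rightarrow> 'a \<Rightarrow> (('a \<times> 'a) \<times> ('a \<times> 'a)) set"
  where "loc_rel A s =
    {((x, u), (y, v)). x \<in> carrier A \<and> y \<in> carrier A \<and> u \<in> powers_of A s \<and> v \<in> powers_of A s \<and>
       (\<exists>w\<in>powers_of A s. w \<otimes>\<^bsub>A\<^esub> (x \<otimes>\<^bsub>A\<^esub> v) = w \<otimes>\<^bsub>A\<^esub> (y \<otimes>\<^bsub>A\<^esub> u))}"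

definition loc_frac :: "('a, 'l) ring_scheme \<Rightarrow> 'a \<Rightarrow> 'a \<Rightarrow> 'a \<Rightarrow> ('a \<times> 'a) set"
  where "loc_frac A s x u = loc_rel A s `` {(x, u)}"

definition localization :: "('a, 'l) ring_scheme \<Rightarrow> 'a \<Rightarrow> ('a \<times> 'a) set ring"
  where "localization A s =
    \<lparr>carrier = (carrier A \<times> powers_of A s) // loc_rel A s,
     monoid.mult = (\<lambda>U V. \<Union>(x, u)\<in>U. \<Union>(y, v)\<in>V. loc_frac A s (x \<otimes>\<^bsub>A\<^esub> y) (u \<otimes>\<^bsub>A\<^esub> v)),
     monoid.one = loc_frac A s \<one>\<^bsub>A\<^esub> \<one>\<^bsub>A\<^esub>,
     ring.zero = loc_frac A s \<zero>\<^bsub>A\<^esub> \<one>\<^bsub>A\<^esub>,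
     ring.add = (\<lambda>U V. \<Union>(x, u)\<in>U. \<Union>(y, v)\<in>V.
              loc_frac A s (x \<otimes>\<^bsub>A\<^esub> v \<oplus>\<^bsub>A\<^esub> y \<otimes>\<^bsub>A\<^esub> u) (u \<otimes>\<^bsub>A\<^esub> v))\<rparr>"

definition loc_map :: "('a, 'l) ring_scheme \<Rightarrow> 'a \<Rightarrow> 'a \<Rightarrow> ('a \<times> 'a) set"
  where "loc_map A s x = loc_frac A s x \<one>\<^bsub>A\<^esub>"

section \<open>Quotients of polynomial rings\<close>

definition pvar :: "('a, 'l) ring_scheme \<Rightarrow> nat \<Rightarrow> 'a"
  where "pvar A = up_ring.monom (UP A) \<one>\<^bsub>A\<^esub> 1"

definition pconst :: "('a, 'l) ring_scheme \<Rightarrow> 'a \<Rightarrow> nat \<Rightarrow> 'a"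
  where "pconst A c = up_ring.monom (UP A) c 0"

definition map_coeffs :: "('a, 'l) ring_scheme \<Rightarrow> ('a \<Rightarrow> 'b) \<Rightarrow> (nat \<Rightarrow> 'a) \<Rightarrow> nat \<Rightarrow> 'b"
  where "map_coeffs A h f = (\<lambda>n. h (up_ring.coeff (UP A) f n))"

definition poly_quot :: "('a, 'l) ring_scheme \<Rightarrow> (nat \<Rightarrow> 'a) \<Rightarrow> (nat \<Rightarrow> 'a) set ring"
  where "poly_quot A f = UP A Quot (PIdl\<^bsub>UP A\<^esub> f)"

definition poly_class :: "('a, 'l) ring_scheme \<Rightarrow> (nat \<Rightarrow> 'a) \<Rightarrow> (nat \<Rightarrow> 'a) \<Rightarrow> (nat \<Rightarrow> 'a) set"
  where "poly_class A f q = (PIdl\<^bsub>UP A\<^esub> f) +>\<^bsub>UP A\<^esub> q"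

definition quot_map :: "('a, 'l) ring_scheme \<Rightarrow> (nat \<Rightarrow> 'a) \<Rightarrow> 'a \<Rightarrow> (nat \<Rightarrow> 'a) set"
  where "quot_map A f c = poly_class A f (pconst A c)"

definition separable_poly :: "('a, 'l) ring_scheme \<Rightarrow> (nat \<Rightarrow> 'a) \<Rightarrow> bool"
  where "separable_poly A f \<longleftrightarrow> separable_algebra A (poly_quot A f) (quot_map A f)"

section \<open>The cyclic extension\<close>

definition primitive_root_of_one :: "nat \<Rightarrow> complex \<Rightarrow> bool"
  where "primitive_root_of_one n z \<longleftrightarrow> z ^ n = 1 \<and> (\<forall>k. 0 < k \<and> k < n \<longrightarrow> z ^ k \<noteq> 1)"

definition Zring :: "complex \<Rightarrow> complex ring"
  where "Zring \<rho> =
    (ring_of_type_algebra :: complex ring)\<lparr>carrier := generate_ring ring_of_type_algebra {\<rho>}\<rparr>"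

text \<open>The polynomial \<open>g\<close> over \<open>\<int>[\<rho>]\<close> with \<open>(1 + \<eta>Z)\<^sup>p = 1 + (g(Z) + Z\<^sup>p) \<eta>\<^sup>p\<close>, where \<open>\<eta> = \<rho> - 1\<close>.\<close>

definition g_poly :: "nat \<Rightarrow> complex \<Rightarrow> nat \<Rightarrow> complex"
  where "g_poly p \<rho> =
    (let A = Zring \<rho>; P = UP A; \<eta> = pconst A (\<rho> - 1); Z = pvar A in
     THE g. g \<in> carrier P \<and> deg A g < p \<and>
       (\<one>\<^bsub>P\<^esub> \<oplus>\<^bsub>P\<^esub> \<eta> \<otimes>\<^bsub>P\<^esub> Z) [^]\<^bsub>P\<^esub> p =
         \<one>\<^bsub>P\<^esub> \<oplus>\<^bsub>P\<^esub> (g \<oplus>\<^bsub>P\<^esub> Z [^]\<^bsub>P\<^esub> p) \<otimes>\<^bsub>P\<^esub> \<eta> [^]\<^bsub>P\<^esub> p)"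

text \<open>
  Here \<open>h\<close> is the structure map of a \<open>\<int>[\<rho>]\<close>-algebra \<open>A\<close>, and \<open>b \<in> A\<close>; the polynomial is
  \<open>Z\<^sup>p + g(Z) - b\<close> and the element is \<open>1 + b\<eta>\<^sup>p\<close>.
\<close>

definition cyc_poly :: "nat \<Rightarrow> complex \<Rightarrow> ('a, 'l) ring_scheme \<Rightarrow> (complex \<Rightarrow> 'a) \<Rightarrow> 'a \<Rightarrow> nat \<Rightarrow> 'a"
  where "cyc_poly p \<rho> A h b =
    pvar A [^]\<^bsub>UP A\<^esub> p \<oplus>\<^bsub>UP A\<^esub> map_coeffs (Zring \<rho>) h (g_poly p \<rho>) \<ominus>\<^bsub>UP A\<^esub> pconst A b"

definition cyc_elt :: "nat \<Rightarrow> complex \<Rightarrow> ('a, 'l) ring_scheme \<Rightarrow> (complex \<Rightarrow> 'a) \<Rightarrow> 'a \<Rightarrow> 'a"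
  where "cyc_elt p \<rho> A h b = \<one>\<^bsub>A\<^esub> \<oplus>\<^bsub>A\<^esub> b \<otimes>\<^bsub>A\<^esub> h (\<rho> - 1) [^]\<^bsub>A\<^esub> p"

abbreviation R0 :: "complex \<Rightarrow> (complex, nat \<Rightarrow> complex) up_ring"
  where "R0 \<rho> \<equiv> UP (Zring \<rho>)"

abbreviation R0_const :: "complex \<Rightarrow> complex \<Rightarrow> nat \<Rightarrow> complex"
  where "R0_const \<rho> \<equiv> pconst (Zring \<rho>)"

abbreviation R0_var :: "complex \<Rightarrow> nat \<Rightarrow> complex"
  where "R0_var \<rho> \<equiv> pvar (Zring \<rho>)"

text \<open>
  The universal case: \<open>R\<^sub>0 = \<int>[\<rho>][a]\<close>, \<open>R = R\<^sub>0(1/(1 + a\<eta>\<^sup>p))\<close> with the map \<open>uni_loc\<close> from \<open>R\<^sub>0\<close>,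
  and \<open>T = R[Z]/(Z\<^sup>p + g(Z) - a)\<close> with structure map \<open>uni_map\<close> and \<open>\<theta>\<close> the class of \<open>Z\<close>.
\<close>

type_synonym uni_base = "((nat \<Rightarrow> complex) \<times> (nat \<Rightarrow> complex)) set"

definition uni_elt :: "nat \<Rightarrow> complex \<Rightarrow> nat \<Rightarrow> complex"
  where "uni_elt p \<rho> = cyc_elt p \<rho> (R0 \<rho>) (R0_const \<rho>) (R0_var \<rho>)"

definition uni_R :: "nat \<Rightarrow> complex \<Rightarrow> uni_base ring"
  where "uni_R p \<rho> = localization (R0 \<rho>) (uni_elt p \<rho>)"

definition uni_loc :: "nat \<Rightarrow> complex \<Rightarrow> (nat \<Rightarrow> complex) \<Rightarrow> uni_base"
  where "uni_loc p \<rho> = loc_map (R0 \<rho>) (uni_elt p \<rho>)"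

definition uni_poly :: "nat \<Rightarrow> complex \<Rightarrow> nat \<Rightarrow> uni_base"
  where "uni_poly p \<rho> =
    cyc_poly p \<rho> (uni_R p \<rho>) (\<lambda>c. uni_loc p \<rho> (R0_const \<rho> c)) (uni_loc p \<rho> (R0_var \<rho>))"

definition uni_T :: "nat \<Rightarrow> complex \<Rightarrow> (nat \<Rightarrow> uni_base) set ring"
  where "uni_T p \<rho> = poly_quot (uni_R p \<rho>) (uni_poly p \<rho>)"

definition uni_map :: "nat \<Rightarrow> complex \<Rightarrow> uni_base \<Rightarrow> (nat \<Rightarrow> uni_base) set"
  where "uni_map p \<rho> = quot_map (uni_R p \<rho>) (uni_poly p \<rho>)"

definition uni_theta :: "nat \<Rightarrow> complex \<Rightarrow> (nat \<Rightarrow> uni_base) set"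
  where "uni_theta p \<rho> = poly_class (uni_R p \<rho>) (uni_poly p \<rho>) (pvar (uni_R p \<rho>))"

definition is_sigma :: "nat \<Rightarrow> complex \<Rightarrow> ((nat \<Rightarrow> uni_base) set \<Rightarrow> (nat \<Rightarrow> uni_base) set) \<Rightarrow> bool"
  where "is_sigma p \<rho> \<sigma> \<longleftrightarrow>
    \<sigma> \<in> algebra_automorphisms (uni_R p \<rho>) (uni_T p \<rho>) (uni_map p \<rho>) \<and>
    \<sigma> (uni_theta p \<rho>) =
      uni_map p \<rho> (uni_loc p \<rho> (R0_const \<rho> \<rho>)) \<otimes>\<^bsub>uni_T p \<rho>\<^esub> uni_theta p \<rho>
        \<oplus>\<^bsub>uni_T p \<rho>\<^esub> \<one>\<^bsub>uni_T p \<rho>\<^esub>"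

definition psi_extension ::
    "nat \<Rightarrow> complex \<Rightarrow> ('a, 'l) ring_scheme \<Rightarrow> ((nat \<Rightarrow> complex) \<Rightarrow> 'a) \<Rightarrow> (uni_base \<Rightarrow> 'a) \<Rightarrow> bool"
  where "psi_extension p \<rho> A \<psi> \<Psi> \<longleftrightarrow>
    \<Psi> \<in> ring_hom (uni_R p \<rho>) A \<and> (\<forall>x\<in>carrier (R0 \<rho>). \<Psi> (uni_loc p \<rho> x) = \<psi> x)"

definition base_change ::
    "nat \<Rightarrow> complex \<Rightarrow> ('a, 'l) ring_scheme \<Rightarrow> (uni_base \<Rightarrow> 'a) \<Rightarrow>
     ((nat \<Rightarrow> uni_base) set \<times> 'a \<Rightarrow>\<^sub>0 int) set ring"
  where "base_change p \<rho> A \<Psi> = tensor_ring (uni_R p \<rho>) (uni_T p \<rho>) (uni_map p \<rho>) A \<Psi>"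

definition bc_tensor ::
    "nat \<Rightarrow> complex \<Rightarrow> ('a, 'l) ring_scheme \<Rightarrow> (uni_base \<Rightarrow> 'a) \<Rightarrow>
     (nat \<Rightarrow> uni_base) set \<Rightarrow> 'a \<Rightarrow> ((nat \<Rightarrow> uni_base) set \<times> 'a \<Rightarrow>\<^sub>0 int) set"
  where "bc_tensor p \<rho> A \<Psi> = pure_tensor (uni_R p \<rho>) (uni_T p \<rho>) (uni_map p \<rho>) A \<Psi>"

definition bc_map ::
    "nat \<Rightarrow> complex \<Rightarrow> ('a, 'l) ring_scheme \<Rightarrow> (uni_base \<Rightarrow> 'a) \<Rightarrow>
     'a \<Rightarrow> ((nat \<Rightarrow> uni_base) set \<times> 'a \<Rightarrow>\<^sub>0 int) set"
  where "bc_map p \<rho> A \<Psi> x = bc_tensor p \<rho> A \<Psi> \<one>\<^bsub>uni_T p \<rho>\<^esub> x"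

end

theory Submission
  imports Defs
begin

text \<open>
  Put \<open>F(Z) = Z\<^sup>p + g(Z)\<close>, so that \<open>(1 + \<eta>Z)\<^sup>p = 1 + F(Z)\<eta>\<^sup>p\<close>.  A root \<open>\<theta>\<close> of \<open>F - b\<close> thus gives a
  \<open>p\<close>-th root \<open>w = 1 + \<eta>\<theta>\<close> of \<open>1 + b\<eta>\<^sup>p\<close>, and multiplying \<open>w\<close> by \<open>\<rho>\<close> amounts to replacing \<open>\<theta>\<close> by
  \<open>\<rho>\<theta> + 1\<close>, which is again a root.  As \<open>p\<close> is a unit times \<open>\<eta>\<^sup>p\<^sup>-\<^sup>1\<close>, the derivative \<open>F'(\<theta>)\<close> is a unit times
  \<open>w\<^sup>p\<^sup>-\<^sup>1\<close>; it is invertible iff \<open>1 + b\<eta>\<^sup>p\<close> is, and this decides separability.  The conjugates satisfy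
  \<open>\<sigma>\<^sup>i\<theta> - \<sigma>\<^sup>j\<theta> = ((\<rho>\<^sup>i - \<rho>\<^sup>j)/\<eta>) w\<close> with \<open>(\<rho>\<^sup>i - \<rho>\<^sup>j)/\<eta>\<close> a unit of \<open>\<int>[\<rho>]\<close> for \<open>0 \<le> j < i < p\<close>, so by interpolation at the
  points \<open>\<sigma>\<^sup>i\<theta>\<close> the map \<open>T \<otimes> T \<rightarrow> T\<^sup>G\<close> is bijective.  Unit differences and the basis
  \<open>1, \<theta>, \<dots>, \<theta>\<^sup>p\<^sup>-\<^sup>1\<close> survive base change.  If \<open>\<eta>\<close> is invertible, \<open>w\<close> generates the same algebra as \<open>\<theta>\<close>.
\<close>

text \<open>The ring \<open>R'\<close> is arbitrary: \<open>\<eta>\<close> may be a zero divisor or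
  zero in it, and \<open>R'\<close> may be the zero ring. So identities in \<open>R'\<close> cannot
  be won by cancelling powers of \<open>\<eta>\<close>. Those about \<open>F\<close> are proved for
  complex polynomials, where division is harmless; their coefficients are shown to lie in
  \<open>\<int>[\<rho>]\<close>, and only then are they evaluated in an algebra. Units of
  \<open>\<int>[\<rho>]\<close> come with an explicit inverse for the same reason. Linear algebra is
  done with coefficient lists of a fixed length, evaluated by Horner's scheme. This stays meaningful
  over the zero ring, where degrees and the distinctness of powers carry no information.
  Separability first shows that \<open>1 + b\<eta>^p\<close> is a unit of the quotient algebra; it
  descends to the base because 1 belongs to a basis. The group always lives on the universal
  \<open>T\<close>, whose base is nonzero, which forces order \<open>p\<close>. After base change it
  may act trivially, but it still has as many elements as the coefficient lists have
  entries.\<close>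

lemma quotient_ring_hom_factor:
  assumes "ideal I A" "ring S" "f \<in> ring_hom A S" "\<And>i. i \<in> I \<Longrightarrow> f i = \<zero>\<^bsub>S\<^esub>"
  shows "\<exists>F \<in> ring_hom (A Quot I) S. \<forall>a\<in>carrier A. F (I +>\<^bsub>A\<^esub> a) = f a"
proof -
  interpret I: ideal I A by fact
  interpret S: ring S by fact
  interpret f: ring_hom_ring A S f
    using assms(3) by (intro ring_hom_ringI2) unfold_locales
  have eq: "f a = f b" if "a \<in> carrier A" "b \<in> carrier A" "I +>\<^bsub>A\<^esub> a = I +>\<^bsub>A\<^esub> b" for a b
  proof -
    have "a \<ominus>\<^bsub>A\<^esub> b \<in> I"
      using that I.quotient_eq_iff_same_a_r_cos[OF I.is_ideal] by blast
    then have "f (a \<ominus>\<^bsub>A\<^esub> b) = \<zero>\<^bsub>S\<^esub>" by (rule assms(4))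
    then show ?thesis using that by (simp add: a_minus_def f.hom_a_inv) (metis S.minus_equality S.minus_minus f.hom_closed S.a_inv_closed)
  qed
  \<comment> \<open>\<open>F\<close> takes the value of \<open>f\<close> at a representative picked
    by \<open>inv_into\<close>; \<open>eq\<close> makes the pick irrelevant.\<close>
  have "\<exists>F. \<forall>a\<in>carrier A. F (I +>\<^bsub>A\<^esub> a) = f a"
  proof (intro exI ballI)
    fix a assume "a \<in> carrier A"
    then have "I +>\<^bsub>A\<^esub> a \<in> a_r_coset A I ` carrier A" by blast
    from eq[OF inv_into_into[OF this] \<open>a \<in> carrier A\<close> f_inv_into_f[OF this]]
    show "f (inv_into (carrier A) (a_r_coset A I) (I +>\<^bsub>A\<^esub> a)) = f a" .
  qed
  then obtain F where F: "\<And>a. a \<in> carrier A \<Longrightarrow> F (I +>\<^bsub>A\<^esub> a) = f a"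
    by blast
  have rep: "\<exists>a\<in>carrier A. x = I +>\<^bsub>A\<^esub> a" if "x \<in> carrier (A Quot I)" for x
    using that by (auto simp: FactRing_def A_RCOSETS_def')
  note Q = ring_hom_ring.homh[OF I.rcos_ring_hom_ring]
  have "F \<in> ring_hom (A Quot I) S"
  proof (rule ring_hom_memI)
    fix x assume "x \<in> carrier (A Quot I)"
    then show "F x \<in> carrier S" using rep F by force
  next
    fix x y assume "x \<in> carrier (A Quot I)" "y \<in> carrier (A Quot I)"
    then obtain a b where ab: "a \<in> carrier A" "x = I +>\<^bsub>A\<^esub> a" "b \<in> carrier A" "y = I +>\<^bsub>A\<^esub> b"
      using rep by meson
    then show "F (x \<otimes>\<^bsub>A Quot I\<^esub> y) = F x \<otimes>\<^bsub>S\<^esub> F y" "F (x \<oplus>\<^bsub>A Quot I\<^esub> y) = F x \<oplus>\<^bsub>S\<^esub> F y"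
      using F by (simp_all flip: ring_hom_mult[OF Q] ring_hom_add[OF Q])
  next
    show "F \<one>\<^bsub>A Quot I\<^esub> = \<one>\<^bsub>S\<^esub>" using F by (simp flip: ring_hom_one[OF Q])
  qed
  then show ?thesis using F by blast
qed

lemma quotient_carrierE:
  assumes "x \<in> carrier (A Quot I)"
  obtains a where "a \<in> carrier A" "x = I +>\<^bsub>A\<^esub> a"
  using assms by (auto simp: FactRing_def A_RCOSETS_def')

section \<open>Tensor products of commutative algebras\<close>

lemma pair_ring_simps [simp]:
  "x \<in> carrier (pair_ring A B) \<longleftrightarrow> Poly_Mapping.keys x \<subseteq> carrier A \<times> carrier B"
  "\<zero>\<^bsub>pair_ring A B\<^esub> = 0" "x \<oplus>\<^bsub>pair_ring A B\<^esub> y = x + y"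
  "\<one>\<^bsub>pair_ring A B\<^esub> = frag_of (\<one>\<^bsub>A\<^esub>, \<one>\<^bsub>B\<^esub>)"
  by (auto simp: pair_ring_def)

lemma pair_ring_mult_frag_of [simp]:
  "frag_of (a, b) \<otimes>\<^bsub>pair_ring A B\<^esub> frag_of (a', b') = frag_of (a \<otimes>\<^bsub>A\<^esub> a', b \<otimes>\<^bsub>B\<^esub> b')"
  by (simp add: pair_ring_def)

lemma pair_ring_mult_0 [simp]: "0 \<otimes>\<^bsub>pair_ring A B\<^esub> y = 0" "x \<otimes>\<^bsub>pair_ring A B\<^esub> 0 = 0"
  by (simp_all add: pair_ring_def frag_extend_eq_0 split_def)

text \<open>Stated for differences because \<open>frag_induction\<close> generates the free abelian
  group from basis elements by subtraction.\<close>

lemma pair_ring_mult_diff_left: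
  "(x - x') \<otimes>\<^bsub>pair_ring A B\<^esub> y = x \<otimes>\<^bsub>pair_ring A B\<^esub> y - x' \<otimes>\<^bsub>pair_ring A B\<^esub> y"
  by (simp add: pair_ring_def frag_extend_diff)

lemma frag_extend_diff_fun:
  "frag_extend (\<lambda>i. f i - g i) x = frag_extend f x - frag_extend g x"
  by (induction x rule: frag_induction[OF subset_UNIV]) (auto simp: frag_extend_diff)

lemma pair_ring_mult_diff_right:
  "x \<otimes>\<^bsub>pair_ring A B\<^esub> (y - y') = x \<otimes>\<^bsub>pair_ring A B\<^esub> y - x \<otimes>\<^bsub>pair_ring A B\<^esub> y'"
  by (simp add: pair_ring_def frag_extend_diff split_def flip: frag_extend_diff_fun)

lemma pair_ring_mult_add:
  fixes x x' y y' :: "'a \<times> 'b \<Rightarrow>\<^sub>0 int"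
  shows "(x + x') \<otimes>\<^bsub>pair_ring A B\<^esub> y = x \<otimes>\<^bsub>pair_ring A B\<^esub> y + x' \<otimes>\<^bsub>pair_ring A B\<^esub> y"
  "x \<otimes>\<^bsub>pair_ring A B\<^esub> (y + y') = x \<otimes>\<^bsub>pair_ring A B\<^esub> y + x \<otimes>\<^bsub>pair_ring A B\<^esub> y'"
proof -
  show "(x + x') \<otimes>\<^bsub>pair_ring A B\<^esub> y = x \<otimes>\<^bsub>pair_ring A B\<^esub> y + x' \<otimes>\<^bsub>pair_ring A B\<^esub> y"
    by (simp add: pair_ring_def frag_extend_add)
  have "x \<otimes>\<^bsub>pair_ring A B\<^esub> y = x \<otimes>\<^bsub>pair_ring A B\<^esub> (y + y') - x \<otimes>\<^bsub>pair_ring A B\<^esub> y'"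
    by (simp flip: pair_ring_mult_diff_right)
  then show "x \<otimes>\<^bsub>pair_ring A B\<^esub> (y + y') = x \<otimes>\<^bsub>pair_ring A B\<^esub> y + x \<otimes>\<^bsub>pair_ring A B\<^esub> y'"
    by simp
qed

text \<open>\<open>pair_ring A B\<close> is the integral monoid ring of the product of the
  multiplicative monoids of \<open>A\<close> and \<open>B\<close>. Multiplication is biadditive, so
  each axiom reduces to basis pairs, with one \<open>frag_induction\<close> per variable.\<close>

lemma cring_pair_ring:
  assumes "cring A" "cring B"
  shows "cring (pair_ring A B)"
proof -
  interpret A: cring A by fact
  interpret B: cring B by fact
  let ?S = "carrier A \<times> carrier B" and ?P = "pair_ring A B"
  have closed: "Poly_Mapping.keys (x \<otimes>\<^bsub>?P\<^esub> y) \<subseteq> ?S"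
    if "Poly_Mapping.keys x \<subseteq> ?S" "Poly_Mapping.keys y \<subseteq> ?S" for x y
    using that(1)
  proof (induction x rule: frag_induction)
    case (one u)
    show ?case using that(2)
    proof (induction y rule: frag_induction)
      case (one v) then show ?case using \<open>u \<in> ?S\<close> by (cases u, cases v) auto
    next
      case (diff a b) then show ?case
        using keys_diff[of "frag_of u \<otimes>\<^bsub>?P\<^esub> a" "frag_of u \<otimes>\<^bsub>?P\<^esub> b"]
        by (auto simp: pair_ring_mult_diff_right)
    qed simp
  next
    case (diff a b) then show ?case
      using keys_diff[of "a \<otimes>\<^bsub>?P\<^esub> y" "b \<otimes>\<^bsub>?P\<^esub> y"] by (auto simp: pair_ring_mult_diff_left)
  qed simp
  have assoc: "x \<otimes>\<^bsub>?P\<^esub> y \<otimes>\<^bsub>?P\<^esub> z = x \<otimes>\<^bsub>?P\<^esub> (y \<otimes>\<^bsub>?P\<^esub> z)"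
    if "Poly_Mapping.keys x \<subseteq> ?S" "Poly_Mapping.keys y \<subseteq> ?S" "Poly_Mapping.keys z \<subseteq> ?S" for x y z
    using that(1)
  proof (induction x rule: frag_induction)
    case (one u)
    show ?case using that(2)
    proof (induction y rule: frag_induction)
      case (one v)
      show ?case using that(3)
      proof (induction z rule: frag_induction)
        case (one w) then show ?case using \<open>u \<in> ?S\<close> \<open>v \<in> ?S\<close>
          by (cases u, cases v, cases w) (auto simp: A.m_assoc B.m_assoc)
      qed (simp_all add: pair_ring_mult_diff_right)
    qed (simp_all add: pair_ring_mult_diff_right pair_ring_mult_diff_left)
  qed (simp_all add: pair_ring_mult_diff_left)
  have comm: "x \<otimes>\<^bsub>?P\<^esub> y = y \<otimes>\<^bsub>?P\<^esub> x"
    if "Poly_Mapping.keys x \<subseteq> ?S" "Poly_Mapping.keys y \<subseteq> ?S" for x y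
    using that(1)
  proof (induction x rule: frag_induction)
    case (one u)
    show ?case using that(2)
    proof (induction y rule: frag_induction)
      case (one v) then show ?case using \<open>u \<in> ?S\<close>
        by (cases u, cases v) (auto simp: A.m_comm B.m_comm)
    qed (simp_all add: pair_ring_mult_diff_right pair_ring_mult_diff_left)
  qed (simp_all add: pair_ring_mult_diff_right pair_ring_mult_diff_left)
  have l_one: "\<one>\<^bsub>?P\<^esub> \<otimes>\<^bsub>?P\<^esub> x = x" if "Poly_Mapping.keys x \<subseteq> ?S" for x
    using that
  proof (induction x rule: frag_induction)
    case (one u) then show ?case by (cases u) auto
  qed (simp_all add: pair_ring_mult_diff_right)
  show ?thesis
  proof (rule cringI)
    show "abelian_group ?P"
    proof (rule abelian_groupI)
      fix x assume "x \<in> carrier ?P"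
      then show "\<exists>y\<in>carrier ?P. y \<oplus>\<^bsub>?P\<^esub> x = \<zero>\<^bsub>?P\<^esub>" by (intro bexI[of _ "- x"]) auto
    qed (auto simp: add_ac dest: subsetD[OF keys_add])
    show "comm_monoid ?P"
      using closed assoc comm l_one by (intro comm_monoidI) auto
  qed (simp add: pair_ring_mult_add)
qed

locale tensor_product = R: cring R + A: cring A + B: cring B
  for R :: "('r, 'k) ring_scheme" and A :: "('a, 'l) ring_scheme" and h :: "'r \<Rightarrow> 'a"
    and B :: "('b, 'm) ring_scheme" and k :: "'r \<Rightarrow> 'b" +
  assumes h: "h \<in> ring_hom R A" and k: "k \<in> ring_hom R B"
begin

abbreviation T where "T \<equiv> tensor_ring R A h B k"
abbreviation J where "J \<equiv> tensor_ideal R A h B k"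
abbreviation t where "t \<equiv> pure_tensor R A h B k"

sublocale P: cring "pair_ring A B"
  by (rule cring_pair_ring) unfold_locales

lemma bilinear_relations_subset: "bilinear_relations R A h B k \<subseteq> carrier (pair_ring A B)"
  using ring_hom_closed[OF h] ring_hom_closed[OF k]
  by (auto simp: bilinear_relations_def dest!: subsetD[OF keys_diff])

sublocale J: ideal J "pair_ring A B"
  unfolding tensor_ideal_def by (rule P.genideal_ideal[OF bilinear_relations_subset])

sublocale T: cring T
  unfolding tensor_ring_def by (rule J.quotient_is_cring) unfold_locales

sublocale proj: ring_hom_ring "pair_ring A B" T "a_r_coset (pair_ring A B) J"
  unfolding tensor_ring_def by (rule J.rcos_ring_hom_ring)

lemma pure_tensor_closed [simp, intro]: "a \<in> carrier A \<Longrightarrow> b \<in> carrier B \<Longrightarrow> t a b \<in> carrier T"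
  unfolding pure_tensor_def by (intro proj.hom_closed) auto

lemma pure_tensor_mult:
  "\<lbrakk>a \<in> carrier A; a' \<in> carrier A; b \<in> carrier B; b' \<in> carrier B\<rbrakk> \<Longrightarrow>
    t (a \<otimes>\<^bsub>A\<^esub> a') (b \<otimes>\<^bsub>B\<^esub> b') = t a b \<otimes>\<^bsub>T\<^esub> t a' b'"
  unfolding pure_tensor_def by (subst proj.hom_mult[symmetric]) auto

lemma pure_tensor_one: "t \<one>\<^bsub>A\<^esub> \<one>\<^bsub>B\<^esub> = \<one>\<^bsub>T\<^esub>"
  unfolding pure_tensor_def using proj.hom_one by simp

text \<open>The bilinear relations all have the form \<open>x - y - z\<close>; the balancing
  relation fits with \<open>z = 0\<close>. One argument thus yields the three rules for pure
  tensors.\<close>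

lemma coset_eqI:
  assumes "x - y - z \<in> bilinear_relations R A h B k"
    "x \<in> carrier (pair_ring A B)" "y \<in> carrier (pair_ring A B)" "z \<in> carrier (pair_ring A B)"
  shows "J +>\<^bsub>pair_ring A B\<^esub> x = (J +>\<^bsub>pair_ring A B\<^esub> y) \<oplus>\<^bsub>T\<^esub> (J +>\<^bsub>pair_ring A B\<^esub> z)"
proof -
  let ?P = "pair_ring A B"
  have in_J: "x - y - z \<in> J"
    using P.genideal_self[OF bilinear_relations_subset] assms(1) by (auto simp: tensor_ideal_def)
  have "J +>\<^bsub>?P\<^esub> (x - y - z) = \<zero>\<^bsub>T\<^esub>"
    using in_J by (simp add: P.a_rcos_zero[OF J.is_ideal] tensor_ring_def FactRing_def)
  moreover have "x = (x - y - z) \<oplus>\<^bsub>?P\<^esub> (y \<oplus>\<^bsub>?P\<^esub> z)" by simp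
  moreover have "x - y - z \<in> carrier ?P" using in_J J.Icarr by blast
  ultimately show ?thesis
    using assms proj.hom_closed
    by (metis (no_types, lifting) P.a_closed T.l_zero proj.hom_add)
qed

lemma pure_tensor_add_left:
  "\<lbrakk>a \<in> carrier A; a' \<in> carrier A; b \<in> carrier B\<rbrakk> \<Longrightarrow> t (a \<oplus>\<^bsub>A\<^esub> a') b = t a b \<oplus>\<^bsub>T\<^esub> t a' b"
  unfolding pure_tensor_def by (rule coset_eqI) (auto simp: bilinear_relations_def)

lemma pure_tensor_add_right:
  "\<lbrakk>a \<in> carrier A; b \<in> carrier B; b' \<in> carrier B\<rbrakk> \<Longrightarrow> t a (b \<oplus>\<^bsub>B\<^esub> b') = t a b \<oplus>\<^bsub>T\<^esub> t a b'"
  unfolding pure_tensor_def by (rule coset_eqI) (auto simp: bilinear_relations_def)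

lemma pure_tensor_balanced:
  assumes "r \<in> carrier R" "a \<in> carrier A" "b \<in> carrier B"
  shows "t (h r \<otimes>\<^bsub>A\<^esub> a) b = t a (k r \<otimes>\<^bsub>B\<^esub> b)"
proof -
  note c = assms ring_hom_closed[OF h] ring_hom_closed[OF k]
  have "frag_of (h r \<otimes>\<^bsub>A\<^esub> a, b) - frag_of (a, k r \<otimes>\<^bsub>B\<^esub> b) - 0 \<in> bilinear_relations R A h B k"
    using assms by (auto simp: bilinear_relations_def)
  from coset_eqI[OF this] c have "t (h r \<otimes>\<^bsub>A\<^esub> a) b = t a (k r \<otimes>\<^bsub>B\<^esub> b) \<oplus>\<^bsub>T\<^esub> \<zero>\<^bsub>T\<^esub>"
    using proj.hom_zero by (simp add: pure_tensor_def)
  then show ?thesis using c by simp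
qed

lemma left_hom: "(\<lambda>a. t a \<one>\<^bsub>B\<^esub>) \<in> ring_hom A T"
  using pure_tensor_mult[of _ _ "\<one>\<^bsub>B\<^esub>" "\<one>\<^bsub>B\<^esub>"]
  by (intro ring_hom_memI) (auto simp: pure_tensor_one pure_tensor_add_left)

lemma right_hom: "(\<lambda>b. t \<one>\<^bsub>A\<^esub> b) \<in> ring_hom B T"
  using pure_tensor_mult[of "\<one>\<^bsub>A\<^esub>" "\<one>\<^bsub>A\<^esub>"]
  by (intro ring_hom_memI) (auto simp: pure_tensor_one pure_tensor_add_right)

lemma pure_tensor_eq_mult:
  "a \<in> carrier A \<Longrightarrow> b \<in> carrier B \<Longrightarrow> t a b = t a \<one>\<^bsub>B\<^esub> \<otimes>\<^bsub>T\<^esub> t \<one>\<^bsub>A\<^esub> b"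
  by (simp flip: pure_tensor_mult)

lemma pure_tensor_base: "r \<in> carrier R \<Longrightarrow> t (h r) \<one>\<^bsub>B\<^esub> = t \<one>\<^bsub>A\<^esub> (k r)"
  using pure_tensor_balanced[of r "\<one>\<^bsub>A\<^esub>" "\<one>\<^bsub>B\<^esub>"] ring_hom_closed[OF h] ring_hom_closed[OF k] by simp

text \<open>Subtraction alone closes the induction, since the pure tensors generate \<open>T\<close>
  as an abelian group.\<close>

lemma tensor_induct [consumes 1, case_names pure diff]:
  assumes "x \<in> carrier T"
    and pure: "\<And>a b. a \<in> carrier A \<Longrightarrow> b \<in> carrier B \<Longrightarrow> Q (t a b)"
    and diff: "\<And>x y. \<lbrakk>x \<in> carrier T; y \<in> carrier T; Q x; Q y\<rbrakk> \<Longrightarrow> Q (x \<ominus>\<^bsub>T\<^esub> y)"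
  shows "Q x"
proof -
  let ?P = "pair_ring A B"
  obtain u where u: "u \<in> carrier ?P" "x = J +>\<^bsub>?P\<^esub> u"
    using assms(1) unfolding tensor_ring_def by (rule quotient_carrierE)
  \<comment> \<open>Zero is the difference of a pure tensor with itself, which spares the rule a
    third case.\<close>
  have "Q (t \<zero>\<^bsub>A\<^esub> \<zero>\<^bsub>B\<^esub> \<ominus>\<^bsub>T\<^esub> t \<zero>\<^bsub>A\<^esub> \<zero>\<^bsub>B\<^esub>)" by (intro diff pure) auto
  then have zero: "Q \<zero>\<^bsub>T\<^esub>" by (simp add: a_minus_def T.r_neg)
  have "Poly_Mapping.keys u \<subseteq> carrier A \<times> carrier B" using u by simp
  then have "u \<in> carrier ?P \<and> Q (J +>\<^bsub>?P\<^esub> u)"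
  proof (induction u rule: frag_induction)
    case zero then show ?case using \<open>Q \<zero>\<^bsub>T\<^esub>\<close> proj.hom_zero by simp
  next
    case (one v) then show ?case using pure by (cases v) (auto simp: pure_tensor_def)
  next
    case (diff a b)
    have keys: "a - b \<in> carrier ?P" using diff keys_diff[of a b] by auto
    have "a = (a - b) \<oplus>\<^bsub>?P\<^esub> b" by simp
    then have "J +>\<^bsub>?P\<^esub> a = (J +>\<^bsub>?P\<^esub> (a - b)) \<oplus>\<^bsub>T\<^esub> (J +>\<^bsub>?P\<^esub> b)"
      using proj.hom_add keys diff by metis
    moreover have "J +>\<^bsub>?P\<^esub> (a - b) \<in> carrier T" "J +>\<^bsub>?P\<^esub> a \<in> carrier T" "J +>\<^bsub>?P\<^esub> b \<in> carrier T"
      using keys diff proj.hom_closed by blast+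
    ultimately have "J +>\<^bsub>?P\<^esub> (a - b) = (J +>\<^bsub>?P\<^esub> a) \<ominus>\<^bsub>T\<^esub> (J +>\<^bsub>?P\<^esub> b)"
      unfolding a_minus_def using T.add.inv_solve_right by metis
    then show ?case using keys diff assms(3) proj.hom_closed by auto
  qed
  then show ?thesis using u by simp
qed

lemma ring_hom_tensor_eqI:
  assumes "ring S" "F \<in> ring_hom T S" "G \<in> ring_hom T S"
    and "\<And>a b. a \<in> carrier A \<Longrightarrow> b \<in> carrier B \<Longrightarrow> F (t a b) = G (t a b)" and "x \<in> carrier T"
  shows "F x = G x"
proof -
  interpret F: ring_hom_ring T S F
    using assms by (intro ring_hom_ringI2) (auto intro: T.ring_axioms)
  interpret G: ring_hom_ring T S G
    using assms by (intro ring_hom_ringI2) (auto intro: T.ring_axioms)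
  show ?thesis using assms(5)
    by (induction rule: tensor_induct) (auto simp: assms(4) a_minus_def)
qed

text \<open>Freeness of the group on pairs gives an additive \<open>f\<close> with value
  \<open>u a\<close> times \<open>v b\<close> at \<open>(a, b)\<close>. It is multiplicative because
  \<open>S\<close> is commutative, and \<open>uv\<close> makes it vanish on the balancing relations.
  Its kernel is an ideal, so it contains the ideal that the relations generate.\<close>

lemma tensor_universal:
  assumes "cring S" and u: "u \<in> ring_hom A S" and v: "v \<in> ring_hom B S"
    and uv: "\<And>r. r \<in> carrier R \<Longrightarrow> u (h r) = v (k r)"
  shows "\<exists>F \<in> ring_hom T S. \<forall>a\<in>carrier A. \<forall>b\<in>carrier B. F (t a b) = u a \<otimes>\<^bsub>S\<^esub> v b"
proof -
  let ?P = "pair_ring A B" and ?X = "carrier A \<times> carrier B"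
  interpret S: cring S by fact
  interpret u: ring_hom_ring A S u
    using u by (intro ring_hom_ringI2) (auto intro: A.ring_axioms S.ring_axioms)
  interpret v: ring_hom_ring B S v
    using v by (intro ring_hom_ringI2) (auto intro: B.ring_axioms S.ring_axioms)
  obtain f where f: "f \<in> hom (free_Abelian_group ?X) (add_monoid S)"
    "\<And>x. x \<in> ?X \<Longrightarrow> f (frag_of x) = (case x of (a, b) \<Rightarrow> u a \<otimes>\<^bsub>S\<^esub> v b)"
  proof (rule comm_group.free_Abelian_group_universal[OF S.a_comm_group,
        of "\<lambda>(a, b). u a \<otimes>\<^bsub>S\<^esub> v b" ?X])
    show "(\<lambda>(a, b). u a \<otimes>\<^bsub>S\<^esub> v b) ` ?X \<subseteq> carrier (add_monoid S)" by auto
  qed (rule that)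
  have closed: "f x \<in> carrier S" if "Poly_Mapping.keys x \<subseteq> ?X" for x
    using hom_in_carrier[OF f(1)] that by simp
  have add: "f (x + y) = f x \<oplus>\<^bsub>S\<^esub> f y"
    if "Poly_Mapping.keys x \<subseteq> ?X" "Poly_Mapping.keys y \<subseteq> ?X" for x y
    using hom_mult[OF f(1), of x y] that by simp
  have diff: "f (x - y) = f x \<ominus>\<^bsub>S\<^esub> f y" "Poly_Mapping.keys (x - y) \<subseteq> ?X"
    if "Poly_Mapping.keys x \<subseteq> ?X" "Poly_Mapping.keys y \<subseteq> ?X" for x y
  proof -
    show *: "Poly_Mapping.keys (x - y) \<subseteq> ?X" using that keys_diff[of x y] by auto
    show "f (x - y) = f x \<ominus>\<^bsub>S\<^esub> f y"
      using add[OF * that(2)] closed[OF *] closed[OF that(1)] closed[OF that(2)] by simp algebra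
  qed
  have zero: "f 0 = \<zero>\<^bsub>S\<^esub>" using diff(1)[of 0 0] closed[of 0] by (simp add: a_minus_def S.r_neg)
  have mult: "f (x \<otimes>\<^bsub>?P\<^esub> y) = f x \<otimes>\<^bsub>S\<^esub> f y"
    if "Poly_Mapping.keys x \<subseteq> ?X" "Poly_Mapping.keys y \<subseteq> ?X" for x y
  proof -
    have "Poly_Mapping.keys x \<subseteq> ?X \<and> f (x \<otimes>\<^bsub>?P\<^esub> y) = f x \<otimes>\<^bsub>S\<^esub> f y"
      using that(1)
    proof (induction x rule: frag_induction)
      case zero then show ?case using \<open>f 0 = \<zero>\<^bsub>S\<^esub>\<close> closed[OF that(2)] by simp
    next
      case (one w)
      have "Poly_Mapping.keys y \<subseteq> ?X \<and> f (frag_of w \<otimes>\<^bsub>?P\<^esub> y) = f (frag_of w) \<otimes>\<^bsub>S\<^esub> f y"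
        using that(2)
      proof (induction y rule: frag_induction)
        case zero then show ?case using \<open>f 0 = \<zero>\<^bsub>S\<^esub>\<close> closed[of "frag_of w"] one by simp
      next
        case (one w') then show ?case using \<open>w \<in> ?X\<close>
          by (cases w, cases w') (auto simp: f(2) S.m_ac)
      next
        case (diff a b)
        have "frag_of w \<otimes>\<^bsub>?P\<^esub> a \<in> carrier ?P" "frag_of w \<otimes>\<^bsub>?P\<^esub> b \<in> carrier ?P"
          using diff \<open>w \<in> ?X\<close> by (intro P.m_closed; simp)+
        then show ?case
          using diff \<open>w \<in> ?X\<close> \<open>\<And>x y. \<lbrakk>Poly_Mapping.keys x \<subseteq> ?X; Poly_Mapping.keys y \<subseteq> ?X\<rbrakk> \<Longrightarrow> f (x - y) = f x \<ominus>\<^bsub>S\<^esub> f y\<close>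
            \<open>\<And>x y. \<lbrakk>Poly_Mapping.keys x \<subseteq> ?X; Poly_Mapping.keys y \<subseteq> ?X\<rbrakk> \<Longrightarrow> Poly_Mapping.keys (x - y) \<subseteq> ?X\<close>
            closed[of a] closed[of b] closed[of "frag_of w"]
          by (simp add: pair_ring_mult_diff_right) algebra
      qed
      then show ?case using one by simp
    next
      case (diff a b)
      have "a \<otimes>\<^bsub>?P\<^esub> y \<in> carrier ?P" "b \<otimes>\<^bsub>?P\<^esub> y \<in> carrier ?P"
        using diff that(2) by (intro P.m_closed; simp)+
      then show ?case
        using diff \<open>\<And>x y. \<lbrakk>Poly_Mapping.keys x \<subseteq> ?X; Poly_Mapping.keys y \<subseteq> ?X\<rbrakk> \<Longrightarrow> f (x - y) = f x \<ominus>\<^bsub>S\<^esub> f y\<close>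
            \<open>\<And>x y. \<lbrakk>Poly_Mapping.keys x \<subseteq> ?X; Poly_Mapping.keys y \<subseteq> ?X\<rbrakk> \<Longrightarrow> Poly_Mapping.keys (x - y) \<subseteq> ?X\<close>
            closed[of a] closed[of b] closed[OF that(2)]
        by (simp add: pair_ring_mult_diff_left) algebra
    qed
    then show ?thesis by simp
  qed
  have hom: "f \<in> ring_hom ?P S"
    by (rule ring_hom_memI) (auto simp: closed mult add f(2))
  interpret f: ring_hom_ring ?P S f
    using hom by (intro ring_hom_ringI2) (auto intro: P.ring_axioms S.ring_axioms)
  have "bilinear_relations R A h B k \<subseteq> a_kernel ?P S f"
  proof
    fix x assume x: "x \<in> bilinear_relations R A h B k"
    note c = ring_hom_closed[OF h] ring_hom_closed[OF k]
    consider (add_left) a a' b where "a \<in> carrier A" "a' \<in> carrier A" "b \<in> carrier B"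
        "x = frag_of (a \<oplus>\<^bsub>A\<^esub> a', b) - frag_of (a, b) - frag_of (a', b)"
      | (add_right) a b b' where "a \<in> carrier A" "b \<in> carrier B" "b' \<in> carrier B"
        "x = frag_of (a, b \<oplus>\<^bsub>B\<^esub> b') - frag_of (a, b) - frag_of (a, b')"
      | (balanced) r a b where "r \<in> carrier R" "a \<in> carrier A" "b \<in> carrier B"
        "x = frag_of (h r \<otimes>\<^bsub>A\<^esub> a, b) - frag_of (a, k r \<otimes>\<^bsub>B\<^esub> b)"
      using x unfolding bilinear_relations_def by auto
    then have "f x = \<zero>\<^bsub>S\<^esub>"
    proof cases
      case add_left
      then have "f x = (u a \<oplus>\<^bsub>S\<^esub> u a') \<otimes>\<^bsub>S\<^esub> v b \<ominus>\<^bsub>S\<^esub> u a \<otimes>\<^bsub>S\<^esub> v b \<ominus>\<^bsub>S\<^esub> u a' \<otimes>\<^bsub>S\<^esub> v b"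
        by (simp add: diff f(2))
      moreover have "u a \<in> carrier S" "u a' \<in> carrier S" "v b \<in> carrier S" using add_left by auto
      ultimately show ?thesis by algebra
    next
      case add_right
      then have "f x = u a \<otimes>\<^bsub>S\<^esub> (v b \<oplus>\<^bsub>S\<^esub> v b') \<ominus>\<^bsub>S\<^esub> u a \<otimes>\<^bsub>S\<^esub> v b \<ominus>\<^bsub>S\<^esub> u a \<otimes>\<^bsub>S\<^esub> v b'"
        by (simp add: diff f(2))
      moreover have "u a \<in> carrier S" "v b' \<in> carrier S" "v b \<in> carrier S" using add_right by auto
      ultimately show ?thesis by algebra
    next
      case balanced
      then have "f x = v (k r) \<otimes>\<^bsub>S\<^esub> u a \<otimes>\<^bsub>S\<^esub> v b \<ominus>\<^bsub>S\<^esub> u a \<otimes>\<^bsub>S\<^esub> (v (k r) \<otimes>\<^bsub>S\<^esub> v b)"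
        by (simp add: diff f(2) c uv)
      moreover have "u a \<in> carrier S" "v (k r) \<in> carrier S" "v b \<in> carrier S" using balanced c by auto
      ultimately show ?thesis by algebra
    qed
    then show "x \<in> a_kernel ?P S f"
      using subsetD[OF bilinear_relations_subset x] unfolding a_kernel_def' by blast
  qed
  then have "J \<subseteq> a_kernel ?P S f"
    unfolding tensor_ideal_def by (intro P.genideal_minimal f.kernel_is_ideal)
  then have "f x = \<zero>\<^bsub>S\<^esub>" if "x \<in> J" for x
    using that unfolding a_kernel_def' by blast
  from quotient_ring_hom_factor[OF J.is_ideal S.ring_axioms hom this]
  obtain F where "F \<in> ring_hom T S" "\<forall>a\<in>carrier ?P. F (J +>\<^bsub>?P\<^esub> a) = f a"
    unfolding tensor_ring_def by blast
  then show ?thesis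
    by (intro bexI[of _ F]) (auto simp: pure_tensor_def f(2))
qed

end

lemma (in comm_monoid) comm_UnitsI:
  "\<lbrakk>x \<otimes> y = \<one>; x \<in> carrier G; y \<in> carrier G\<rbrakk> \<Longrightarrow> x \<in> Units G"
  unfolding Units_def using m_comm[of x y] by auto

section \<open>Localization at one element\<close>

locale localized = A: cring A for A :: "('a, 'l) ring_scheme" +
  fixes s assumes s [simp, intro]: "s \<in> carrier A"
begin

abbreviation S where "S \<equiv> powers_of A s"
abbreviation L where "L \<equiv> localization A s"
abbreviation frac where "frac \<equiv> loc_frac A s"

lemma powers_closed [simp]: "u \<in> S \<Longrightarrow> u \<in> carrier A"
  by (auto simp: powers_of_def)

lemma powers_mult [simp]: "u \<in> S \<Longrightarrow> v \<in> S \<Longrightarrow> u \<otimes>\<^bsub>A\<^esub> v \<in> S"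
  by (auto simp: powers_of_def A.nat_pow_mult)

lemma powers_one [simp, intro]: "\<one>\<^bsub>A\<^esub> \<in> S"
  by (auto simp: powers_of_def intro!: exI[of _ "0::nat"])

lemma powers_self [simp, intro]: "s \<in> S"
  by (auto simp: powers_of_def intro!: exI[of _ "1::nat"])

lemma equiv_loc_rel: "equiv (carrier A \<times> S) (loc_rel A s)"
proof (rule equivI)
  show "loc_rel A s \<subseteq> (carrier A \<times> S) \<times> (carrier A \<times> S)" by (auto simp: loc_rel_def)
  show "refl_on (carrier A \<times> S) (loc_rel A s)" by (auto simp: loc_rel_def refl_on_def)
  show "sym (loc_rel A s)" by (auto simp: loc_rel_def sym_def) metis
  show "trans (loc_rel A s)"
  proof (rule transI, clarify)
    fix x u y v z w
    assume "((x, u), (y, v)) \<in> loc_rel A s" "((y, v), (z, w)) \<in> loc_rel A s"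
    then obtain c d where c: "c \<in> S" "c \<otimes>\<^bsub>A\<^esub> (x \<otimes>\<^bsub>A\<^esub> v) = c \<otimes>\<^bsub>A\<^esub> (y \<otimes>\<^bsub>A\<^esub> u)"
      and d: "d \<in> S" "d \<otimes>\<^bsub>A\<^esub> (y \<otimes>\<^bsub>A\<^esub> w) = d \<otimes>\<^bsub>A\<^esub> (z \<otimes>\<^bsub>A\<^esub> v)"
      and m: "x \<in> carrier A" "y \<in> carrier A" "z \<in> carrier A" "u \<in> S" "v \<in> S" "w \<in> S"
      by (auto simp: loc_rel_def)
    \<comment> \<open>The witness needs the factor \<open>v\<close>: the two given equations can be
      chained only after multiplication by it, and \<open>v\<close> may be a zero divisor.\<close>
    have "(c \<otimes>\<^bsub>A\<^esub> d \<otimes>\<^bsub>A\<^esub> v) \<otimes>\<^bsub>A\<^esub> (x \<otimes>\<^bsub>A\<^esub> w) = (c \<otimes>\<^bsub>A\<^esub> (x \<otimes>\<^bsub>A\<^esub> v)) \<otimes>\<^bsub>A\<^esub> (d \<otimes>\<^bsub>A\<^esub> w)"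
      using c(1) d(1) m by (simp add: A.m_ac)
    also have "\<dots> = (d \<otimes>\<^bsub>A\<^esub> (y \<otimes>\<^bsub>A\<^esub> w)) \<otimes>\<^bsub>A\<^esub> (c \<otimes>\<^bsub>A\<^esub> u)"
      unfolding c using c(1) d(1) m by (simp add: A.m_ac)
    also have "\<dots> = (c \<otimes>\<^bsub>A\<^esub> d \<otimes>\<^bsub>A\<^esub> v) \<otimes>\<^bsub>A\<^esub> (z \<otimes>\<^bsub>A\<^esub> u)"
      unfolding d using c(1) d(1) m by (simp add: A.m_ac)
    finally show "((x, u), (z, w)) \<in> loc_rel A s"
      using c(1) d(1) m by (auto simp: loc_rel_def intro!: bexI[of _ "c \<otimes>\<^bsub>A\<^esub> d \<otimes>\<^bsub>A\<^esub> v"])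
  qed
qed

lemma frac_eq_iff:
  assumes "x \<in> carrier A" "u \<in> S" "y \<in> carrier A" "v \<in> S"
  shows "frac x u = frac y v \<longleftrightarrow>
    (\<exists>w\<in>S. w \<otimes>\<^bsub>A\<^esub> (x \<otimes>\<^bsub>A\<^esub> v) = w \<otimes>\<^bsub>A\<^esub> (y \<otimes>\<^bsub>A\<^esub> u))"
  unfolding loc_frac_def using assms
  by (subst eq_equiv_class_iff[OF equiv_loc_rel]) (auto simp: loc_rel_def)

lemma frac_eqI:
  assumes "x \<in> carrier A" "u \<in> S" "y \<in> carrier A" "v \<in> S" "x \<otimes>\<^bsub>A\<^esub> v = y \<otimes>\<^bsub>A\<^esub> u"
  shows "frac x u = frac y v"
  unfolding frac_eq_iff[OF assms(1-4)] assms(5) by (rule bexI[OF refl powers_one])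

lemma mem_frac:
  assumes "x \<in> carrier A" "u \<in> S"
  shows "q \<in> frac x u \<longleftrightarrow> (\<exists>y\<in>carrier A. \<exists>v\<in>S. q = (y, v) \<and> frac x u = frac y v)"
proof
  assume "q \<in> frac x u"
  then have q: "((x, u), q) \<in> loc_rel A s" by (simp add: loc_frac_def)
  then have "q \<in> carrier A \<times> S" by (auto simp: loc_rel_def)
  moreover have "frac x u = loc_rel A s `` {q}"
    unfolding loc_frac_def by (rule equiv_class_eq[OF equiv_loc_rel q])
  ultimately show "\<exists>y\<in>carrier A. \<exists>v\<in>S. q = (y, v) \<and> frac x u = frac y v"
    unfolding loc_frac_def by blast
next
  assume "\<exists>y\<in>carrier A. \<exists>v\<in>S. q = (y, v) \<and> frac x u = frac y v"
  then obtain y v where q: "y \<in> carrier A" "v \<in> S" "q = (y, v)"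
    "loc_rel A s `` {(x, u)} = loc_rel A s `` {(y, v)}"
    unfolding loc_frac_def by blast
  then have "((x, u), (y, v)) \<in> loc_rel A s"
    using assms by (simp add: eq_equiv_class_iff[OF equiv_loc_rel])
  then show "q \<in> frac x u" unfolding q(3) loc_frac_def by blast
qed

lemma frac_closed [simp, intro]: "x \<in> carrier A \<Longrightarrow> u \<in> S \<Longrightarrow> frac x u \<in> carrier L"
  by (auto simp: localization_def loc_frac_def quotient_def)

lemma fracE:
  assumes "q \<in> carrier L"
  obtains x u where "x \<in> carrier A" "u \<in> S" "q = frac x u"
proof -
  from assms obtain p where "p \<in> carrier A \<times> S" "q = loc_rel A s `` {p}"
    unfolding localization_def quotient_def by auto
  then show thesis using that[of "fst p" "snd p"] unfolding loc_frac_def by auto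
qed

text \<open>The operations of \<open>localization\<close> are unions over all representatives. If
  the body does not depend on them, this is a union of copies of one set, over an index set that is
  nonempty because a fraction contains its own representative.\<close>

lemma UN_frac:
  assumes "x \<in> carrier A" "u \<in> S" "y \<in> carrier A" "v \<in> S"
    and "\<And>x' u' y' v'. \<lbrakk>x' \<in> carrier A; u' \<in> S; y' \<in> carrier A; v' \<in> S;
      frac x u = frac x' u'; frac y v = frac y' v'\<rbrakk> \<Longrightarrow> f x' u' y' v' = f x u y v"
  shows "(\<Union>(x, u)\<in>frac x u. \<Union>(y, v)\<in>frac y v. f x u y v) = f x u y v"
proof -
  have ne: "frac x u \<noteq> {}" if "x \<in> carrier A" "u \<in> S" for x u
  proof -
    have "(x, u) \<in> frac x u" unfolding mem_frac[OF that] using that by fast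
    then show ?thesis by blast
  qed
  have "(case p of (x', u') \<Rightarrow> \<Union>(y, v)\<in>frac y v. f x' u' y v) = f x u y v"
    if p_in: "p \<in> frac x u" for p
  proof -
    obtain x' u' where p: "p = (x', u')" "x' \<in> carrier A" "u' \<in> S" "frac x u = frac x' u'"
      using p_in mem_frac[OF assms(1,2), of p] by blast
    have "(case q of (y', v') \<Rightarrow> f x' u' y' v') = f x u y v" if q_in: "q \<in> frac y v" for q
    proof -
      obtain y' v' where "q = (y', v')" "y' \<in> carrier A" "v' \<in> S" "frac y v = frac y' v'"
        using q_in mem_frac[OF assms(3,4), of q] by blast
      then show ?thesis using assms(5)[OF p(2,3)] p(4) by simp
    qed
    then show ?thesis unfolding p(1) prod.case by (rule SUP_eq_const[OF ne[OF assms(3,4)]])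
  qed
  then show ?thesis by (rule SUP_eq_const[OF ne[OF assms(1,2)]])
qed

lemma frac_mult:
  assumes "x \<in> carrier A" "u \<in> S" "y \<in> carrier A" "v \<in> S"
  shows "frac x u \<otimes>\<^bsub>L\<^esub> frac y v = frac (x \<otimes>\<^bsub>A\<^esub> y) (u \<otimes>\<^bsub>A\<^esub> v)"
proof -
  have "(\<Union>(x, u)\<in>frac x u. \<Union>(y, v)\<in>frac y v. frac (x \<otimes>\<^bsub>A\<^esub> y) (u \<otimes>\<^bsub>A\<^esub> v))
      = frac (x \<otimes>\<^bsub>A\<^esub> y) (u \<otimes>\<^bsub>A\<^esub> v)"
  proof (rule UN_frac[OF assms])
    fix x' u' y' v'
    assume m: "x' \<in> carrier A" "u' \<in> S" "y' \<in> carrier A" "v' \<in> S"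
      and "frac x u = frac x' u'" "frac y v = frac y' v'"
    then obtain c d where c: "c \<in> S" "c \<otimes>\<^bsub>A\<^esub> (x \<otimes>\<^bsub>A\<^esub> u') = c \<otimes>\<^bsub>A\<^esub> (x' \<otimes>\<^bsub>A\<^esub> u)"
      and d: "d \<in> S" "d \<otimes>\<^bsub>A\<^esub> (y \<otimes>\<^bsub>A\<^esub> v') = d \<otimes>\<^bsub>A\<^esub> (y' \<otimes>\<^bsub>A\<^esub> v)"
      using assms by (auto simp: frac_eq_iff)
    have "(c \<otimes>\<^bsub>A\<^esub> d) \<otimes>\<^bsub>A\<^esub> (x' \<otimes>\<^bsub>A\<^esub> y' \<otimes>\<^bsub>A\<^esub> (u \<otimes>\<^bsub>A\<^esub> v))
        = (c \<otimes>\<^bsub>A\<^esub> (x' \<otimes>\<^bsub>A\<^esub> u)) \<otimes>\<^bsub>A\<^esub> (d \<otimes>\<^bsub>A\<^esub> (y' \<otimes>\<^bsub>A\<^esub> v))"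
      using c(1) d(1) m assms by (simp add: A.m_ac)
    also have "\<dots> = (c \<otimes>\<^bsub>A\<^esub> d) \<otimes>\<^bsub>A\<^esub> (x \<otimes>\<^bsub>A\<^esub> y \<otimes>\<^bsub>A\<^esub> (u' \<otimes>\<^bsub>A\<^esub> v'))"
      unfolding c(2)[symmetric] d(2)[symmetric] using c(1) d(1) m assms by (simp add: A.m_ac)
    finally show "frac (x' \<otimes>\<^bsub>A\<^esub> y') (u' \<otimes>\<^bsub>A\<^esub> v') = frac (x \<otimes>\<^bsub>A\<^esub> y) (u \<otimes>\<^bsub>A\<^esub> v)"
      using c(1) d(1) m assms by (subst frac_eq_iff) (auto intro!: bexI[of _ "c \<otimes>\<^bsub>A\<^esub> d"])
  qed
  then show ?thesis by (simp add: localization_def)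
qed

lemma frac_add:
  assumes "x \<in> carrier A" "u \<in> S" "y \<in> carrier A" "v \<in> S"
  shows "frac x u \<oplus>\<^bsub>L\<^esub> frac y v = frac (x \<otimes>\<^bsub>A\<^esub> v \<oplus>\<^bsub>A\<^esub> y \<otimes>\<^bsub>A\<^esub> u) (u \<otimes>\<^bsub>A\<^esub> v)"
proof -
  have "(\<Union>(x, u)\<in>frac x u. \<Union>(y, v)\<in>frac y v. frac (x \<otimes>\<^bsub>A\<^esub> v \<oplus>\<^bsub>A\<^esub> y \<otimes>\<^bsub>A\<^esub> u) (u \<otimes>\<^bsub>A\<^esub> v))
      = frac (x \<otimes>\<^bsub>A\<^esub> v \<oplus>\<^bsub>A\<^esub> y \<otimes>\<^bsub>A\<^esub> u) (u \<otimes>\<^bsub>A\<^esub> v)"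
  proof (rule UN_frac[OF assms])
    fix x' u' y' v'
    assume m: "x' \<in> carrier A" "u' \<in> S" "y' \<in> carrier A" "v' \<in> S"
      and "frac x u = frac x' u'" "frac y v = frac y' v'"
    then obtain c d where c: "c \<in> S" "c \<otimes>\<^bsub>A\<^esub> (x \<otimes>\<^bsub>A\<^esub> u') = c \<otimes>\<^bsub>A\<^esub> (x' \<otimes>\<^bsub>A\<^esub> u)"
      and d: "d \<in> S" "d \<otimes>\<^bsub>A\<^esub> (y \<otimes>\<^bsub>A\<^esub> v') = d \<otimes>\<^bsub>A\<^esub> (y' \<otimes>\<^bsub>A\<^esub> v)"
      using assms by (auto simp: frac_eq_iff)
    have "(c \<otimes>\<^bsub>A\<^esub> d) \<otimes>\<^bsub>A\<^esub> ((x' \<otimes>\<^bsub>A\<^esub> v' \<oplus>\<^bsub>A\<^esub> y' \<otimes>\<^bsub>A\<^esub> u') \<otimes>\<^bsub>A\<^esub> (u \<otimes>\<^bsub>A\<^esub> v))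
        = (c \<otimes>\<^bsub>A\<^esub> (x' \<otimes>\<^bsub>A\<^esub> u)) \<otimes>\<^bsub>A\<^esub> (d \<otimes>\<^bsub>A\<^esub> v' \<otimes>\<^bsub>A\<^esub> v)
          \<oplus>\<^bsub>A\<^esub> (d \<otimes>\<^bsub>A\<^esub> (y' \<otimes>\<^bsub>A\<^esub> v)) \<otimes>\<^bsub>A\<^esub> (c \<otimes>\<^bsub>A\<^esub> u' \<otimes>\<^bsub>A\<^esub> u)"
      using c(1) d(1) m assms by (simp add: A.m_ac A.l_distr A.r_distr)
    also have "\<dots> = (c \<otimes>\<^bsub>A\<^esub> d) \<otimes>\<^bsub>A\<^esub> ((x \<otimes>\<^bsub>A\<^esub> v \<oplus>\<^bsub>A\<^esub> y \<otimes>\<^bsub>A\<^esub> u) \<otimes>\<^bsub>A\<^esub> (u' \<otimes>\<^bsub>A\<^esub> v'))"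
      unfolding c(2)[symmetric] d(2)[symmetric] using c(1) d(1) m assms
      by (simp add: A.m_ac A.l_distr A.r_distr)
    finally show "frac (x' \<otimes>\<^bsub>A\<^esub> v' \<oplus>\<^bsub>A\<^esub> y' \<otimes>\<^bsub>A\<^esub> u') (u' \<otimes>\<^bsub>A\<^esub> v') =
        frac (x \<otimes>\<^bsub>A\<^esub> v \<oplus>\<^bsub>A\<^esub> y \<otimes>\<^bsub>A\<^esub> u) (u \<otimes>\<^bsub>A\<^esub> v)"
      using c(1) d(1) m assms by (subst frac_eq_iff) (auto intro!: bexI[of _ "c \<otimes>\<^bsub>A\<^esub> d"])
  qed
  then show ?thesis by (simp add: localization_def)
qed

lemma one_eq_frac: "\<one>\<^bsub>L\<^esub> = frac \<one>\<^bsub>A\<^esub> \<one>\<^bsub>A\<^esub>" and zero_eq_frac: "\<zero>\<^bsub>L\<^esub> = frac \<zero>\<^bsub>A\<^esub> \<one>\<^bsub>A\<^esub>"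
  by (simp_all add: localization_def)

lemmas frac_ring_simps = frac_mult frac_add one_eq_frac zero_eq_frac

sublocale L: cring L
proof (rule cringI)
  show "abelian_group L"
  proof (rule abelian_groupI)
    fix x y assume "x \<in> carrier L" "y \<in> carrier L"
    then show "x \<oplus>\<^bsub>L\<^esub> y \<in> carrier L" by (elim fracE) (auto simp: frac_ring_simps)
    from \<open>x \<in> carrier L\<close> \<open>y \<in> carrier L\<close> show "x \<oplus>\<^bsub>L\<^esub> y = y \<oplus>\<^bsub>L\<^esub> x"
      by (elim fracE) (auto simp: frac_ring_simps A.m_ac A.a_ac)
  next
    fix x y z assume "x \<in> carrier L" "y \<in> carrier L" "z \<in> carrier L"
    then show "x \<oplus>\<^bsub>L\<^esub> y \<oplus>\<^bsub>L\<^esub> z = x \<oplus>\<^bsub>L\<^esub> (y \<oplus>\<^bsub>L\<^esub> z)"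
      by (elim fracE) (auto simp: frac_ring_simps A.m_ac A.a_ac A.l_distr A.r_distr)
  next
    fix x assume "x \<in> carrier L"
    then show "\<zero>\<^bsub>L\<^esub> \<oplus>\<^bsub>L\<^esub> x = x" by (elim fracE) (auto simp: frac_ring_simps)
    from \<open>x \<in> carrier L\<close> obtain a u where a: "a \<in> carrier A" "u \<in> S" "x = frac a u" by (rule fracE)
    then have "frac (\<ominus>\<^bsub>A\<^esub> a) u \<oplus>\<^bsub>L\<^esub> x = \<zero>\<^bsub>L\<^esub>"
      by (simp add: frac_ring_simps A.l_minus A.l_neg) (rule frac_eqI; simp)
    then show "\<exists>y\<in>carrier L. y \<oplus>\<^bsub>L\<^esub> x = \<zero>\<^bsub>L\<^esub>" using a by blast
  qed (auto simp: zero_eq_frac)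
  show "comm_monoid L"
  proof (rule comm_monoidI)
    fix x y assume "x \<in> carrier L" "y \<in> carrier L"
    then show "x \<otimes>\<^bsub>L\<^esub> y \<in> carrier L" by (elim fracE) (auto simp: frac_ring_simps)
    from \<open>x \<in> carrier L\<close> \<open>y \<in> carrier L\<close> show "x \<otimes>\<^bsub>L\<^esub> y = y \<otimes>\<^bsub>L\<^esub> x"
      by (elim fracE) (auto simp: frac_ring_simps A.m_ac)
  next
    fix x y z assume "x \<in> carrier L" "y \<in> carrier L" "z \<in> carrier L"
    then show "x \<otimes>\<^bsub>L\<^esub> y \<otimes>\<^bsub>L\<^esub> z = x \<otimes>\<^bsub>L\<^esub> (y \<otimes>\<^bsub>L\<^esub> z)"
      by (elim fracE) (auto simp: frac_ring_simps A.m_ac)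
  next
    fix x assume "x \<in> carrier L"
    then show "\<one>\<^bsub>L\<^esub> \<otimes>\<^bsub>L\<^esub> x = x" by (elim fracE) (auto simp: frac_ring_simps)
  qed (auto simp: one_eq_frac)
next
  fix x y z assume "x \<in> carrier L" "y \<in> carrier L" "z \<in> carrier L"
  then show "(x \<oplus>\<^bsub>L\<^esub> y) \<otimes>\<^bsub>L\<^esub> z = x \<otimes>\<^bsub>L\<^esub> z \<oplus>\<^bsub>L\<^esub> y \<otimes>\<^bsub>L\<^esub> z"
    by (elim fracE, simp add: frac_ring_simps) (rule frac_eqI; simp add: A.m_ac A.l_distr A.r_distr)
qed

lemma loc_map_hom: "loc_map A s \<in> ring_hom A L"
proof (rule ring_hom_memI)
  fix x y assume "x \<in> carrier A" "y \<in> carrier A"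
  then show "loc_map A s (x \<otimes>\<^bsub>A\<^esub> y) = loc_map A s x \<otimes>\<^bsub>L\<^esub> loc_map A s y"
    "loc_map A s (x \<oplus>\<^bsub>A\<^esub> y) = loc_map A s x \<oplus>\<^bsub>L\<^esub> loc_map A s y"
    by (simp_all add: loc_map_def frac_mult frac_add)
qed (simp_all add: loc_map_def one_eq_frac)

lemma loc_map_unit: "loc_map A s s \<in> Units L"
proof -
  have "frac s s = frac \<one>\<^bsub>A\<^esub> \<one>\<^bsub>A\<^esub>" by (rule frac_eqI) simp_all
  then have "frac s \<one>\<^bsub>A\<^esub> \<otimes>\<^bsub>L\<^esub> frac \<one>\<^bsub>A\<^esub> s = \<one>\<^bsub>L\<^esub>"
    by (simp add: frac_mult one_eq_frac)
  then show ?thesis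
    unfolding loc_map_def by (rule L.comm_UnitsI) simp_all
qed

lemma localization_universal:
  assumes "cring B" and f: "f \<in> ring_hom A B" and unit: "f s \<in> Units B"
  shows "\<exists>F \<in> ring_hom L B. \<forall>x\<in>carrier A. F (loc_map A s x) = f x"
proof -
  interpret B: cring B by fact
  interpret f: ring_hom_cring A B f
    by unfold_locales (rule f)
  have units: "f u \<in> Units B" if "u \<in> S" for u
    using that unit by (auto simp: powers_of_def B.Units_pow_closed)
  let ?g = "\<lambda>x u. f x \<otimes>\<^bsub>B\<^esub> inv\<^bsub>B\<^esub> f u"
  \<comment> \<open>The described value is unique (\<open>wd\<close> below): the factor
    \<open>w\<close> that witnesses the equality of two fractions maps to a unit of \<open>B\<close>
    and can be cancelled there.\<close>
  define F where "F q = (THE z. \<exists>x\<in>carrier A. \<exists>u\<in>S. q = frac x u \<and> z = ?g x u)" for q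
  have F: "F (frac x u) = ?g x u" if xu: "x \<in> carrier A" "u \<in> S" for x u
  proof -
    have "?g y v = ?g x u" if yv: "y \<in> carrier A" "v \<in> S" "frac x u = frac y v" for y v
    proof -
      obtain w where w: "w \<in> S" "w \<otimes>\<^bsub>A\<^esub> (x \<otimes>\<^bsub>A\<^esub> v) = w \<otimes>\<^bsub>A\<^esub> (y \<otimes>\<^bsub>A\<^esub> u)"
        using yv xu by (auto simp: frac_eq_iff)
      note c = xu yv w(1) units[OF xu(2)] units[OF yv(2)] units[OF w(1)]
      have "f w \<otimes>\<^bsub>B\<^esub> (f x \<otimes>\<^bsub>B\<^esub> f v) = f w \<otimes>\<^bsub>B\<^esub> (f y \<otimes>\<^bsub>B\<^esub> f u)"
        using arg_cong[OF w(2), of f] c by simp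
      then have eq: "f x \<otimes>\<^bsub>B\<^esub> f v = f y \<otimes>\<^bsub>B\<^esub> f u"
        using c by (simp add: B.Units_l_cancel)
      have inv: "inv\<^bsub>B\<^esub> f u \<in> carrier B" "inv\<^bsub>B\<^esub> f v \<in> carrier B" "f u \<otimes>\<^bsub>B\<^esub> inv\<^bsub>B\<^esub> f u = \<one>\<^bsub>B\<^esub>" "f v \<otimes>\<^bsub>B\<^esub> inv\<^bsub>B\<^esub> f v = \<one>\<^bsub>B\<^esub>"
        using c by auto
      have carr: "f x \<in> carrier B" "f y \<in> carrier B" "f u \<in> carrier B" "f v \<in> carrier B"
        using c by auto
      have "?g y v = ?g y v \<otimes>\<^bsub>B\<^esub> (f u \<otimes>\<^bsub>B\<^esub> inv\<^bsub>B\<^esub> f u)" using carr inv by simp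
      also have "\<dots> = (f y \<otimes>\<^bsub>B\<^esub> f u) \<otimes>\<^bsub>B\<^esub> (inv\<^bsub>B\<^esub> f u \<otimes>\<^bsub>B\<^esub> inv\<^bsub>B\<^esub> f v)"
        using carr inv(1,2) by algebra
      also have "\<dots> = ?g x u \<otimes>\<^bsub>B\<^esub> (f v \<otimes>\<^bsub>B\<^esub> inv\<^bsub>B\<^esub> f v)"
        unfolding eq[symmetric] using carr inv(1,2) by algebra
      also have "\<dots> = ?g x u" using carr inv by simp
      finally show ?thesis .
    qed
    note wd = this
    show ?thesis
      unfolding F_def
    proof (rule the_equality)
      show "\<exists>y\<in>carrier A. \<exists>v\<in>S. frac x u = frac y v \<and> ?g x u = ?g y v"
        by (intro bexI[of _ x] bexI[of _ u] conjI refl xu)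
    next
      fix z assume "\<exists>y\<in>carrier A. \<exists>v\<in>S. frac x u = frac y v \<and> z = ?g y v"
      then show "z = ?g x u" using wd by metis
    qed
  qed
  have inv_mult: "inv\<^bsub>B\<^esub> (f u \<otimes>\<^bsub>B\<^esub> f v) = inv\<^bsub>B\<^esub> f u \<otimes>\<^bsub>B\<^esub> inv\<^bsub>B\<^esub> f v" if "u \<in> S" "v \<in> S" for u v
  proof (rule B.comm_inv_char)
    have inv: "inv\<^bsub>B\<^esub> f u \<in> carrier B" "inv\<^bsub>B\<^esub> f v \<in> carrier B" "f u \<otimes>\<^bsub>B\<^esub> inv\<^bsub>B\<^esub> f u = \<one>\<^bsub>B\<^esub>" "f v \<otimes>\<^bsub>B\<^esub> inv\<^bsub>B\<^esub> f v = \<one>\<^bsub>B\<^esub>"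
      using that units by auto
    have carr: "f u \<in> carrier B" "f v \<in> carrier B" using that by auto
    have "(f u \<otimes>\<^bsub>B\<^esub> f v) \<otimes>\<^bsub>B\<^esub> (inv\<^bsub>B\<^esub> f u \<otimes>\<^bsub>B\<^esub> inv\<^bsub>B\<^esub> f v) = (f u \<otimes>\<^bsub>B\<^esub> inv\<^bsub>B\<^esub> f u) \<otimes>\<^bsub>B\<^esub> (f v \<otimes>\<^bsub>B\<^esub> inv\<^bsub>B\<^esub> f v)"
      using carr inv(1,2) by algebra
    then show "f u \<otimes>\<^bsub>B\<^esub> f v \<otimes>\<^bsub>B\<^esub> (inv\<^bsub>B\<^esub> f u \<otimes>\<^bsub>B\<^esub> inv\<^bsub>B\<^esub> f v) = \<one>\<^bsub>B\<^esub>"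
      using inv by simp
  qed (use that units in auto)
  have "F \<in> ring_hom L B"
  proof (rule ring_hom_memI)
    fix q assume "q \<in> carrier L"
    then show "F q \<in> carrier B" by (elim fracE) (simp add: F units)
  next
    fix p q assume "p \<in> carrier L" "q \<in> carrier L"
    then obtain x u y v where c: "x \<in> carrier A" "u \<in> S" "y \<in> carrier A" "v \<in> S"
      and pq: "p = frac x u" "q = frac y v" by (elim fracE) auto
    have inv: "inv\<^bsub>B\<^esub> f u \<in> carrier B" "inv\<^bsub>B\<^esub> f v \<in> carrier B" "f u \<otimes>\<^bsub>B\<^esub> inv\<^bsub>B\<^esub> f u = \<one>\<^bsub>B\<^esub>" "f v \<otimes>\<^bsub>B\<^esub> inv\<^bsub>B\<^esub> f v = \<one>\<^bsub>B\<^esub>"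
      using c units by auto
    have carr: "f x \<in> carrier B" "f y \<in> carrier B" "f u \<in> carrier B" "f v \<in> carrier B"
      using c by auto
    have "F (p \<otimes>\<^bsub>L\<^esub> q) = (f x \<otimes>\<^bsub>B\<^esub> f y) \<otimes>\<^bsub>B\<^esub> (inv\<^bsub>B\<^esub> f u \<otimes>\<^bsub>B\<^esub> inv\<^bsub>B\<^esub> f v)"
      using c by (simp add: pq frac_mult F inv_mult)
    also have "\<dots> = ?g x u \<otimes>\<^bsub>B\<^esub> ?g y v" using carr inv(1,2) by algebra
    finally show "F (p \<otimes>\<^bsub>L\<^esub> q) = F p \<otimes>\<^bsub>B\<^esub> F q"
      using c by (simp add: pq F)
    have "F (p \<oplus>\<^bsub>L\<^esub> q) = (f x \<otimes>\<^bsub>B\<^esub> f v \<oplus>\<^bsub>B\<^esub> f y \<otimes>\<^bsub>B\<^esub> f u) \<otimes>\<^bsub>B\<^esub> (inv\<^bsub>B\<^esub> f u \<otimes>\<^bsub>B\<^esub> inv\<^bsub>B\<^esub> f v)"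
      using c by (simp add: pq frac_add F inv_mult)
    also have "\<dots> = ?g x u \<otimes>\<^bsub>B\<^esub> (f v \<otimes>\<^bsub>B\<^esub> inv\<^bsub>B\<^esub> f v)
        \<oplus>\<^bsub>B\<^esub> ?g y v \<otimes>\<^bsub>B\<^esub> (f u \<otimes>\<^bsub>B\<^esub> inv\<^bsub>B\<^esub> f u)"
      using carr inv(1,2) by algebra
    also have "\<dots> = F p \<oplus>\<^bsub>B\<^esub> F q" using c carr inv by (simp add: pq F)
    finally show "F (p \<oplus>\<^bsub>L\<^esub> q) = F p \<oplus>\<^bsub>B\<^esub> F q" .
  qed (simp add: one_eq_frac F)
  then show ?thesis by (intro bexI[of _ F]) (simp_all add: loc_map_def F)
qed

end

section \<open>Horner evaluation of coefficient lists\<close>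

text \<open>The constant coefficient comes first. A list of length \<open>n\<close> stands for a
  polynomial of degree below \<open>n\<close>; the bound is part of the data, so no degree has to be
  computed.\<close>

fun horner :: "('a, 'l) ring_scheme \<Rightarrow> 'a \<Rightarrow> 'a list \<Rightarrow> 'a" where
  "horner A x [] = \<zero>\<^bsub>A\<^esub>"
| "horner A x (a # as) = a \<oplus>\<^bsub>A\<^esub> x \<otimes>\<^bsub>A\<^esub> horner A x as"

context cring
begin

lemma horner_closed [simp, intro]: "x \<in> carrier R \<Longrightarrow> set as \<subseteq> carrier R \<Longrightarrow> horner R x as \<in> carrier R"
  by (induction as) auto

lemma horner_map2_add:
  "\<lbrakk>length as = length bs; x \<in> carrier R; set as \<subseteq> carrier R; set bs \<subseteq> carrier R\<rbrakk> \<Longrightarrow>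
    horner R x (map2 (\<oplus>) as bs) = horner R x as \<oplus> horner R x bs"
proof (induction as bs rule: list_induct2)
  case (Cons a as b bs)
  then have c: "x \<in> carrier R" "a \<in> carrier R" "b \<in> carrier R" "horner R x as \<in> carrier R" "horner R x bs \<in> carrier R" by auto
  have l: "set as \<subseteq> carrier R" "set bs \<subseteq> carrier R" using Cons.prems by auto
  from c show ?case
    by (simp only: list.map zip_Cons_Cons prod.case horner.simps Cons.IH[OF Cons.prems(1) l]) algebra
qed simp

lemma horner_map2_minus:
  "\<lbrakk>length as = length bs; x \<in> carrier R; set as \<subseteq> carrier R; set bs \<subseteq> carrier R\<rbrakk> \<Longrightarrow>
    horner R x (map2 (\<lambda>a b. a \<ominus> b) as bs) = horner R x as \<ominus> horner R x bs"
proof (induction as bs rule: list_induct2)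
  case (Cons a as b bs)
  then have c: "x \<in> carrier R" "a \<in> carrier R" "b \<in> carrier R" "horner R x as \<in> carrier R" "horner R x bs \<in> carrier R" by auto
  have l: "set as \<subseteq> carrier R" "set bs \<subseteq> carrier R" using Cons.prems by auto
  from c show ?case
    by (simp only: list.map zip_Cons_Cons prod.case horner.simps Cons.IH[OF Cons.prems(1) l]) algebra
qed (simp add: a_minus_def)

lemma horner_map_mult:
  "\<lbrakk>c \<in> carrier R; x \<in> carrier R; set as \<subseteq> carrier R\<rbrakk> \<Longrightarrow>
    horner R x (map ((\<otimes>) c) as) = c \<otimes> horner R x as"
proof (induction as)
  case (Cons a as)
  then have c: "x \<in> carrier R" "c \<in> carrier R" "a \<in> carrier R" "horner R x as \<in> carrier R" by auto
  have l: "set as \<subseteq> carrier R" using Cons.prems by auto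
  from c show ?case
    by (simp only: list.map horner.simps Cons.IH[OF Cons.prems(1,2) l]) algebra
qed simp

lemma horner_replicate_zero: "x \<in> carrier R \<Longrightarrow> horner R x (replicate n \<zero>) = \<zero>"
  by (induction n) auto

lemma horner_snoc:
  "\<lbrakk>x \<in> carrier R; set as \<subseteq> carrier R; c \<in> carrier R\<rbrakk> \<Longrightarrow>
    horner R x (as @ [c]) = horner R x as \<oplus> c \<otimes> x [^] length as"
proof (induction as)
  case (Cons a as)
  then have cl: "x \<in> carrier R" "c \<in> carrier R" "a \<in> carrier R" "horner R x as \<in> carrier R" "x [^] length as \<in> carrier R" by auto
  have l: "set as \<subseteq> carrier R" using Cons.prems by auto
  from cl show ?case
    by (simp only: append_Cons horner.simps Cons.IH[OF Cons.prems(1) l Cons.prems(3)] length_Cons nat_pow_Suc) algebra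
qed simp

end

lemma ring_hom_horner:
  assumes "cring A" "cring B" "f \<in> ring_hom A B" "x \<in> carrier A" "set as \<subseteq> carrier A"
  shows "f (horner A x as) = horner B (f x) (map f as)"
proof -
  interpret ring_hom_cring A B f
    using assms by (simp add: ring_hom_cring_def ring_hom_cring_axioms_def)
  show ?thesis using assms(5)
    by (induction as) (auto simp: assms(4) cring.horner_closed[OF assms(1)])
qed

subsection \<open>Newton interpolation\<close>

text \<open>Synthetic division by \<open>Z - x\<close>: this is the quotient, and the remainder is
  \<open>horner A x as\<close>.\<close>

fun horner_div :: "('a, 'l) ring_scheme \<Rightarrow> 'a \<Rightarrow> 'a list \<Rightarrow> 'a list" where
  "horner_div A x [] = []"
| "horner_div A x (a # as) = (if as = [] then [] else horner A x as # horner_div A x as)"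

text \<open>The coefficients of \<open>c + (Z - x) b(Z)\<close>, which undoes
  \<open>horner_div\<close>. In the recursion \<open>c\<close> is the coefficient of
  \<open>b\<close> of the previous degree.\<close>

fun horner_mul :: "('a, 'l) ring_scheme \<Rightarrow> 'a \<Rightarrow> 'a \<Rightarrow> 'a list \<Rightarrow> 'a list" where
  "horner_mul A x c [] = [c]"
| "horner_mul A x c (b # bs) = (c \<ominus>\<^bsub>A\<^esub> x \<otimes>\<^bsub>A\<^esub> b) # horner_mul A x b bs"

context cring
begin

lemma length_horner_div: "length (horner_div R x as) = length as - 1"
  by (induction as) auto

lemma horner_div_closed: "x \<in> carrier R \<Longrightarrow> set as \<subseteq> carrier R \<Longrightarrow> set (horner_div R x as) \<subseteq> carrier R"
  by (induction as) auto

lemma horner_div: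
  assumes "x \<in> carrier R" "y \<in> carrier R" "set as \<subseteq> carrier R"
  shows "horner R y as = horner R x as \<oplus> (y \<ominus> x) \<otimes> horner R y (horner_div R x as)"
  using assms(3)
proof (induction as)
  case (Cons a as)
  then have c: "a \<in> carrier R" "horner R x as \<in> carrier R" "horner R y (horner_div R x as) \<in> carrier R"
    using assms(1,2) horner_div_closed by auto
  show ?case
  proof (cases "as = []")
    case True then show ?thesis using c assms by simp
  next
    case False
    have IH: "horner R y as = horner R x as \<oplus> (y \<ominus> x) \<otimes> horner R y (horner_div R x as)"
      using Cons by simp
    show ?thesis
      using c assms(1,2) by (simp only: horner_div.simps False if_False horner.simps IH) algebra
  qed
qed (use assms in \<open>simp add: a_minus_def\<close>)

text \<open>The entries of the quotient are the values at \<open>x\<close> of the proper nonempty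
  tails of \<open>as\<close>. Each coefficient is the value of the tail that it starts minus
  \<open>x\<close> times the value of the next one.\<close>

lemma horner_div_zero:
  "\<lbrakk>x \<in> carrier R; set as \<subseteq> carrier R; horner R x as = \<zero>; set (horner_div R x as) \<subseteq> {\<zero>}\<rbrakk> \<Longrightarrow> set as \<subseteq> {\<zero>}"
proof (induction as)
  case (Cons a as)
  show ?case
  proof (cases "as = []")
    case True then show ?thesis using Cons by auto
  next
    case False then show ?thesis using Cons by auto
  qed
qed simp

lemma length_horner_mul: "length (horner_mul R x c as) = Suc (length as)"
  by (induction as arbitrary: c) auto

lemma horner_mul_closed:
  "x \<in> carrier R \<Longrightarrow> c \<in> carrier R \<Longrightarrow> set as \<subseteq> carrier R \<Longrightarrow> set (horner_mul R x c as) \<subseteq> carrier R"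
  by (induction as arbitrary: c) auto

lemma horner_mul:
  "\<lbrakk>x \<in> carrier R; y \<in> carrier R; c \<in> carrier R; set as \<subseteq> carrier R\<rbrakk> \<Longrightarrow>
    horner R y (horner_mul R x c as) = c \<oplus> (y \<ominus> x) \<otimes> horner R y as"
proof (induction as arbitrary: c)
  case (Cons a as)
  then have cl: "x \<in> carrier R" "y \<in> carrier R" "c \<in> carrier R" "a \<in> carrier R" "horner R y as \<in> carrier R" by auto
  have l: "set as \<subseteq> carrier R" using Cons.prems by auto
  from cl show ?case
    by (simp only: horner_mul.simps horner.simps Cons.IH[OF Cons.prems(1,2) cl(4) l]) algebra
qed (simp add: a_minus_def)

text \<open>Over a general ring distinct points do not bound the number of roots, but unit
  differences do: after division by \<open>Z - x\<close> the factor \<open>y - x\<close> cancels at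
  each later point \<open>y\<close>, and the quotient has one coefficient fewer.\<close>

lemma interpolation_unique:
  assumes "length as = length xs" "set as \<subseteq> carrier R" "set xs \<subseteq> carrier R"
    and "sorted_wrt (\<lambda>x y. y \<ominus> x \<in> Units R) xs" "\<And>x. x \<in> set xs \<Longrightarrow> horner R x as = \<zero>"
  shows "set as \<subseteq> {\<zero>}"
  using assms
proof (induction xs arbitrary: as)
  case (Cons x xs)
  let ?bs = "horner_div R x as"
  have bs: "set ?bs \<subseteq> carrier R" using Cons.prems(2,3) by (intro horner_div_closed) auto
  have "set ?bs \<subseteq> {\<zero>}"
  proof (rule Cons.IH)
    fix y assume y: "y \<in> set xs"
    then have y': "y \<in> carrier R" "y \<ominus> x \<in> Units R" "x \<in> carrier R" using Cons.prems(3,4) by auto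
    have B: "horner R y ?bs \<in> carrier R" using bs y' by auto
    have zero: "horner R y as = \<zero>" "horner R x as = \<zero>"
      using Cons.prems(5) y by simp_all
    have "(y \<ominus> x) \<otimes> horner R y ?bs = \<zero>"
      using horner_div[OF y'(3,1) Cons.prems(2)] unfolding zero using y' B by simp
    then have "(y \<ominus> x) \<otimes> horner R y ?bs = (y \<ominus> x) \<otimes> \<zero>" using y' by simp
    then show "horner R y ?bs = \<zero>"
      unfolding Units_l_cancel[OF y'(2) B zero_closed] .
  qed (use Cons.prems(1,3,4) bs in \<open>auto simp: length_horner_div\<close>)
  then show ?case
    by (rule horner_div_zero[rotated 3]) (use Cons.prems(2,3) Cons.prems(5)[of x] in simp_all)
qed simp

lemma Units_mult_inv_cancel: "u \<in> Units R \<Longrightarrow> w \<in> carrier R \<Longrightarrow> u \<otimes> (inv u \<otimes> w) = w"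
  by (simp add: m_assoc[symmetric] Units_closed)

text \<open>Newton's scheme: \<open>y + (Z - x) b(Z)\<close> takes the value \<open>y\<close> at
  \<open>x\<close>, and \<open>b\<close> has to interpolate the divided differences
  \<open>zs\<close> at the remaining points.\<close>

lemma interpolation_exists:
  assumes "length ys = length xs" "set ys \<subseteq> carrier R" "set xs \<subseteq> carrier R"
    and "sorted_wrt (\<lambda>x y. y \<ominus> x \<in> Units R) xs"
  shows "\<exists>as. length as = length xs \<and> set as \<subseteq> carrier R \<and> map (\<lambda>x. horner R x as) xs = ys"
  using assms
proof (induction xs arbitrary: ys)
  case (Cons x xs)
  obtain y ys' where ys: "ys = y # ys'" using Cons.prems(1) by (cases ys) auto
  have c: "x \<in> carrier R" "y \<in> carrier R" "length ys' = length xs" "set ys' \<subseteq> carrier R" "set xs \<subseteq> carrier R"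
    using Cons.prems ys by auto
  have units: "x' \<ominus> x \<in> Units R" if "x' \<in> set xs" for x' using Cons.prems that by auto
  define zs where "zs = map2 (\<lambda>x' y'. inv (x' \<ominus> x) \<otimes> (y' \<ominus> y)) xs ys'"
  have zs: "length zs = length xs" using c by (simp add: zs_def)
  have nth: "xs ! i \<in> carrier R" "ys' ! i \<in> carrier R" "xs ! i \<ominus> x \<in> Units R"
    "zs ! i = inv (xs ! i \<ominus> x) \<otimes> (ys' ! i \<ominus> y)" if "i < length xs" for i
    using that c units by (auto simp: zs_def)
  have "zs ! i \<in> carrier R" if "i < length xs" for i
    using nth[OF that] c by simp
  then have zs': "set zs \<subseteq> carrier R" by (auto simp: in_set_conv_nth zs)
  have "sorted_wrt (\<lambda>x y. y \<ominus> x \<in> Units R) xs" using Cons.prems by simp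
  from Cons.IH[OF zs zs' c(5) this] obtain bs
    where bs: "length bs = length xs" "set bs \<subseteq> carrier R" "map (\<lambda>x. horner R x bs) xs = zs"
    by blast
  have val: "horner R (xs ! i) (horner_mul R x y bs) = ys' ! i" if i: "i < length xs" for i
  proof -
    have "horner R (xs ! i) bs = zs ! i" using bs(3) i by (metis nth_map)
    then have "horner R (xs ! i) (horner_mul R x y bs)
        = y \<oplus> (xs ! i \<ominus> x) \<otimes> (inv (xs ! i \<ominus> x) \<otimes> (ys' ! i \<ominus> y))"
      using horner_mul[OF c(1) nth(1)[OF i] c(2) bs(2)] nth(4)[OF i] by simp
    also have "\<dots> = y \<oplus> (ys' ! i \<ominus> y)"
      using Units_mult_inv_cancel[OF nth(3)[OF i], of "ys' ! i \<ominus> y"] nth[OF i] c by simp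
    also have "\<dots> = ys' ! i" using nth(2)[OF i] c(2) by algebra
    finally show ?thesis .
  qed
  have "horner R x (horner_mul R x y bs) = y"
    using horner_mul[OF c(1) c(1) c(2) bs(2)] c bs by (simp add: a_minus_def r_neg)
  moreover have "map (\<lambda>z. horner R z (horner_mul R x y bs)) xs = ys'"
    using val c(3) by (intro nth_equalityI) auto
  ultimately show ?case
    using horner_mul_closed[OF c(1,2) bs(2)] length_horner_mul[of x y bs] bs(1) ys
    by (intro exI[of _ "horner_mul R x y bs"]) simp
qed simp

end

section \<open>Polynomials modulo a monic polynomial\<close>

lemma UP_coeff_eq: "q \<in> carrier (UP R) \<Longrightarrow> up_ring.coeff (UP R) q n = q n"
  by (simp add: UP_def)

context UP_cring
begin

lemma coeff_var_mult:
  assumes "q \<in> carrier P"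
  shows "up_ring.coeff P (up_ring.monom P \<one> 1 \<otimes>\<^bsub>P\<^esub> q) n = (case n of 0 \<Rightarrow> \<zero> | Suc m \<Rightarrow> up_ring.coeff P q m)"
proof (cases n)
  case 0 then show ?thesis using assms by simp
next
  case (Suc m)
  then show ?thesis using coeff_monom_mult[OF R.one_closed assms, of 1 m] assms by simp
qed

lemma coeff_horner_var:
  "set as \<subseteq> carrier R \<Longrightarrow>
    up_ring.coeff P (horner P (up_ring.monom P \<one> 1) (map (\<lambda>a. up_ring.monom P a 0) as)) n = (if n < length as then as ! n else \<zero>)"
proof (induction as arbitrary: n)
  case (Cons a as)
  have "set (map (\<lambda>a. up_ring.monom P a 0) as) \<subseteq> carrier P" using Cons by auto
  then have "horner P (up_ring.monom P \<one> 1) (map (\<lambda>a. up_ring.monom P a 0) as) \<in> carrier P"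
    by (intro P.horner_closed) auto
  moreover have "as ! i \<in> carrier R" if "i < length as" for i using Cons that by auto
  ultimately show ?case using Cons
    by (auto simp: coeff_var_mult simp del: coeff_mult One_nat_def split: nat.split)
qed simp

lemma poly_eq_horner:
  assumes "q \<in> carrier P"
  obtains as where "set as \<subseteq> carrier R" "q = horner P (up_ring.monom P \<one> 1) (map (\<lambda>a. up_ring.monom P a 0) as)"
proof
  let ?as = "map (up_ring.coeff P q) [0..<Suc (deg R q)]"
  show c: "set ?as \<subseteq> carrier R" using assms by auto
  have "set (map (\<lambda>a. up_ring.monom P a 0) ?as) \<subseteq> carrier P" using assms by auto
  then have "horner P (up_ring.monom P \<one> 1) (map (\<lambda>a. up_ring.monom P a 0) ?as) \<in> carrier P"
    by (intro P.horner_closed) auto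
  then show "q = horner P (up_ring.monom P \<one> 1) (map (\<lambda>a. up_ring.monom P a 0) ?as)"
    using assms c by (intro up_eqI) (auto simp: coeff_horner_var[simplified] deg_aboveD simp del: upt_Suc map_map)
qed

text \<open>In degree \<open>deg q + n\<close> the product has the leading coefficient of
  \<open>q\<close>, which meets the coefficient 1 of \<open>f\<close>. So even in the presence of
  zero divisors a nonzero multiple of a monic polynomial of degree \<open>n\<close> has degree at
  least \<open>n\<close>.\<close>

lemma monic_mult_bound:
  assumes f: "f \<in> carrier P" "up_ring.coeff P f n = \<one>" "\<And>i. n < i \<Longrightarrow> up_ring.coeff P f i = \<zero>"
    and q: "q \<in> carrier P" and bound: "\<And>i. n \<le> i \<Longrightarrow> up_ring.coeff P (q \<otimes>\<^bsub>P\<^esub> f) i = \<zero>"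
  shows "q = \<zero>\<^bsub>P\<^esub>"
proof (rule ccontr)
  assume "q \<noteq> \<zero>\<^bsub>P\<^esub>"
  let ?d = "deg R q"
  have "up_ring.coeff P (q \<otimes>\<^bsub>P\<^esub> f) (?d + n) = (\<Oplus>i\<in>{..?d + n}. up_ring.coeff P q i \<otimes> up_ring.coeff P f (?d + n - i))"
    using f q by simp
  also have "\<dots> = (\<Oplus>i\<in>{..?d + n}. if ?d = i then up_ring.coeff P q i else \<zero>)"
  proof (rule R.finsum_cong'[OF refl])
    fix i assume "i \<in> {..?d + n}"
    consider "i < ?d" | "i = ?d" | "?d < i" by linarith
    then show "up_ring.coeff P q i \<otimes> up_ring.coeff P f (?d + n - i) = (if ?d = i then up_ring.coeff P q i else \<zero>)"
    proof cases
      case 1 then show ?thesis using f(3)[of "?d + n - i"] q by simp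
    next
      case 2 then show ?thesis using f(2) q by simp
    next
      case 3 then show ?thesis using deg_aboveD[OF 3 q] coeff_closed[OF f(1)] by simp
    qed
  qed (simp add: q)
  also have "\<dots> = up_ring.coeff P q ?d"
    by (rule R.finsum_singleton) (simp_all add: q)
  finally have "up_ring.coeff P q ?d = \<zero>" using bound by simp
  then show False using lcoeff_nonzero[OF \<open>q \<noteq> \<zero>\<^bsub>P\<^esub>\<close> q] by simp
qed

end

section \<open>Algebras spanned by the powers of one element\<close>

lemma alg_module_simps [simp]:
  "carrier (alg_module S h) = carrier S" "x \<oplus>\<^bsub>alg_module S h\<^esub> y = x \<oplus>\<^bsub>S\<^esub> y"
  "\<zero>\<^bsub>alg_module S h\<^esub> = \<zero>\<^bsub>S\<^esub>" "r \<odot>\<^bsub>alg_module S h\<^esub> x = h r \<otimes>\<^bsub>S\<^esub> x"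
  by (simp_all add: alg_module_def)

lemma (in ring_hom_cring) module_alg_module: "module R (alg_module S h)"
proof (rule moduleI)
  show "abelian_group (alg_module S h)"
  proof (rule abelian_groupI)
    fix x assume "x \<in> carrier (alg_module S h)"
    then show "\<exists>y\<in>carrier (alg_module S h). y \<oplus>\<^bsub>alg_module S h\<^esub> x = \<zero>\<^bsub>alg_module S h\<^esub>"
      by (intro bexI[of _ "\<ominus>\<^bsub>S\<^esub> x"]) (auto simp: S.l_neg)
  qed (auto simp: S.a_ac)
qed (auto simp: S.l_distr S.r_distr S.m_assoc intro: R.is_cring)

text \<open>Spanning and independence of the powers below \<open>n\<close> are kept apart: spanning
  passes to tensor products by a formal induction and already suffices for handling
  \<open>S \<otimes> S\<close>, whereas independence is tested by a homomorphism to an algebra where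
  it is known.\<close>

locale power_span = R: cring R + S: cring S
  for R :: "('r, 'k) ring_scheme" and S :: "('a, 'l) ring_scheme" and h :: "'r \<Rightarrow> 'a" +
  fixes \<theta> :: 'a and n :: nat
  assumes h: "h \<in> ring_hom R S" and \<theta> [simp, intro]: "\<theta> \<in> carrier S"
    and spans: "s \<in> carrier S \<Longrightarrow>
      \<exists>as. length as = n \<and> set as \<subseteq> carrier R \<and> s = horner S \<theta> (map h as)"

locale power_basis = power_span R S h \<theta> n
  for R :: "('r, 'k) ring_scheme" and S :: "('a, 'l) ring_scheme" and h \<theta> n +
  assumes indep: "\<lbrakk>length as = n; set as \<subseteq> carrier R; horner S \<theta> (map h as) = \<zero>\<^bsub>S\<^esub>\<rbrakk> \<Longrightarrow>
      set as \<subseteq> {\<zero>\<^bsub>R\<^esub>}"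

context power_span
begin

sublocale h: ring_hom_cring R S h
  by unfold_locales (rule h)

lemma map_h_closed [simp]: "set as \<subseteq> carrier R \<Longrightarrow> h ` set as \<subseteq> carrier S"
  by auto

lemma finsum_alg_module: "finsum (alg_module S h) f A = finsum S f A"
  by (simp add: finsum_def finprod_def alg_module_def)

text \<open>A set of generators is wanted, but distinct exponents may give the same power of
  \<open>\<theta>\<close>. Showing that the combinations \<open>W\<close> of the set
  \<open>G\<close> are closed under addition avoids reindexing a sum over exponents.\<close>

lemma finitely_generated: "finitely_generated_module R (alg_module S h)"
proof -
  define G where "G = (\<lambda>i. \<theta> [^]\<^bsub>S\<^esub> i) ` {..<n}"
  have G: "finite G" "G \<subseteq> carrier S" by (auto simp: G_def)
  define W where "W = {x. \<exists>c \<in> G \<rightarrow> carrier R. x = (\<Oplus>\<^bsub>S\<^esub>s\<in>G. h (c s) \<otimes>\<^bsub>S\<^esub> s)}"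
  have zero: "\<zero>\<^bsub>S\<^esub> \<in> W"
  proof -
    have "(\<Oplus>\<^bsub>S\<^esub>s\<in>G. h \<zero>\<^bsub>R\<^esub> \<otimes>\<^bsub>S\<^esub> s) = (\<Oplus>\<^bsub>S\<^esub>s\<in>G. \<zero>\<^bsub>S\<^esub>)"
      using G by (intro S.finsum_cong') auto
    then show ?thesis unfolding W_def by (auto intro!: bexI[of _ "\<lambda>_. \<zero>\<^bsub>R\<^esub>"])
  qed
  have add: "x \<oplus>\<^bsub>S\<^esub> y \<in> W" if "x \<in> W" "y \<in> W" for x y
  proof -
    obtain c d where c: "c \<in> G \<rightarrow> carrier R" "x = (\<Oplus>\<^bsub>S\<^esub>s\<in>G. h (c s) \<otimes>\<^bsub>S\<^esub> s)"
      and d: "d \<in> G \<rightarrow> carrier R" "y = (\<Oplus>\<^bsub>S\<^esub>s\<in>G. h (d s) \<otimes>\<^bsub>S\<^esub> s)"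
      using \<open>x \<in> W\<close> \<open>y \<in> W\<close> unfolding W_def by blast
    have cd: "c s \<in> carrier R" "d s \<in> carrier R" "s \<in> carrier S" if "s \<in> G" for s
      using that c(1) d(1) G(2) by auto
    have "x \<oplus>\<^bsub>S\<^esub> y = (\<Oplus>\<^bsub>S\<^esub>s\<in>G. h (c s) \<otimes>\<^bsub>S\<^esub> s \<oplus>\<^bsub>S\<^esub> h (d s) \<otimes>\<^bsub>S\<^esub> s)"
      unfolding c(2) d(2) using cd by (intro S.finsum_addf[symmetric]) auto
    also have "\<dots> = (\<Oplus>\<^bsub>S\<^esub>s\<in>G. h (c s \<oplus>\<^bsub>R\<^esub> d s) \<otimes>\<^bsub>S\<^esub> s)"
      using cd by (intro S.finsum_cong') (auto simp: S.l_distr)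
    finally show ?thesis
      unfolding W_def using cd by (auto intro!: bexI[of _ "\<lambda>s. c s \<oplus>\<^bsub>R\<^esub> d s"])
  qed
  have gen: "h a \<otimes>\<^bsub>S\<^esub> g \<in> W" if "a \<in> carrier R" "g \<in> G" for a g
  proof -
    have "(\<Oplus>\<^bsub>S\<^esub>s\<in>G. h (if s = g then a else \<zero>\<^bsub>R\<^esub>) \<otimes>\<^bsub>S\<^esub> s)
        = (\<Oplus>\<^bsub>S\<^esub>s\<in>G. if g = s then h a \<otimes>\<^bsub>S\<^esub> s else \<zero>\<^bsub>S\<^esub>)"
      using G that by (intro S.finsum_cong') auto
    also have "\<dots> = h a \<otimes>\<^bsub>S\<^esub> g"
      using G that by (intro S.finsum_singleton) auto
    finally show ?thesis
      unfolding W_def using that by (auto intro!: bexI[of _ "\<lambda>s. if s = g then a else \<zero>\<^bsub>R\<^esub>"])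
  qed
  have "horner S \<theta> (map h as) \<in> W" if "length as \<le> n" "set as \<subseteq> carrier R" for as
    using that
  proof (induction as rule: rev_induct)
    case (snoc a as)
    have "horner S \<theta> (map h (as @ [a])) = horner S \<theta> (map h as) \<oplus>\<^bsub>S\<^esub> h a \<otimes>\<^bsub>S\<^esub> \<theta> [^]\<^bsub>S\<^esub> length as"
      using snoc.prems S.horner_snoc[of \<theta> "map h as" "h a"] by simp
    moreover have "\<theta> [^]\<^bsub>S\<^esub> length as \<in> G" using snoc.prems by (auto simp: G_def)
    ultimately show ?case using snoc add gen by simp
  qed (simp add: zero)
  then have "\<exists>c \<in> G \<rightarrow> carrier R. x = (\<Oplus>\<^bsub>S\<^esub>s\<in>G. h (c s) \<otimes>\<^bsub>S\<^esub> s)" if "x \<in> carrier S" for x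
    using spans[OF that] unfolding W_def by force
  then show ?thesis
    unfolding finitely_generated_module_def using G h.module_alg_module
    by (auto simp: finsum_alg_module intro!: exI[of _ G])
qed

end

context power_basis
begin

lemma unique:
  assumes "length as = n" "set as \<subseteq> carrier R" "length bs = n" "set bs \<subseteq> carrier R"
    and "horner S \<theta> (map h as) = horner S \<theta> (map h bs)"
  shows "as = bs"
proof -
  let ?cs = "map2 (\<lambda>a b. a \<ominus>\<^bsub>R\<^esub> b) as bs"
  have nth: "as ! i \<in> carrier R" "bs ! i \<in> carrier R" if "i < n" for i using assms that by auto
  have "map h ?cs = map2 (\<lambda>a b. a \<ominus>\<^bsub>S\<^esub> b) (map h as) (map h bs)"
    using assms nth by (intro nth_equalityI) (auto simp: a_minus_def)
  then have "horner S \<theta> (map h ?cs) = horner S \<theta> (map h as) \<ominus>\<^bsub>S\<^esub> horner S \<theta> (map h bs)"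
    using assms by (simp add: S.horner_map2_minus)
  also have "\<dots> = \<zero>\<^bsub>S\<^esub>" using assms by (simp add: a_minus_def S.r_neg)
  finally have zero: "horner S \<theta> (map h ?cs) = \<zero>\<^bsub>S\<^esub>" .
  have "?cs ! i \<in> carrier R" if "i < n" for i using assms nth[OF that] that by simp
  then have "set ?cs \<subseteq> carrier R" using assms by (auto simp: in_set_conv_nth)
  then have "set ?cs \<subseteq> {\<zero>\<^bsub>R\<^esub>}" using indep[OF _ _ zero] assms by simp
  then have "?cs ! i = \<zero>\<^bsub>R\<^esub>" if "i < n" for i using that assms nth_mem[of i ?cs] by auto
  then show ?thesis
    using assms nth by (intro nth_equalityI) auto
qed

definition coords where
  "coords s = (THE as. length as = n \<and> set as \<subseteq> carrier R \<and> s = horner S \<theta> (map h as))"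

lemma coords_horner:
  assumes "length as = n" "set as \<subseteq> carrier R"
  shows "coords (horner S \<theta> (map h as)) = as"
  unfolding coords_def using assms unique by (intro the_equality) auto

lemma coords:
  assumes "s \<in> carrier S"
  shows "length (coords s) = n" "set (coords s) \<subseteq> carrier R" "horner S \<theta> (map h (coords s)) = s"
  using spans[OF assms] coords_horner by auto

text \<open>For positive \<open>n\<close> the element 1 is the first basis vector, so
  \<open>z\<close> is the first coordinate of \<open>h z\<close>.\<close>

lemma inj_h: "0 < n \<Longrightarrow> inj_on h (carrier R)"
proof (rule inj_onI)
  fix x y assume n: "0 < n" and xy: "x \<in> carrier R" "y \<in> carrier R" "h x = h y"
  have "horner S \<theta> (map h (z # replicate (n - 1) \<zero>\<^bsub>R\<^esub>)) = h z" if "z \<in> carrier R" for z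
    using that by (simp add: S.horner_replicate_zero)
  then have "x # replicate (n - 1) \<zero>\<^bsub>R\<^esub> = y # replicate (n - 1) \<zero>\<^bsub>R\<^esub>"
    using n xy by (intro unique) auto
  then show "x = y" by simp
qed

lemma coords_add:
  assumes "x \<in> carrier S" "y \<in> carrier S"
  shows "coords (x \<oplus>\<^bsub>S\<^esub> y) = map2 (\<oplus>\<^bsub>R\<^esub>) (coords x) (coords y)"
proof -
  let ?cs = "map2 (\<oplus>\<^bsub>R\<^esub>) (coords x) (coords y)"
  have nth: "coords x ! i \<in> carrier R" "coords y ! i \<in> carrier R" if "i < n" for i
    using coords[OF assms(1)] coords[OF assms(2)] that by auto
  have "map h ?cs = map2 (\<oplus>\<^bsub>S\<^esub>) (map h (coords x)) (map h (coords y))"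
    using coords[OF assms(1)] coords[OF assms(2)] nth by (intro nth_equalityI) auto
  then have "horner S \<theta> (map h ?cs) = x \<oplus>\<^bsub>S\<^esub> y"
    using coords[OF assms(1)] coords[OF assms(2)] by (simp add: S.horner_map2_add)
  moreover have "?cs ! i \<in> carrier R" if "i < n" for i
    using coords[OF assms(1)] coords[OF assms(2)] nth[OF that] that by simp
  then have "set ?cs \<subseteq> carrier R"
    using coords[OF assms(1)] coords[OF assms(2)] by (auto simp: in_set_conv_nth)
  ultimately show ?thesis
    using coords_horner[of ?cs] coords[OF assms(1)] coords[OF assms(2)] by simp
qed

lemma coords_smult:
  assumes "r \<in> carrier R" "x \<in> carrier S"
  shows "coords (h r \<otimes>\<^bsub>S\<^esub> x) = map ((\<otimes>\<^bsub>R\<^esub>) r) (coords x)"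
proof -
  let ?cs = "map ((\<otimes>\<^bsub>R\<^esub>) r) (coords x)"
  have "map h ?cs = map ((\<otimes>\<^bsub>S\<^esub>) (h r)) (map h (coords x))"
    using coords[OF assms(2)] assms(1) by auto
  then have "horner S \<theta> (map h ?cs) = h r \<otimes>\<^bsub>S\<^esub> x"
    using coords[OF assms(2)] assms by (simp add: S.horner_map_mult del: map_map)
  moreover have "set ?cs \<subseteq> carrier R" using coords[OF assms(2)] assms(1) by auto
  ultimately show ?thesis using coords_horner[of ?cs] coords[OF assms(2)] by simp
qed

text \<open>The index set of the free module has to consist of elements of \<open>S\<close>, so the
  powers of \<open>\<theta>\<close> themselves serve as indices. Independence makes them distinct if
  \<open>R\<close> is nonzero; over the zero ring they coincide, and that case is treated
  apart.\<close>

lemma projective: "projective_module R (alg_module S h)"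
proof -
  define e where "e i = \<theta> [^]\<^bsub>S\<^esub> i" for i :: nat
  define E where "E = e ` {..<n}"
  have inj: "inj_on e {..<n}" if "\<zero>\<^bsub>R\<^esub> \<noteq> \<one>\<^bsub>R\<^esub>"
  proof (rule inj_onI)
    fix i j assume ij: "i \<in> {..<n}" "j \<in> {..<n}" "e i = e j"
    \<comment> \<open>The coordinate list of the \<open>k\<close>-th power is the
      \<open>k\<close>-th unit vector, so equal powers give equal unit vectors.\<close>
    have unit: "horner S \<theta> (map h ((replicate n \<zero>\<^bsub>R\<^esub>)[k := \<one>\<^bsub>R\<^esub>])) = e k" if "k < n" for k
      using that
    proof (induction n arbitrary: k)
      case (Suc m)
      show ?case
      proof (cases k)
        case 0 then show ?thesis by (simp add: e_def S.horner_replicate_zero)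
      next
        case (Suc l)
        then show ?thesis using Suc.IH[of l] Suc.prems by (simp add: e_def S.m_comm)
      qed
    qed simp
    have "(replicate n \<zero>\<^bsub>R\<^esub>)[i := \<one>\<^bsub>R\<^esub>] = (replicate n \<zero>\<^bsub>R\<^esub>)[j := \<one>\<^bsub>R\<^esub>]"
      using ij unit by (intro unique) (auto dest!: subsetD[OF set_update_subset_insert])
    then have "(replicate n \<zero>\<^bsub>R\<^esub>)[i := \<one>\<^bsub>R\<^esub>] ! i = (replicate n \<zero>\<^bsub>R\<^esub>)[j := \<one>\<^bsub>R\<^esub>] ! i" by simp
    then show "i = j" using ij that by (auto simp: nth_list_update split: if_splits)
  qed
  let ?F = "free_module R E" and ?M = "alg_module S h"
  define idx where "idx t = inv_into {..<n} e t" for t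
  have idx: "idx t < n" if "t \<in> E" for t
    using inv_into_into[of t e "{..<n}"] that by (simp add: idx_def E_def)
  have eE: "e i \<in> E" if "i < n" for i using that by (simp add: E_def)
  have finE: "finite E" by (simp add: E_def)
  have carr: "f \<in> carrier ?F \<longleftrightarrow> f \<in> E \<rightarrow>\<^sub>E carrier R" for f
    using finE by (simp add: free_module_def)
  have ops: "f \<oplus>\<^bsub>?F\<^esub> g = (\<lambda>i\<in>E. f i \<oplus>\<^bsub>R\<^esub> g i)" "r \<odot>\<^bsub>?F\<^esub> f = (\<lambda>i\<in>E. r \<otimes>\<^bsub>R\<^esub> f i)" for f g r
    by (simp_all add: free_module_def)
  define i where "i s = (\<lambda>t\<in>E. coords s ! idx t)" for s
  define vals where "vals f = map (\<lambda>i. f (e i)) [0..<n]" for f :: "'a \<Rightarrow> 'r"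
  define q where "q f = horner S \<theta> (map h (vals f))" for f
  have vals: "set (vals f) \<subseteq> carrier R" "length (vals f) = n" if "f \<in> carrier ?F" for f
    using that eE unfolding carr vals_def by auto
  have i_hom: "i \<in> module_hom R ?M ?F"
    unfolding module_hom_def
  proof (intro CollectI conjI ballI Pi_I)
    fix x assume x: "x \<in> carrier ?M"
    then show "i x \<in> carrier ?F"
      unfolding carr i_def using idx coords[of x] by (auto intro!: nth_mem[THEN subsetD[rotated]])
  next
    fix x y assume "x \<in> carrier ?M" "y \<in> carrier ?M"
    then show "i (x \<oplus>\<^bsub>?M\<^esub> y) = i x \<oplus>\<^bsub>?F\<^esub> i y"
      unfolding ops i_def using idx coords[of x] coords[of y] by (auto simp: coords_add)
  next
    fix r x assume "r \<in> carrier R" "x \<in> carrier ?M"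
    then show "i (r \<odot>\<^bsub>?M\<^esub> x) = r \<odot>\<^bsub>?F\<^esub> i x"
      unfolding ops i_def using idx coords[of x] by (auto simp: coords_smult)
  qed
  have q_hom: "q \<in> module_hom R ?F ?M"
    unfolding module_hom_def
  proof (intro CollectI conjI ballI Pi_I)
    fix f assume "f \<in> carrier ?F"
    then show "q f \<in> carrier ?M" using vals[of f] by (auto simp: q_def)
  next
    fix f g assume fg: "f \<in> carrier ?F" "g \<in> carrier ?F"
    have "f (e i) \<in> carrier R" "g (e i) \<in> carrier R" if "i < n" for i
      using fg eE[OF that] unfolding carr by auto
    then have "map h (vals (f \<oplus>\<^bsub>?F\<^esub> g)) = map2 (\<oplus>\<^bsub>S\<^esub>) (map h (vals f)) (map h (vals g))"
      using fg eE unfolding carr ops vals_def by (intro nth_equalityI) auto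
    then show "q (f \<oplus>\<^bsub>?F\<^esub> g) = q f \<oplus>\<^bsub>?M\<^esub> q g"
      using vals[OF fg(1)] vals[OF fg(2)] by (simp add: q_def S.horner_map2_add)
  next
    fix r f assume rf: "r \<in> carrier R" "f \<in> carrier ?F"
    have "f (e i) \<in> carrier R" if "i < n" for i
      using rf eE[OF that] unfolding carr by auto
    then have "map h (vals (r \<odot>\<^bsub>?F\<^esub> f)) = map ((\<otimes>\<^bsub>S\<^esub>) (h r)) (map h (vals f))"
      using rf eE unfolding carr ops vals_def by (intro nth_equalityI) auto
    then show "q (r \<odot>\<^bsub>?F\<^esub> f) = r \<odot>\<^bsub>?M\<^esub> q f"
      using vals[OF rf(2)] rf by (simp add: q_def S.horner_map_mult del: map_map)
  qed
  have "q (i x) = x" if x: "x \<in> carrier S" for x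
  proof -
    have "vals (i x) ! j = coords x ! j" if j: "j < n" for j
    proof (cases "\<zero>\<^bsub>R\<^esub> = \<one>\<^bsub>R\<^esub>")
      \<comment> \<open>Here \<open>idx\<close> need not invert \<open>e\<close>, but all
        coordinates lie in a ring with one element, so picking the wrong one does no harm.\<close>
      case True
      then have "carrier R = {\<zero>\<^bsub>R\<^esub>}" using R.one_zeroD by simp
      moreover have "coords x ! j \<in> carrier R" "coords x ! idx (e j) \<in> carrier R"
        using coords[OF x] j idx[OF eE[OF j]] by auto
      ultimately show ?thesis using j eE[OF j] by (simp add: vals_def i_def)
    next
      case False
      then have "idx (e j) = j" unfolding idx_def using inj j by (intro inv_into_f_f) auto
      then show ?thesis using j eE[OF j] by (simp add: vals_def i_def)
    qed
    then have "vals (i x) = coords x" using coords[OF x] by (intro nth_equalityI) (auto simp: vals_def)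
    then show ?thesis using coords[OF x] by (simp add: q_def)
  qed
  then show ?thesis
    unfolding projective_module_def using h.module_alg_module i_hom q_hom
    by (intro conjI exI[of _ E] bexI[of _ i] bexI[of _ q]) auto
qed

end

text \<open>Division with remainder, one coefficient at a time. Prepending \<open>a\<close> shifts
  the reduced list \<open>u @ [c]\<close> by one degree; the overflow, \<open>c\<close> times the
  power with exponent \<open>length cs\<close>, is rewritten by the relation \<open>power\<close>,
  which gives the new list \<open>?ds\<close>.\<close>

lemma (in ring_hom_cring) horner_reduce:
  assumes x: "x \<in> carrier S" and cs: "set cs \<subseteq> carrier R" "0 < length cs"
    and power: "x [^]\<^bsub>S\<^esub> length cs = horner S x (map h cs)" and as: "set as \<subseteq> carrier R"
  shows "\<exists>bs. length bs = length cs \<and> set bs \<subseteq> carrier R \<and>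
    horner S x (map h as) = horner S x (map h bs)"
  using as
proof (induction as)
  case Nil
  show ?case using x
    by (intro exI[of _ "replicate (length cs) \<zero>"]) (auto simp: S.horner_replicate_zero)
next
  case (Cons a as)
  then obtain bs where bs: "length bs = length cs" "set bs \<subseteq> carrier R"
    "horner S x (map h as) = horner S x (map h bs)" by auto
  have ne: "bs \<noteq> []" using bs cs by auto
  define u where "u = butlast bs"
  define c where "c = last bs"
  have bs_eq: "bs = u @ [c]" using ne by (simp add: u_def c_def)
  have carr: "a \<in> carrier R" "c \<in> carrier R" "set u \<subseteq> carrier R" "length (a # u) = length cs"
    using Cons.prems bs unfolding bs_eq by auto
  have hc: "h ` set u \<subseteq> carrier S" "h ` set cs \<subseteq> carrier S" using carr cs by auto
  let ?ds = "map2 (\<oplus>) (a # u) (map ((\<otimes>) c) cs)"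
  have nth: "(a # u) ! i \<in> carrier R" "cs ! i \<in> carrier R" if "i < length cs" for i
    using nth_mem[of i "a # u"] nth_mem[of i cs] that carr cs by auto
  have "map h ?ds = map2 (\<oplus>\<^bsub>S\<^esub>) (map h (a # u)) (map ((\<otimes>\<^bsub>S\<^esub>) (h c)) (map h cs))"
    using carr nth by (intro nth_equalityI) (auto simp del: list.map)
  moreover have "(\<otimes>\<^bsub>S\<^esub>) (h c) ` h ` set cs \<subseteq> carrier S" using carr hc by auto
  ultimately have "horner S x (map h ?ds) = horner S x (map h (a # u)) \<oplus>\<^bsub>S\<^esub> h c \<otimes>\<^bsub>S\<^esub> horner S x (map h cs)"
    using carr hc x
    by (simp only: S.horner_map2_add[of "map h (a # u)" "map ((\<otimes>\<^bsub>S\<^esub>) (h c)) (map h cs)" x]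
        S.horner_map_mult[of "h c" x "map h cs"] length_map set_map list.set image_insert insert_subset
        hom_closed simp_thms)
  also have "\<dots> = h a \<oplus>\<^bsub>S\<^esub> x \<otimes>\<^bsub>S\<^esub> horner S x (map h u) \<oplus>\<^bsub>S\<^esub> h c \<otimes>\<^bsub>S\<^esub> x [^]\<^bsub>S\<^esub> Suc (length u)"
    using power carr by simp
  also have "\<dots> = h a \<oplus>\<^bsub>S\<^esub> x \<otimes>\<^bsub>S\<^esub> (horner S x (map h u) \<oplus>\<^bsub>S\<^esub> h c \<otimes>\<^bsub>S\<^esub> x [^]\<^bsub>S\<^esub> length u)"
  proof -
    have "h a \<in> carrier S" "h c \<in> carrier S" "horner S x (map h u) \<in> carrier S" "x [^]\<^bsub>S\<^esub> length u \<in> carrier S"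
      using carr hc x by auto
    then show ?thesis using x by (simp only: S.nat_pow_Suc) algebra
  qed
  also have "\<dots> = horner S x (map h (a # as))"
    using S.horner_snoc[OF x, of "map h u" "h c"] carr hc bs(3) unfolding bs_eq by simp
  finally have eq: "horner S x (map h (a # as)) = horner S x (map h ?ds)" by simp
  have "?ds ! i \<in> carrier R" if "i < length cs" for i
    using nth[OF that] that carr by (simp del: nth_Cons_Suc)
  then have "set ?ds \<subseteq> carrier R" using carr by (auto simp: in_set_conv_nth)
  then show ?case using eq carr by (intro exI[of _ ?ds]) auto
qed

section \<open>The quotient of a polynomial ring by a monic polynomial\<close>

locale poly_quotient = R: cring R for R :: "('r, 'k) ring_scheme" +
  fixes f
  assumes f: "f \<in> carrier (UP R)"
begin

abbreviation Q where "Q \<equiv> poly_quot R f"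
abbreviation h where "h \<equiv> quot_map R f"
abbreviation \<theta> where "\<theta> \<equiv> poly_class R f (pvar R)"

sublocale UP: UP_cring R "UP R"
  by (simp add: UP_cring_def R.is_cring)

sublocale I: ideal "PIdl\<^bsub>UP R\<^esub> f" "UP R"
  by (rule UP.P.cgenideal_ideal[OF f])

sublocale Q: cring Q
  unfolding poly_quot_def by (rule I.quotient_is_cring) (rule UP.P.is_cring)

lemma class_hom: "poly_class R f \<in> ring_hom (UP R) Q"
  unfolding poly_class_def[abs_def] poly_quot_def by (rule I.rcos_ring_hom)

lemma quot_map_hom: "h \<in> ring_hom R Q"
  using ring_hom_trans[OF UP.const_ring_hom class_hom]
  by (simp add: quot_map_def[abs_def] pconst_def[abs_def] comp_def)

lemma theta_closed: "\<theta> \<in> carrier Q"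
  using ring_hom_closed[OF class_hom] by (simp add: pvar_def)

lemma class_horner:
  assumes "set as \<subseteq> carrier R"
  shows "poly_class R f (horner (UP R) (pvar R) (map (pconst R) as)) = horner Q \<theta> (map h as)"
proof -
  have "set (map (pconst R) as) \<subseteq> carrier (UP R)" "pvar R \<in> carrier (UP R)"
    using assms by (auto simp: pconst_def pvar_def)
  from ring_hom_horner[OF UP.P.is_cring Q.is_cring class_hom this(2,1)]
  show ?thesis by (simp add: quot_map_def[abs_def] comp_def)
qed

lemma class_zero_iff:
  assumes "q \<in> carrier (UP R)"
  shows "poly_class R f q = \<zero>\<^bsub>Q\<^esub> \<longleftrightarrow> (\<exists>k\<in>carrier (UP R). q = k \<otimes>\<^bsub>UP R\<^esub> f)"
proof -
  have Q0: "\<zero>\<^bsub>Q\<^esub> = PIdl\<^bsub>UP R\<^esub> f" by (simp add: poly_quot_def FactRing_def)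
  have "poly_class R f q = \<zero>\<^bsub>Q\<^esub> \<longleftrightarrow> q \<in> PIdl\<^bsub>UP R\<^esub> f"
    unfolding poly_class_def Q0
    using UP.P.a_rcos_zero[OF I.is_ideal] I.rcos_const_imp_mem[OF assms] by blast
  then show ?thesis unfolding cgenideal_def by blast
qed

lemma quotient_spans_horner:
  assumes "s \<in> carrier Q"
  obtains as where "set as \<subseteq> carrier R" "s = horner Q \<theta> (map h as)"
proof -
  obtain q where q: "q \<in> carrier (UP R)" "s = poly_class R f q"
    using assms unfolding poly_quot_def poly_class_def by (rule quotient_carrierE)
  obtain as where as: "set as \<subseteq> carrier R" "q = horner (UP R) (pvar R) (map (pconst R) as)"
    using UP.poly_eq_horner[OF q(1)] unfolding pvar_def pconst_def by blast
  then show thesis using that class_horner q by simp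
qed

lemma quotient_universal:
  assumes "cring S" and k: "k \<in> ring_hom R S" and s: "s \<in> carrier S"
    and root: "eval R S k s f = \<zero>\<^bsub>S\<^esub>"
  shows "\<exists>F \<in> ring_hom Q S. (\<forall>r\<in>carrier R. F (h r) = k r) \<and> F \<theta> = s"
proof -
  interpret S: cring S by fact
  interpret E: UP_pre_univ_prop R S k "UP R"
    by (simp add: UP_pre_univ_prop_def ring_hom_cring_def ring_hom_cring_axioms_def R.is_cring S.is_cring k UP.UP_cring_axioms)
  have E: "eval R S k s \<in> ring_hom (UP R) S" by (rule E.eval_ring_hom[OF s])
  have "eval R S k s q = \<zero>\<^bsub>S\<^esub>" if "q \<in> PIdl\<^bsub>UP R\<^esub> f" for q
  proof -
    obtain r where r: "r \<in> carrier (UP R)" "q = r \<otimes>\<^bsub>UP R\<^esub> f"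
      using \<open>q \<in> PIdl\<^bsub>UP R\<^esub> f\<close> unfolding cgenideal_def by blast
    then show ?thesis
      using ring_hom_mult[OF E r(1) f] ring_hom_closed[OF E r(1)] unfolding r(2) root by simp
  qed
  from quotient_ring_hom_factor[OF I.is_ideal S.ring_axioms E this]
  obtain F where F: "F \<in> ring_hom Q S" "\<forall>q\<in>carrier (UP R). F (poly_class R f q) = eval R S k s q"
    unfolding poly_quot_def poly_class_def by blast
  have "F (h r) = k r" if "r \<in> carrier R" for r
    using F(2) E.eval_const[OF s that] that by (simp add: quot_map_def pconst_def)
  moreover have "F \<theta> = s"
    using F(2) E.eval_monom1[OF s] by (simp add: pvar_def)
  ultimately show ?thesis using F(1) by blast
qed

end

locale monic_quotient = poly_quotient R f for R :: "('r, 'k) ring_scheme" and f +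
  fixes n
  assumes lead: "up_ring.coeff (UP R) f n = \<one>\<^bsub>R\<^esub>"
    and bound: "n < i \<Longrightarrow> up_ring.coeff (UP R) f i = \<zero>\<^bsub>R\<^esub>" and n: "0 < n"
begin

text \<open>This is \<open>f(\<theta>) = 0\<close> solved for its leading term, in the form that
  \<open>horner_reduce\<close> takes as its rewriting rule.\<close>

lemma theta_power:
  defines "cs \<equiv> map (\<lambda>i. \<ominus>\<^bsub>R\<^esub> up_ring.coeff (UP R) f i) [0..<n]"
  shows "\<theta> [^]\<^bsub>Q\<^esub> n = horner Q \<theta> (map h cs)"
proof -
  let ?as = "map (up_ring.coeff (UP R) f) [0..<n]"
  interpret h: ring_hom_cring R Q h
    by unfold_locales (rule quot_map_hom)
  have as: "set ?as \<subseteq> carrier R" using f by auto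
  have has: "h ` set ?as \<subseteq> carrier Q" using as by (meson h.hom_closed image_subsetI subsetD)
  have in_UP: "set (map (pconst R) (?as @ [\<one>\<^bsub>R\<^esub>])) \<subseteq> carrier (UP R)"
    using f by (auto simp: pconst_def)
  have "f = horner (UP R) (pvar R) (map (pconst R) (?as @ [\<one>\<^bsub>R\<^esub>]))"
  proof (rule UP.up_eqI)
    show "horner (UP R) (pvar R) (map (pconst R) (?as @ [\<one>\<^bsub>R\<^esub>])) \<in> carrier (UP R)"
      using in_UP by (intro UP.P.horner_closed) (auto simp: pvar_def)
    fix i
    have "set (?as @ [\<one>\<^bsub>R\<^esub>]) \<subseteq> carrier R" using as by simp
    from UP.coeff_horner_var[OF this, of i]
    show "up_ring.coeff (UP R) f i = up_ring.coeff (UP R) (horner (UP R) (pvar R) (map (pconst R) (?as @ [\<one>\<^bsub>R\<^esub>]))) i"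
      unfolding pvar_def pconst_def[abs_def] using lead bound[of i]
      by (cases i n rule: linorder_cases) (simp_all add: nth_append)
  qed (rule f)
  then have "poly_class R f f = horner Q \<theta> (map h (?as @ [\<one>\<^bsub>R\<^esub>]))"
    using class_horner[of "?as @ [\<one>\<^bsub>R\<^esub>]"] as by simp
  also have "\<dots> = horner Q \<theta> (map h ?as) \<oplus>\<^bsub>Q\<^esub> \<theta> [^]\<^bsub>Q\<^esub> n"
  proof -
    have 1: "set (map h ?as) \<subseteq> carrier Q" using has by (simp only: set_map)
    have "horner Q \<theta> (map h (?as @ [\<one>\<^bsub>R\<^esub>])) = horner Q \<theta> (map h ?as) \<oplus>\<^bsub>Q\<^esub> \<one>\<^bsub>Q\<^esub> \<otimes>\<^bsub>Q\<^esub> \<theta> [^]\<^bsub>Q\<^esub> length (map h ?as)"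
      using Q.horner_snoc[OF theta_closed 1 Q.one_closed] by (simp only: map_append list.map h.hom_one)
    then show ?thesis using theta_closed by simp
  qed
  also have "poly_class R f f = \<zero>\<^bsub>Q\<^esub>"
    unfolding class_zero_iff[OF f] using f by (intro bexI[of _ "\<one>\<^bsub>UP R\<^esub>"]) auto
  finally have sum: "\<zero>\<^bsub>Q\<^esub> = horner Q \<theta> (map h ?as) \<oplus>\<^bsub>Q\<^esub> \<theta> [^]\<^bsub>Q\<^esub> n" .
  define w where "w = horner Q \<theta> (map h ?as)"
  have w: "w \<in> carrier Q" unfolding w_def using has by (intro Q.horner_closed theta_closed) (simp only: set_map)
  have pow: "\<theta> [^]\<^bsub>Q\<^esub> n \<in> carrier Q" using theta_closed by simp
  have "\<theta> [^]\<^bsub>Q\<^esub> n = (\<ominus>\<^bsub>Q\<^esub> \<one>\<^bsub>Q\<^esub>) \<otimes>\<^bsub>Q\<^esub> w \<oplus>\<^bsub>Q\<^esub> (w \<oplus>\<^bsub>Q\<^esub> \<theta> [^]\<^bsub>Q\<^esub> n)"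
    using w pow by algebra
  also have "\<dots> = (\<ominus>\<^bsub>Q\<^esub> \<one>\<^bsub>Q\<^esub>) \<otimes>\<^bsub>Q\<^esub> w"
    using sum[symmetric] w unfolding w_def[symmetric] by simp
  also have "\<dots> = horner Q \<theta> (map ((\<otimes>\<^bsub>Q\<^esub>) (\<ominus>\<^bsub>Q\<^esub> \<one>\<^bsub>Q\<^esub>)) (map h ?as))"
    unfolding w_def using has by (intro Q.horner_map_mult[symmetric] theta_closed) (simp_all only: set_map Q.a_inv_closed Q.one_closed)
  also have "map ((\<otimes>\<^bsub>Q\<^esub>) (\<ominus>\<^bsub>Q\<^esub> \<one>\<^bsub>Q\<^esub>)) (map h ?as) = map h cs"
    using as by (auto simp: cs_def Q.l_minus)
  finally show ?thesis .
qed

text \<open>Spanning is reduction by \<open>theta_power\<close>. For independence, a relation of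
  length \<open>n\<close> is a polynomial of degree below \<open>n\<close> that is a multiple of the
  monic \<open>f\<close>, and \<open>monic_mult_bound\<close> forces it to be zero.\<close>

sublocale power_basis R Q h \<theta> n
proof unfold_locales
  show "h \<in> ring_hom R Q" by (rule quot_map_hom)
  show "\<theta> \<in> carrier Q" by (rule theta_closed)
next
  fix s assume "s \<in> carrier Q"
  then obtain as where as: "set as \<subseteq> carrier R" "s = horner Q \<theta> (map h as)"
    by (rule quotient_spans_horner)
  interpret h: ring_hom_cring R Q h
    by unfold_locales (rule quot_map_hom)
  let ?cs = "map (\<lambda>i. \<ominus>\<^bsub>R\<^esub> up_ring.coeff (UP R) f i) [0..<n]"
  have "set ?cs \<subseteq> carrier R" using f by auto
  then show "\<exists>as. length as = n \<and> set as \<subseteq> carrier R \<and> s = horner Q \<theta> (map h as)"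
    using h.horner_reduce[OF theta_closed, of ?cs as] theta_power as n by simp
next
  fix as assume as: "length as = n" "set as \<subseteq> carrier R" "horner Q \<theta> (map h as) = \<zero>\<^bsub>Q\<^esub>"
  let ?q = "horner (UP R) (pvar R) (map (pconst R) as)"
  have "set (map (pconst R) as) \<subseteq> carrier (UP R)" using as by (auto simp: pconst_def)
  then have q: "?q \<in> carrier (UP R)" by (intro UP.P.horner_closed) (simp_all add: pvar_def)
  then obtain k where k: "k \<in> carrier (UP R)" "?q = k \<otimes>\<^bsub>UP R\<^esub> f"
    using as class_horner[of as] class_zero_iff[OF q] by auto
  have coeff: "up_ring.coeff (UP R) ?q i = (if i < length as then as ! i else \<zero>\<^bsub>R\<^esub>)" for i
    using UP.coeff_horner_var[OF as(2)] by (simp add: pvar_def pconst_def[abs_def])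
  have "k = \<zero>\<^bsub>UP R\<^esub>"
    using k coeff as(1) by (intro UP.monic_mult_bound[OF f lead bound k(1)]) (simp_all del: UP.coeff_mult flip: k(2))
  then have "?q = \<zero>\<^bsub>UP R\<^esub>" using k f by simp
  then have "as ! i = \<zero>\<^bsub>R\<^esub>" if "i < n" for i
    using coeff[of i] that as(1) by simp
  then show "set as \<subseteq> {\<zero>\<^bsub>R\<^esub>}" using as(1) by (auto simp: in_set_conv_nth)
qed

end

lemma (in power_span) ring_hom_eqI:
  assumes "cring B" "F \<in> ring_hom S B" "G \<in> ring_hom S B"
    and "\<And>r. r \<in> carrier R \<Longrightarrow> F (h r) = G (h r)" "F \<theta> = G \<theta>" "s \<in> carrier S"
  shows "F s = G s"
proof -
  obtain as where as: "set as \<subseteq> carrier R" "s = horner S \<theta> (map h as)"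
    using spans[OF assms(6)] by blast
  have eq: "map F (map h as) = map G (map h as)" using as assms(4) by auto
  have "set (map h as) \<subseteq> carrier S" using as by auto
  note ring_hom_horner[OF S.is_cring assms(1) _ \<theta> this]
  then show ?thesis unfolding as(2) using assms(2,3,5) eq by metis
qed

section \<open>Spanning powers in a tensor product\<close>

context tensor_product
begin

text \<open>The coefficients of \<open>a\<close>, coming from \<open>R\<close>, cross the tensor
  sign and are absorbed into \<open>b\<close>. All lists have the same length \<open>n\<close>, so a
  difference of two expansions is again an expansion, entry by entry.\<close>

lemma power_span_left_factor:
  assumes "power_span R A h \<theta> n"
  shows "power_span B T (\<lambda>b. t \<one>\<^bsub>A\<^esub> b) (t \<theta> \<one>\<^bsub>B\<^esub>) n"
proof -
  interpret A: power_span R A h \<theta> n by fact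
  show ?thesis
  proof unfold_locales
    fix s assume "s \<in> carrier T"
    then show "\<exists>bs. length bs = n \<and> set bs \<subseteq> carrier B \<and>
        s = horner T (t \<theta> \<one>\<^bsub>B\<^esub>) (map (\<lambda>b. t \<one>\<^bsub>A\<^esub> b) bs)"
    proof (induction rule: tensor_induct)
      case (pure a b)
      obtain as where as: "length as = n" "set as \<subseteq> carrier R" "a = horner A \<theta> (map h as)"
        using A.spans[OF pure(1)] by blast
      have has: "set (map h as) \<subseteq> carrier A" using as by auto
      have "t a \<one>\<^bsub>B\<^esub> = horner T (t \<theta> \<one>\<^bsub>B\<^esub>) (map (\<lambda>a. t a \<one>\<^bsub>B\<^esub>) (map h as))"
        unfolding as(3) by (rule ring_hom_horner[OF A.is_cring T.is_cring left_hom A.\<theta> has])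
      also have "map (\<lambda>a. t a \<one>\<^bsub>B\<^esub>) (map h as) = map (\<lambda>r. t \<one>\<^bsub>A\<^esub> (k r)) as"
        using as(2) pure_tensor_base by auto
      finally have ta: "t a \<one>\<^bsub>B\<^esub> = horner T (t \<theta> \<one>\<^bsub>B\<^esub>) (map (\<lambda>r. t \<one>\<^bsub>A\<^esub> (k r)) as)" .
      have "t a b = t \<one>\<^bsub>A\<^esub> b \<otimes>\<^bsub>T\<^esub> t a \<one>\<^bsub>B\<^esub>"
        unfolding pure_tensor_eq_mult[OF pure] using pure by (intro T.m_comm) auto
      then have "t a b = t \<one>\<^bsub>A\<^esub> b \<otimes>\<^bsub>T\<^esub> horner T (t \<theta> \<one>\<^bsub>B\<^esub>) (map (\<lambda>r. t \<one>\<^bsub>A\<^esub> (k r)) as)"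
        unfolding ta .
      moreover have kas: "set (map (\<lambda>r. t \<one>\<^bsub>A\<^esub> (k r)) as) \<subseteq> carrier T"
        using as(2) ring_hom_closed[OF k] by auto
      ultimately have "t a b = horner T (t \<theta> \<one>\<^bsub>B\<^esub>) (map ((\<otimes>\<^bsub>T\<^esub>) (t \<one>\<^bsub>A\<^esub> b)) (map (\<lambda>r. t \<one>\<^bsub>A\<^esub> (k r)) as))"
        using pure T.horner_map_mult[of "t \<one>\<^bsub>A\<^esub> b" "t \<theta> \<one>\<^bsub>B\<^esub>" "map (\<lambda>r. t \<one>\<^bsub>A\<^esub> (k r)) as"] by simp
      also have "map ((\<otimes>\<^bsub>T\<^esub>) (t \<one>\<^bsub>A\<^esub> b)) (map (\<lambda>r. t \<one>\<^bsub>A\<^esub> (k r)) as) = map (\<lambda>b. t \<one>\<^bsub>A\<^esub> b) (map (\<lambda>r. b \<otimes>\<^bsub>B\<^esub> k r) as)"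
        using as(2) pure ring_hom_closed[OF k] pure_tensor_mult[of "\<one>\<^bsub>A\<^esub>" "\<one>\<^bsub>A\<^esub>" b]
        by (auto simp: subset_iff)
      finally show ?case
        using as(1,2) pure ring_hom_closed[OF k]
        by (intro exI[of _ "map (\<lambda>r. b \<otimes>\<^bsub>B\<^esub> k r) as"]) auto
    next
      case (diff x y)
      then obtain as bs where ab: "length as = n" "set as \<subseteq> carrier B" "length bs = n" "set bs \<subseteq> carrier B"
        and xy: "x = horner T (t \<theta> \<one>\<^bsub>B\<^esub>) (map (\<lambda>b. t \<one>\<^bsub>A\<^esub> b) as)"
          "y = horner T (t \<theta> \<one>\<^bsub>B\<^esub>) (map (\<lambda>b. t \<one>\<^bsub>A\<^esub> b) bs)" by blast
      interpret r: ring_hom_cring B T "\<lambda>b. t \<one>\<^bsub>A\<^esub> b"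
        by unfold_locales (rule right_hom)
      let ?cs = "map2 (\<lambda>a b. a \<ominus>\<^bsub>B\<^esub> b) as bs"
      have nth: "as ! i \<in> carrier B" "bs ! i \<in> carrier B" if "i < n" for i using ab that by auto
      have "map (\<lambda>b. t \<one>\<^bsub>A\<^esub> b) ?cs = map2 (\<lambda>a b. a \<ominus>\<^bsub>T\<^esub> b) (map (\<lambda>b. t \<one>\<^bsub>A\<^esub> b) as) (map (\<lambda>b. t \<one>\<^bsub>A\<^esub> b) bs)"
        using ab nth by (intro nth_equalityI) (auto simp: a_minus_def)
      moreover have "set (map (\<lambda>b. t \<one>\<^bsub>A\<^esub> b) as) \<subseteq> carrier T" "set (map (\<lambda>b. t \<one>\<^bsub>A\<^esub> b) bs) \<subseteq> carrier T"
        using ab by auto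
      ultimately have "x \<ominus>\<^bsub>T\<^esub> y = horner T (t \<theta> \<one>\<^bsub>B\<^esub>) (map (\<lambda>b. t \<one>\<^bsub>A\<^esub> b) ?cs)"
        unfolding xy using ab by (subst T.horner_map2_minus[symmetric]) auto
      moreover have "?cs ! i \<in> carrier B" if "i < n" for i using nth[OF that] that ab by simp
      then have "set ?cs \<subseteq> carrier B" using ab by (auto simp: in_set_conv_nth)
      ultimately show ?case using ab by (intro exI[of _ ?cs]) auto
    qed
  qed (auto intro: right_hom)
qed

end

lemma tensor_product_swap: "tensor_product R A h B k \<Longrightarrow> tensor_product R B k A h"
  by (simp add: tensor_product_def tensor_product_axioms_def)

context tensor_product
begin

text \<open>The mirror image is obtained by exchanging the factors: \<open>G\<close> moves an
  element to the swapped tensor product, where it is expanded, and \<open>F\<close> brings the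
  expansion back. For this \<open>F\<close> has to be a left inverse of \<open>G\<close>.\<close>

lemma power_span_right_factor:
  assumes "power_span R B k \<theta> n"
  shows "power_span A T (\<lambda>a. t a \<one>\<^bsub>B\<^esub>) (t \<one>\<^bsub>A\<^esub> \<theta>) n"
proof -
  interpret B: power_span R B k \<theta> n by fact
  interpret swap: tensor_product R B k A h
    using tensor_product_swap[OF tensor_product_axioms] .
  interpret swap: power_span A swap.T "\<lambda>a. swap.t \<one>\<^bsub>B\<^esub> a" "swap.t \<theta> \<one>\<^bsub>A\<^esub>" n
    by (rule swap.power_span_left_factor[OF assms])
  obtain F where F: "F \<in> ring_hom swap.T T"
    "\<And>b a. b \<in> carrier B \<Longrightarrow> a \<in> carrier A \<Longrightarrow> F (swap.t b a) = t \<one>\<^bsub>A\<^esub> b \<otimes>\<^bsub>T\<^esub> t a \<one>\<^bsub>B\<^esub>"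
    using swap.tensor_universal[OF T.is_cring right_hom left_hom] pure_tensor_base by metis
  obtain G where G: "G \<in> ring_hom T swap.T"
    "\<And>a b. a \<in> carrier A \<Longrightarrow> b \<in> carrier B \<Longrightarrow> G (t a b) = swap.t \<one>\<^bsub>B\<^esub> a \<otimes>\<^bsub>swap.T\<^esub> swap.t b \<one>\<^bsub>A\<^esub>"
    using tensor_universal[OF swap.T.is_cring swap.right_hom swap.left_hom] swap.pure_tensor_base by metis
  have FG: "F (G s) = s" if "s \<in> carrier T" for s
  proof -
    have "(F \<circ> G) s = id s"
    proof (rule ring_hom_tensor_eqI[OF T.ring_axioms ring_hom_trans[OF G(1) F(1)] _ _ that])
      show "id \<in> ring_hom T T" by (rule ring_hom_memI) auto
      fix a b assume ab: "a \<in> carrier A" "b \<in> carrier B"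
      then have "G (t a b) = swap.t b a"
        using G(2)[OF ab] swap.pure_tensor_eq_mult[OF ab(2,1)]
        by (simp add: swap.T.m_comm)
      then show "(F \<circ> G) (t a b) = id (t a b)"
        using F(2)[OF ab(2,1)] pure_tensor_eq_mult[OF ab] ab by (simp add: T.m_comm)
    qed
    then show ?thesis by simp
  qed
  show ?thesis
  proof unfold_locales
    fix s assume s: "s \<in> carrier T"
    obtain as where as: "length as = n" "set as \<subseteq> carrier A"
      "G s = horner swap.T (swap.t \<theta> \<one>\<^bsub>A\<^esub>) (map (\<lambda>a. swap.t \<one>\<^bsub>B\<^esub> a) as)"
      using swap.spans[OF ring_hom_closed[OF G(1) s]] by blast
    have "set (map (\<lambda>a. swap.t \<one>\<^bsub>B\<^esub> a) as) \<subseteq> carrier swap.T" using as(2) by auto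
    then have "s = horner T (F (swap.t \<theta> \<one>\<^bsub>A\<^esub>)) (map F (map (\<lambda>a. swap.t \<one>\<^bsub>B\<^esub> a) as))"
      using FG[OF s] as(3) ring_hom_horner[OF swap.T.is_cring T.is_cring F(1) swap.\<theta>] by metis
    also have "F (swap.t \<theta> \<one>\<^bsub>A\<^esub>) = t \<one>\<^bsub>A\<^esub> \<theta>" using F(2)[of \<theta> "\<one>\<^bsub>A\<^esub>"] by (simp add: pure_tensor_one)
    also have "map F (map (\<lambda>a. swap.t \<one>\<^bsub>B\<^esub> a) as) = map (\<lambda>a. t a \<one>\<^bsub>B\<^esub>) as"
      using as(2) F(2)[of "\<one>\<^bsub>B\<^esub>"] by (auto simp: pure_tensor_one subset_iff)
    finally show "\<exists>as. length as = n \<and> set as \<subseteq> carrier A \<and> s = horner T (t \<one>\<^bsub>A\<^esub> \<theta>) (map (\<lambda>a. t a \<one>\<^bsub>B\<^esub>) as)"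
      using as by blast
  qed (auto intro: left_hom)
qed

end

section \<open>A criterion for Galois extensions\<close>

text \<open>
  As \<open>S \<otimes> S\<close> is spanned over \<open>S\<close> by the powers of \<open>1 \<otimes> \<theta>\<close>, the map to \<open>S\<^sup>G\<close> evaluates polynomials of
  degree less than \<open>n\<close> at the \<open>n\<close> points \<open>g(\<theta>)\<close>.
\<close>

theorem (in power_basis) galois_extensionI:
  assumes n: "0 < n" and G: "finite (carrier G)" "card (carrier G) = n"
    and action: "group_action G (carrier S) act"
    and hom: "\<And>g. g \<in> carrier G \<Longrightarrow> act g \<in> ring_hom S S"
    and fix_R: "\<And>g r. g \<in> carrier G \<Longrightarrow> r \<in> carrier R \<Longrightarrow> act g (h r) = h r"
    and units: "\<And>g g'. g \<in> carrier G \<Longrightarrow> g' \<in> carrier G \<Longrightarrow> g \<noteq> g' \<Longrightarrow> act g \<theta> \<ominus>\<^bsub>S\<^esub> act g' \<theta> \<in> Units S"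
  shows "galois_extension R S h G act"
proof -
  interpret TT: tensor_product R S h S h
    by unfold_locales (auto intro: h)
  interpret TT: power_span S TT.T "\<lambda>s. TT.t s \<one>\<^bsub>S\<^esub>" "TT.t \<one>\<^bsub>S\<^esub> \<theta>" n
    by (rule TT.power_span_right_factor) (rule power_span_axioms)
  obtain gs where gs: "distinct gs" "set gs = carrier G" using finite_distinct_list[OF G(1)] by blast
  then have len: "length gs = n" using G(2) by (metis distinct_card)
  \<comment> \<open>The orbit of \<open>\<theta>\<close> along an enumeration of \<open>G\<close>:
    as many points as a coefficient list has entries, so interpolation is both possible and
    unique.\<close>
  define xs where "xs = map (\<lambda>g. act g \<theta>) gs"
  have closed: "act g s \<in> carrier S" if "g \<in> carrier G" "s \<in> carrier S" for g s
    using ring_hom_closed[OF hom] that by blast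
  have xs: "length xs = n" "set xs \<subseteq> carrier S" using closed gs len by (auto simp: xs_def)
  have sorted: "sorted_wrt (\<lambda>x y. y \<ominus>\<^bsub>S\<^esub> x \<in> Units S) xs"
    unfolding xs_def sorted_wrt_map unfolding sorted_wrt_iff_nth_less
  proof (intro allI impI)
    fix i j assume ij: "i < j" "j < length gs"
    have "gs ! i \<in> carrier G" "gs ! j \<in> carrier G" "gs ! j \<noteq> gs ! i"
      using nth_mem[of i gs] nth_mem[of j gs] nth_eq_iff_index_eq[OF gs(1), of j i] ij unfolding gs(2) by simp_all
    then show "act (gs ! j) \<theta> \<ominus>\<^bsub>S\<^esub> act (gs ! i) \<theta> \<in> Units S"
      using units by blast
  qed
  \<comment> \<open>The component at \<open>g\<close> is
    \<open>a \<otimes> b \<mapsto> a g(b)\<close>; it respects the balancing relations because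
    \<open>g\<close> fixes the image of \<open>R\<close>.\<close>
  have "\<forall>g\<in>carrier G. \<exists>F\<in>ring_hom TT.T S. \<forall>a\<in>carrier S. \<forall>b\<in>carrier S. F (TT.t a b) = a \<otimes>\<^bsub>S\<^esub> act g b"
  proof
    fix g assume g: "g \<in> carrier G"
    have "id \<in> ring_hom S S" by (rule ring_hom_memI) auto
    from TT.tensor_universal[OF S.is_cring this hom[OF g]] fix_R[OF g]
    show "\<exists>F\<in>ring_hom TT.T S. \<forall>a\<in>carrier S. \<forall>b\<in>carrier S. F (TT.t a b) = a \<otimes>\<^bsub>S\<^esub> act g b" by simp
  qed
  then obtain F where F: "\<And>g. g \<in> carrier G \<Longrightarrow> F g \<in> ring_hom TT.T S"
    "\<And>g a b. g \<in> carrier G \<Longrightarrow> a \<in> carrier S \<Longrightarrow> b \<in> carrier S \<Longrightarrow> F g (TT.t a b) = a \<otimes>\<^bsub>S\<^esub> act g b"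
    by metis
  define f where "f z = (\<lambda>g\<in>carrier G. F g z)" for z
  let ?z = "\<lambda>as. horner TT.T (TT.t \<one>\<^bsub>S\<^esub> \<theta>) (map (\<lambda>s. TT.t s \<one>\<^bsub>S\<^esub>) as)"
  have z_closed: "?z as \<in> carrier TT.T" if "set as \<subseteq> carrier S" for as
    using that by (intro TT.T.horner_closed) auto
  have F_z: "F g (?z as) = horner S (act g \<theta>) as" if "g \<in> carrier G" "set as \<subseteq> carrier S" for g as
  proof -
    have "set (map (\<lambda>s. TT.t s \<one>\<^bsub>S\<^esub>) as) \<subseteq> carrier TT.T" using that by auto
    then have "F g (?z as) = horner S (F g (TT.t \<one>\<^bsub>S\<^esub> \<theta>)) (map (F g) (map (\<lambda>s. TT.t s \<one>\<^bsub>S\<^esub>) as))"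
      by (intro ring_hom_horner[OF TT.T.is_cring S.is_cring F(1)[OF that(1)]]) auto
    also have "F g (TT.t \<one>\<^bsub>S\<^esub> \<theta>) = act g \<theta>" using F(2)[of g "\<one>\<^bsub>S\<^esub>" \<theta>] closed that by simp
    also have "map (F g) (map (\<lambda>s. TT.t s \<one>\<^bsub>S\<^esub>) as) = as"
      using that F(2)[of g _ "\<one>\<^bsub>S\<^esub>"] ring_hom_one[OF hom[OF that(1)]]
      by (auto simp: subset_iff intro!: map_idI)
    finally show ?thesis .
  qed
  have inj: "inj_on f (carrier TT.T)"
  proof (rule inj_onI)
    fix z z' assume "z \<in> carrier TT.T" "z' \<in> carrier TT.T" and eq: "f z = f z'"
    then obtain as bs where as: "length as = n" "set as \<subseteq> carrier S" "z = ?z as"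
      and bs: "length bs = n" "set bs \<subseteq> carrier S" "z' = ?z bs"
      using TT.spans by meson
    let ?cs = "map2 (\<lambda>a b. a \<ominus>\<^bsub>S\<^esub> b) as bs"
    have nth: "as ! i \<in> carrier S" "bs ! i \<in> carrier S" if "i < n" for i using as bs that by auto
    have "set ?cs \<subseteq> {\<zero>\<^bsub>S\<^esub>}"
    proof (rule S.interpolation_unique[OF _ _ xs(2) sorted])
      show "length ?cs = length xs" using as bs xs by simp
      have "?cs ! i \<in> carrier S" if "i < n" for i using nth[OF that] that as bs by simp
      then show "set ?cs \<subseteq> carrier S" using as bs by (auto simp: in_set_conv_nth)
    next
      fix x assume "x \<in> set xs"
      then obtain g where g: "g \<in> carrier G" "x = act g \<theta>" using gs by (auto simp: xs_def)
      have "f z g = f z' g" using eq by simp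
      then have eqg: "horner S x as = horner S x bs"
        using g F_z[OF g(1) as(2)] F_z[OF g(1) bs(2)] as(3) bs(3) by (simp add: f_def)
      have x: "x \<in> carrier S" using g closed by simp
      have "horner S x ?cs = horner S x as \<ominus>\<^bsub>S\<^esub> horner S x bs"
        using as bs x by (intro S.horner_map2_minus) auto
      also have "\<dots> = \<zero>\<^bsub>S\<^esub>" using eqg bs x by (simp add: a_minus_def S.r_neg)
      finally show "horner S x ?cs = \<zero>\<^bsub>S\<^esub>" .
    qed
    then have "as ! i \<ominus>\<^bsub>S\<^esub> bs ! i = \<zero>\<^bsub>S\<^esub>" if "i < n" for i
      using that as bs nth_mem[of i ?cs] by auto
    then have "as = bs" using as bs nth by (intro nth_equalityI) auto
    then show "z = z'" using as bs by simp
  qed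
  have surj: "f ` carrier TT.T = carrier (power_ring (carrier G) S)"
  proof (intro equalityI subsetI)
    fix y assume "y \<in> f ` carrier TT.T"
    then show "y \<in> carrier (power_ring (carrier G) S)"
      using ring_hom_closed[OF F(1)] by (auto simp: power_ring_def f_def)
  next
    fix y assume "y \<in> carrier (power_ring (carrier G) S)"
    then have y: "y \<in> carrier G \<rightarrow>\<^sub>E carrier S" by (simp add: power_ring_def)
    obtain as where as: "length as = n" "set as \<subseteq> carrier S" "map (\<lambda>x. horner S x as) xs = map y gs"
      using S.interpolation_exists[OF _ _ xs(2) sorted, of "map y gs"] xs len y gs by auto
    have "f (?z as) g = y g" if "g \<in> carrier G" for g
      using as(3) that gs F_z[OF that as(2)] by (simp add: f_def xs_def)
    then have "f (?z as) = y"
      using y by (intro extensionalityI[of _ "carrier G"]) (auto simp: f_def PiE_def)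
    then show "y \<in> f ` carrier TT.T" using z_closed[OF as(2)] by blast
  qed
  have "f \<in> ring_hom TT.T (power_ring (carrier G) S)"
  proof (rule ring_hom_memI)
    fix z assume "z \<in> carrier TT.T"
    then show "f z \<in> carrier (power_ring (carrier G) S)" using surj by blast
  next
    fix z w assume "z \<in> carrier TT.T" "w \<in> carrier TT.T"
    then show "f (z \<otimes>\<^bsub>TT.T\<^esub> w) = f z \<otimes>\<^bsub>power_ring (carrier G) S\<^esub> f w"
      "f (z \<oplus>\<^bsub>TT.T\<^esub> w) = f z \<oplus>\<^bsub>power_ring (carrier G) S\<^esub> f w"
      using ring_hom_mult[OF F(1)] ring_hom_add[OF F(1)]
      by (auto simp: f_def power_ring_def fun_eq_iff restrict_def)
  next
    show "f \<one>\<^bsub>TT.T\<^esub> = \<one>\<^bsub>power_ring (carrier G) S\<^esub>"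
      using ring_hom_one[OF F(1)] by (auto simp: f_def power_ring_def fun_eq_iff restrict_def)
  qed
  then have "f \<in> ring_iso TT.T (power_ring (carrier G) S)"
    using inj surj by (simp add: ring_iso_def bij_betw_def)
  moreover have "\<forall>a\<in>carrier S. \<forall>b\<in>carrier S. f (TT.t a b) = (\<lambda>g\<in>carrier G. a \<otimes>\<^bsub>S\<^esub> act g b)"
    using F(2) by (auto simp: f_def fun_eq_iff restrict_def)
  moreover have "comm_algebra R S h"
    by (simp add: comm_algebra_def R.is_cring S.is_cring h)
  ultimately show ?thesis
    unfolding galois_extension_def
    using inj_h[OF n] G(1) action hom fix_R finitely_generated projective by blast
qed

section \<open>Separability of a monic polynomial\<close>

text \<open>The values of a polynomial at \<open>x\<close> and \<open>y\<close> differ by a multiple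
  of \<open>x - y\<close>, which \<open>e\<close> kills. It extends
  \<open>u \<epsilon> = w \<epsilon>\<close> from the generator \<open>\<theta>\<close> to all
  elements of \<open>Q\<close>.\<close>

lemma (in cring) horner_annihilate:
  assumes "x \<in> carrier R" "y \<in> carrier R" "e \<in> carrier R" "x \<otimes> e = y \<otimes> e" "set as \<subseteq> carrier R"
  shows "horner R x as \<otimes> e = horner R y as \<otimes> e"
  using assms(5)
proof (induction as)
  case (Cons a as)
  have c: "a \<in> carrier R" "horner R x as \<in> carrier R" "horner R y as \<in> carrier R"
    using Cons.prems assms by auto
  have IH: "horner R x as \<otimes> e = horner R y as \<otimes> e" using Cons by simp
  have "(a \<oplus> x \<otimes> horner R x as) \<otimes> e = a \<otimes> e \<oplus> x \<otimes> (horner R x as \<otimes> e)"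
    using c assms(1-3) by algebra
  also have "\<dots> = a \<otimes> e \<oplus> (x \<otimes> e) \<otimes> horner R y as"
    unfolding IH using c assms(1-3) by algebra
  also have "\<dots> = (a \<oplus> y \<otimes> horner R y as) \<otimes> e"
    unfolding assms(4) using c assms(1-3) by algebra
  finally show ?case by simp
qed simp

lemma UP_pre_univ_propI:
  "cring A \<Longrightarrow> cring B \<Longrightarrow> u \<in> ring_hom A B \<Longrightarrow> UP_pre_univ_prop A B u"
  by (simp add: UP_pre_univ_prop_def ring_hom_cring_def ring_hom_cring_axioms_def UP_cring_def)

lemma eval_horner:
  assumes "cring A" "cring B" "u \<in> ring_hom A B" "s \<in> carrier B" "set as \<subseteq> carrier A"
    and q: "q = horner (UP A) (pvar A) (map (pconst A) as)"
  shows "UnivPoly.eval A B u s q = horner B s (map u as)"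
proof -
  interpret UP_pre_univ_prop A B u "UP A"
    by (rule UP_pre_univ_propI[OF assms(1-3)])
  have c: "set (map (pconst A) as) \<subseteq> carrier (UP A)" "pvar A \<in> carrier (UP A)"
    using assms by (auto simp: pconst_def pvar_def)
  have "UnivPoly.eval A B u s q = horner B (UnivPoly.eval A B u s (pvar A)) (map (UnivPoly.eval A B u s) (map (pconst A) as))"
    unfolding q by (rule ring_hom_horner[OF P.is_cring S.is_cring eval_ring_hom[OF assms(4)] c(2,1)])
  also have "UnivPoly.eval A B u s (pvar A) = s" unfolding pvar_def by (rule eval_monom1[OF assms(4)])
  also have "map (UnivPoly.eval A B u s) (map (pconst A) as) = map u as"
    using assms(5) eval_const[OF assms(4)] by (auto simp: pconst_def)
  finally show ?thesis .
qed

text \<open>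
  The hypothesis is the Taylor expansion of \<open>f\<close> at \<open>\<theta>\<close>, so \<open>d = f'(\<theta>)\<close>.  With \<open>u = 1 \<otimes> \<theta>\<close> and
  \<open>w = \<theta> \<otimes> 1\<close>, the element \<open>(d + (u - w) q(u))/d\<close> is a separability idempotent if \<open>d\<close> is a unit.
  Conversely, every element of \<open>Q \<otimes> Q\<close> annihilated by \<open>u - w\<close> is a multiple of \<open>d + (u - w) q(u)\<close>,
  hence its image in \<open>Q\<close> is a multiple of \<open>d\<close>.
\<close>

lemma (in monic_quotient) separable_poly_iff:
  fixes d q
  defines "V \<equiv> UP Q" and "y \<equiv> pvar Q" and "x \<equiv> pconst Q \<theta>"
  assumes d: "d \<in> carrier Q" and q: "q \<in> carrier V"
    and factor: "eval R V (\<lambda>r. pconst Q (h r)) y f =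
      (y \<ominus>\<^bsub>V\<^esub> x) \<otimes>\<^bsub>V\<^esub> (pconst Q d \<oplus>\<^bsub>V\<^esub> (y \<ominus>\<^bsub>V\<^esub> x) \<otimes>\<^bsub>V\<^esub> q)"
  shows "separable_poly R f \<longleftrightarrow> d \<in> Units Q"
proof -
  interpret E: tensor_product R Q h Q h
    by unfold_locales (auto intro: h)
  interpret E: power_span Q E.T "\<lambda>s. E.t s \<one>\<^bsub>Q\<^esub>" "E.t \<one>\<^bsub>Q\<^esub> \<theta>" n
    by (rule E.power_span_right_factor) (rule power_span_axioms)
  interpret V: UP_cring Q V
    by (simp_all add: UP_cring_def Q.is_cring V_def)
  define u where "u = E.t \<one>\<^bsub>Q\<^esub> \<theta>"
  define w where "w = E.t \<theta> \<one>\<^bsub>Q\<^esub>"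
  have uw: "u \<in> carrier E.T" "w \<in> carrier E.T" by (simp_all add: u_def w_def)
  have pconst: "pconst Q z \<in> carrier V" if "z \<in> carrier Q" for z
    using that by (simp add: pconst_def V_def[symmetric])
  have y: "y \<in> carrier V" by (simp add: y_def pvar_def V_def[symmetric])
  have x: "x \<in> carrier V" unfolding x_def by (rule pconst[OF \<theta>])
  have pconst_hom: "pconst Q \<in> ring_hom Q V"
    using V.const_ring_hom by (simp add: pconst_def[abs_def] V_def[symmetric])
  have const_hom: "(\<lambda>r. pconst Q (h r)) \<in> ring_hom R V"
    using ring_hom_trans[OF h pconst_hom] by (simp add: comp_def)
  interpret EV: UP_pre_univ_prop R V "\<lambda>r. pconst Q (h r)" "UP R"
    by (rule UP_pre_univ_propI[OF R.is_cring V.P.is_cring const_hom])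
  obtain fs where fs: "set fs \<subseteq> carrier R" "f = horner (UP R) (pvar R) (map (pconst R) fs)"
    using UP.poly_eq_horner[OF f] unfolding pvar_def pconst_def by blast
  \<comment> \<open>This is \<open>f\<close> regarded as a polynomial over \<open>Q\<close>; by
    \<open>factor\<close> its root \<open>\<theta>\<close> splits off.\<close>
  define fV where "fV = eval R V (\<lambda>r. pconst Q (h r)) y f"
  have fV: "fV \<in> carrier V" unfolding fV_def by (rule ring_hom_closed[OF EV.eval_ring_hom[OF y] f])
  have fV_horner: "fV = horner V y (map (pconst Q) (map h fs))"
    using eval_horner[OF R.is_cring V.P.is_cring const_hom y fs] unfolding fV_def by (simp add: comp_def)
  have hfs: "set (map h fs) \<subseteq> carrier Q" using fs(1) by auto
  have ev_w: "eval Q B k s fV = horner B s (map k (map h fs))"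
    if "cring B" "k \<in> ring_hom Q B" "s \<in> carrier B" for B :: "('z, 'y) ring_scheme" and k s
    by (rule eval_horner[OF Q.is_cring that hfs]) (simp only: fV_horner y_def V_def)
  show ?thesis
  proof
    assume "d \<in> Units Q"
    then have d': "inv\<^bsub>Q\<^esub> d \<in> carrier Q" "d \<otimes>\<^bsub>Q\<^esub> inv\<^bsub>Q\<^esub> d = \<one>\<^bsub>Q\<^esub>" by auto
    \<comment> \<open>Substitutes \<open>u\<close> for the variable and puts the coefficients into
      the left factor. It sends \<open>y - x\<close> to \<open>u - w\<close>, so
      \<open>factor\<close> becomes an identity in \<open>Q \<otimes> Q\<close>.\<close>
    define \<Psi> where "\<Psi> = eval Q E.T (\<lambda>s. E.t s \<one>\<^bsub>Q\<^esub>) u"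
    interpret K: UP_pre_univ_prop Q E.T "\<lambda>s. E.t s \<one>\<^bsub>Q\<^esub>" V
      unfolding V_def by (rule UP_pre_univ_propI[OF Q.is_cring E.T.is_cring E.left_hom])
    have \<Psi>: "\<Psi> \<in> ring_hom V E.T" unfolding \<Psi>_def by (rule K.eval_ring_hom[OF uw(1)])
    interpret \<Psi>: ring_hom_cring V E.T \<Psi>
      by unfold_locales (rule \<Psi>)
    have \<Psi>_y: "\<Psi> y = u" and \<Psi>_const: "\<And>z. z \<in> carrier Q \<Longrightarrow> \<Psi> (pconst Q z) = E.t z \<one>\<^bsub>Q\<^esub>"
      using K.eval_monom1[OF uw(1)] K.eval_const[OF uw(1)]
      by (simp_all add: \<Psi>_def y_def pvar_def pconst_def V_def)
    \<comment> \<open>The coefficients of \<open>f\<close> come from \<open>R\<close> and may move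
      to the right factor; then \<open>\<Psi> fV\<close> is the image of
      \<open>f(\<theta>) = 0\<close> under the right inclusion.\<close>
    have "map (\<lambda>s. E.t s \<one>\<^bsub>Q\<^esub>) (map h fs) = map (\<lambda>s. E.t \<one>\<^bsub>Q\<^esub> s) (map h fs)"
      using fs(1) E.pure_tensor_base by auto
    then have "\<Psi> fV = horner E.T u (map (\<lambda>s. E.t \<one>\<^bsub>Q\<^esub> s) (map h fs))"
      unfolding \<Psi>_def ev_w[OF E.T.is_cring E.left_hom uw(1)] by (simp only:)
    also have "\<dots> = E.t \<one>\<^bsub>Q\<^esub> (horner Q \<theta> (map h fs))"
      unfolding u_def by (rule ring_hom_horner[OF Q.is_cring E.T.is_cring E.right_hom \<theta> hfs, symmetric])
    also have "horner Q \<theta> (map h fs) = \<zero>\<^bsub>Q\<^esub>"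
    proof -
      have "poly_class R f f = \<zero>\<^bsub>Q\<^esub>"
        unfolding class_zero_iff[OF f] using UP.P.l_one[OF f] UP.P.one_closed by metis
      then show ?thesis using class_horner[OF fs(1)] unfolding fs(2)[symmetric] by simp
    qed
    finally have \<Psi>_fV: "\<Psi> fV = \<zero>\<^bsub>E.T\<^esub>" using ring_hom_zero[OF E.right_hom Q.ring_axioms E.T.ring_axioms] by simp
    define \<epsilon>0 where "\<epsilon>0 = E.t d \<one>\<^bsub>Q\<^esub> \<oplus>\<^bsub>E.T\<^esub> (u \<ominus>\<^bsub>E.T\<^esub> w) \<otimes>\<^bsub>E.T\<^esub> \<Psi> q"
    define \<epsilon> where "\<epsilon> = \<epsilon>0 \<otimes>\<^bsub>E.T\<^esub> E.t (inv\<^bsub>Q\<^esub> d) \<one>\<^bsub>Q\<^esub>"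
    have qV: "\<Psi> q \<in> carrier E.T" using q by simp
    have \<epsilon>0: "\<epsilon>0 \<in> carrier E.T" using d uw qV by (simp add: \<epsilon>0_def)
    then have \<epsilon>: "\<epsilon> \<in> carrier E.T" using d' by (simp add: \<epsilon>_def)
    have \<Psi>_x: "\<Psi> x = w" using \<Psi>_const[OF \<theta>] by (simp add: x_def w_def)
    have "\<Psi> fV = (u \<ominus>\<^bsub>E.T\<^esub> w) \<otimes>\<^bsub>E.T\<^esub> \<epsilon>0"
      unfolding fV_def factor \<epsilon>0_def using x y q pconst[OF d]
      by (simp add: a_minus_def \<Psi>_y \<Psi>_x \<Psi>_const[OF d])
    then have zero: "(u \<ominus>\<^bsub>E.T\<^esub> w) \<otimes>\<^bsub>E.T\<^esub> \<epsilon>0 = \<zero>\<^bsub>E.T\<^esub>" using \<Psi>_fV by simp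
    have "(u \<ominus>\<^bsub>E.T\<^esub> w) \<otimes>\<^bsub>E.T\<^esub> \<epsilon> = ((u \<ominus>\<^bsub>E.T\<^esub> w) \<otimes>\<^bsub>E.T\<^esub> \<epsilon>0) \<otimes>\<^bsub>E.T\<^esub> E.t (inv\<^bsub>Q\<^esub> d) \<one>\<^bsub>Q\<^esub>"
      using \<epsilon>0 uw d' by (simp add: \<epsilon>_def E.T.m_assoc)
    also have "\<dots> = \<zero>\<^bsub>E.T\<^esub>" unfolding zero using d' by simp
    finally have "(u \<ominus>\<^bsub>E.T\<^esub> w) \<otimes>\<^bsub>E.T\<^esub> \<epsilon> = \<zero>\<^bsub>E.T\<^esub>" .
    moreover have "u \<otimes>\<^bsub>E.T\<^esub> \<epsilon> = (u \<ominus>\<^bsub>E.T\<^esub> w) \<otimes>\<^bsub>E.T\<^esub> \<epsilon> \<oplus>\<^bsub>E.T\<^esub> w \<otimes>\<^bsub>E.T\<^esub> \<epsilon>"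
      using uw \<epsilon> by algebra
    ultimately have u\<epsilon>: "u \<otimes>\<^bsub>E.T\<^esub> \<epsilon> = w \<otimes>\<^bsub>E.T\<^esub> \<epsilon>" using uw \<epsilon> by simp
    have swap: "E.t \<one>\<^bsub>Q\<^esub> z \<otimes>\<^bsub>E.T\<^esub> \<epsilon> = E.t z \<one>\<^bsub>Q\<^esub> \<otimes>\<^bsub>E.T\<^esub> \<epsilon>" if z_in: "z \<in> carrier Q" for z
    proof -
      obtain as where as: "set as \<subseteq> carrier R" "z = horner Q \<theta> (map h as)" using spans[OF z_in] by blast
      have has: "set (map h as) \<subseteq> carrier Q" using as by auto
      have eq: "map (\<lambda>s. E.t s \<one>\<^bsub>Q\<^esub>) (map h as) = map (\<lambda>s. E.t \<one>\<^bsub>Q\<^esub> s) (map h as)"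
        using as(1) E.pure_tensor_base by auto
      have "set (map (\<lambda>s. E.t s \<one>\<^bsub>Q\<^esub>) (map h as)) \<subseteq> carrier E.T" using has by auto
      from E.T.horner_annihilate[OF uw \<epsilon> u\<epsilon> this] show ?thesis
        unfolding as(2) ring_hom_horner[OF Q.is_cring E.T.is_cring E.left_hom \<theta> has]
          ring_hom_horner[OF Q.is_cring E.T.is_cring E.right_hom \<theta> has] eq u_def w_def .
    qed
    have id_hom: "(\<lambda>z. z) \<in> ring_hom Q Q" by (rule ring_hom_memI) auto
    obtain m where m: "m \<in> ring_hom E.T Q"
      "\<And>a b. a \<in> carrier Q \<Longrightarrow> b \<in> carrier Q \<Longrightarrow> m (E.t a b) = a \<otimes>\<^bsub>Q\<^esub> b"
      using E.tensor_universal[OF Q.is_cring id_hom id_hom] by blast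
    interpret m: ring_hom_cring E.T Q m
      by unfold_locales (rule m(1))
    have "m \<epsilon> = (d \<oplus>\<^bsub>Q\<^esub> (\<theta> \<ominus>\<^bsub>Q\<^esub> \<theta>) \<otimes>\<^bsub>Q\<^esub> m (\<Psi> q)) \<otimes>\<^bsub>Q\<^esub> inv\<^bsub>Q\<^esub> d"
      using d d' uw qV by (simp add: \<epsilon>_def \<epsilon>0_def a_minus_def m(2) u_def w_def)
    also have "\<dots> = \<one>\<^bsub>Q\<^esub>" using d d' qV by (simp add: a_minus_def Q.r_neg)
    finally have m\<epsilon>: "m \<epsilon> = \<one>\<^bsub>Q\<^esub>" .
    \<comment> \<open>On multiples of \<open>\<epsilon>\<close> the ring
      \<open>Q \<otimes> Q\<close> acts through \<open>m\<close>. This makes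
      \<open>z \<mapsto> (z \<otimes> 1) \<epsilon>\<close> linear, and it is a section of
      \<open>m\<close> because \<open>m \<epsilon> = 1\<close>.\<close>
    have absorb: "E.t (m e) \<one>\<^bsub>Q\<^esub> \<otimes>\<^bsub>E.T\<^esub> \<epsilon> = e \<otimes>\<^bsub>E.T\<^esub> \<epsilon>" if "e \<in> carrier E.T" for e
      using that
    proof (induction rule: E.tensor_induct)
      case (pure a b)
      have "E.t (a \<otimes>\<^bsub>Q\<^esub> b) \<one>\<^bsub>Q\<^esub> \<otimes>\<^bsub>E.T\<^esub> \<epsilon> = E.t a \<one>\<^bsub>Q\<^esub> \<otimes>\<^bsub>E.T\<^esub> (E.t b \<one>\<^bsub>Q\<^esub> \<otimes>\<^bsub>E.T\<^esub> \<epsilon>)"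
        using pure \<epsilon> E.pure_tensor_mult[of a b "\<one>\<^bsub>Q\<^esub>" "\<one>\<^bsub>Q\<^esub>"] by (simp add: E.T.m_assoc)
      also have "\<dots> = E.t a \<one>\<^bsub>Q\<^esub> \<otimes>\<^bsub>E.T\<^esub> E.t \<one>\<^bsub>Q\<^esub> b \<otimes>\<^bsub>E.T\<^esub> \<epsilon>"
        using pure \<epsilon> by (simp add: swap[symmetric] E.T.m_assoc)
      finally show ?case using pure by (simp add: m(2) E.pure_tensor_eq_mult[symmetric])
    next
      case (diff a b)
      have c: "E.t (m a) \<one>\<^bsub>Q\<^esub> \<in> carrier E.T" "E.t (m b) \<one>\<^bsub>Q\<^esub> \<in> carrier E.T" using diff by auto
      interpret l: ring_hom_cring Q E.T "\<lambda>s. E.t s \<one>\<^bsub>Q\<^esub>"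
        by unfold_locales (rule E.left_hom)
      have "E.t (m (a \<ominus>\<^bsub>E.T\<^esub> b)) \<one>\<^bsub>Q\<^esub> = E.t (m a) \<one>\<^bsub>Q\<^esub> \<ominus>\<^bsub>E.T\<^esub> E.t (m b) \<one>\<^bsub>Q\<^esub>"
        using diff by (simp add: a_minus_def)
      then have "E.t (m (a \<ominus>\<^bsub>E.T\<^esub> b)) \<one>\<^bsub>Q\<^esub> \<otimes>\<^bsub>E.T\<^esub> \<epsilon> = E.t (m a) \<one>\<^bsub>Q\<^esub> \<otimes>\<^bsub>E.T\<^esub> \<epsilon> \<ominus>\<^bsub>E.T\<^esub> E.t (m b) \<one>\<^bsub>Q\<^esub> \<otimes>\<^bsub>E.T\<^esub> \<epsilon>"
        using c \<epsilon> by (simp only:) algebra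
      also have "\<dots> = (a \<ominus>\<^bsub>E.T\<^esub> b) \<otimes>\<^bsub>E.T\<^esub> \<epsilon>"
        unfolding diff(3,4) using diff(1,2) \<epsilon> by algebra
      finally show ?case .
    qed
    \<comment> \<open>Rank one is enough. The index must have the type of elements of
      \<open>Q\<close>, and zero is such an index.\<close>
    let ?F = "free_module E.T {\<zero>\<^bsub>Q\<^esub>}" and ?M = "alg_module Q m"
    have carr: "g \<in> carrier ?F \<longleftrightarrow> g \<in> {\<zero>\<^bsub>Q\<^esub>} \<rightarrow>\<^sub>E carrier E.T" for g
      by (simp add: free_module_def)
    have ops: "g \<oplus>\<^bsub>?F\<^esub> g' = (\<lambda>i\<in>{\<zero>\<^bsub>Q\<^esub>}. g i \<oplus>\<^bsub>E.T\<^esub> g' i)" "r \<odot>\<^bsub>?F\<^esub> g = (\<lambda>i\<in>{\<zero>\<^bsub>Q\<^esub>}. r \<otimes>\<^bsub>E.T\<^esub> g i)" for g g' r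
      by (simp_all add: free_module_def)
    define i where "i z = (\<lambda>_\<in>{\<zero>\<^bsub>Q\<^esub>}. E.t z \<one>\<^bsub>Q\<^esub> \<otimes>\<^bsub>E.T\<^esub> \<epsilon>)" for z
    have i_hom: "i \<in> module_hom E.T ?M ?F"
      unfolding module_hom_def
    proof (intro CollectI conjI ballI Pi_I)
      fix z assume "z \<in> carrier ?M" then show "i z \<in> carrier ?F" using \<epsilon> by (auto simp: carr i_def)
    next
      fix z z' assume "z \<in> carrier ?M" "z' \<in> carrier ?M"
      then show "i (z \<oplus>\<^bsub>?M\<^esub> z') = i z \<oplus>\<^bsub>?F\<^esub> i z'"
        using \<epsilon> by (auto simp: i_def ops fun_eq_iff restrict_def E.pure_tensor_add_left E.T.l_distr)
    next
      fix e z assume ez: "e \<in> carrier E.T" "z \<in> carrier ?M"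
      have "E.t (m e \<otimes>\<^bsub>Q\<^esub> z) \<one>\<^bsub>Q\<^esub> \<otimes>\<^bsub>E.T\<^esub> \<epsilon> = E.t z \<one>\<^bsub>Q\<^esub> \<otimes>\<^bsub>E.T\<^esub> (E.t (m e) \<one>\<^bsub>Q\<^esub> \<otimes>\<^bsub>E.T\<^esub> \<epsilon>)"
        using ez \<epsilon> E.pure_tensor_mult[of "m e" z "\<one>\<^bsub>Q\<^esub>" "\<one>\<^bsub>Q\<^esub>"]
        by (simp add: E.T.m_assoc E.T.m_lcomm)
      also have "\<dots> = e \<otimes>\<^bsub>E.T\<^esub> (E.t z \<one>\<^bsub>Q\<^esub> \<otimes>\<^bsub>E.T\<^esub> \<epsilon>)"
        using ez \<epsilon> by (simp add: absorb E.T.m_lcomm)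
      finally show "i (e \<odot>\<^bsub>?M\<^esub> z) = e \<odot>\<^bsub>?F\<^esub> i z"
        by (auto simp: i_def ops fun_eq_iff restrict_def)
    qed
    have p_hom: "(\<lambda>g. m (g \<zero>\<^bsub>Q\<^esub>)) \<in> module_hom E.T ?F ?M"
    proof -
      have "g \<zero>\<^bsub>Q\<^esub> \<in> carrier E.T" if "g \<in> carrier ?F" for g using that by (auto simp: carr)
      then show ?thesis
        unfolding module_hom_def by (intro CollectI conjI ballI Pi_I) (simp_all add: ops)
    qed
    have mi: "m (i z \<zero>\<^bsub>Q\<^esub>) = z" if "z \<in> carrier ?M" for z
      using that \<epsilon> m\<epsilon> by (simp add: i_def m(2))
    have "projective_module E.T ?M"
      unfolding projective_module_def
      by (intro conjI m.module_alg_module exI[of _ "{\<zero>\<^bsub>Q\<^esub>}"] bexI[OF _ i_hom] bexI[OF _ p_hom] ballI) (rule mi)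
    moreover have "comm_algebra R Q h"
      unfolding comm_algebra_def using h R.is_cring Q.is_cring by blast
    ultimately show "separable_poly R f"
      unfolding separable_poly_def separable_algebra_def using m
      by (intro conjI bexI[OF _ m(1)] ballI) simp_all
  next
    assume "separable_poly R f"
    then obtain m where m: "m \<in> ring_hom E.T Q"
      "\<And>a b. a \<in> carrier Q \<Longrightarrow> b \<in> carrier Q \<Longrightarrow> m (E.t a b) = a \<otimes>\<^bsub>Q\<^esub> b"
      and "projective_module E.T (alg_module Q m)"
      unfolding separable_poly_def separable_algebra_def by blast
    then obtain I :: "(nat \<Rightarrow> 'r) set set" and i p where i: "i \<in> module_hom E.T (alg_module Q m) (free_module E.T I)"
      and p: "p \<in> module_hom E.T (free_module E.T I) (alg_module Q m)"
      and pi: "\<forall>z\<in>carrier Q. p (i z) = z"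
      unfolding projective_module_def alg_module_simps by blast
    interpret m: ring_hom_cring E.T Q m
      by unfold_locales (rule m(1))
    have key: "\<exists>z\<in>carrier Q. m e = d \<otimes>\<^bsub>Q\<^esub> z"
      if e: "e \<in> carrier E.T" "(u \<ominus>\<^bsub>E.T\<^esub> w) \<otimes>\<^bsub>E.T\<^esub> e = \<zero>\<^bsub>E.T\<^esub>" for e
    proof -
      \<comment> \<open>\<open>Q[Z]/(fV)\<close> is a concrete model of
        \<open>Q \<otimes> Q\<close>: the map \<open>\<Lambda>\<close> below sends \<open>u\<close>
        to the class of the variable and \<open>w\<close> to that of the constant
        \<open>\<theta>\<close>. It turns a relation in the tensor product into divisibility by
        \<open>fV\<close> in \<open>Q[Z]\<close>.\<close>
      interpret Q2: poly_quotient Q fV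
        using fV by unfold_locales (simp add: V_def)
      have class_horner2: "poly_class Q fV (horner V y (map (pconst Q) as)) = horner Q2.Q Q2.\<theta> (map Q2.h as)"
        if "set as \<subseteq> carrier Q" for as
        using Q2.class_horner[OF that] unfolding y_def V_def .
      have k_hom: "(\<lambda>r. Q2.h (h r)) \<in> ring_hom R Q2.Q"
        using ring_hom_trans[OF h Q2.quot_map_hom] by (simp add: comp_def)
      have "UnivPoly.eval R Q2.Q (\<lambda>r. Q2.h (h r)) Q2.\<theta> f = horner Q2.Q Q2.\<theta> (map Q2.h (map h fs))"
        using eval_horner[OF R.is_cring Q2.Q.is_cring k_hom Q2.theta_closed fs] by (simp add: comp_def)
      also have "\<dots> = poly_class Q fV fV"
        using class_horner2[OF hfs] unfolding fV_horner by simp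
      also have "\<dots> = \<zero>\<^bsub>Q2.Q\<^esub>"
        using Q2.class_zero_iff[of fV] fV V.P.l_one V.P.one_closed unfolding V_def by metis
      finally obtain A where A: "A \<in> ring_hom Q Q2.Q" "\<And>r. r \<in> carrier R \<Longrightarrow> A (h r) = Q2.h (h r)" "A \<theta> = Q2.\<theta>"
        using quotient_universal[OF Q2.Q.is_cring k_hom Q2.theta_closed] by blast
      obtain \<Lambda> where \<Lambda>: "\<Lambda> \<in> ring_hom E.T Q2.Q"
        "\<And>a b. a \<in> carrier Q \<Longrightarrow> b \<in> carrier Q \<Longrightarrow> \<Lambda> (E.t a b) = Q2.h a \<otimes>\<^bsub>Q2.Q\<^esub> A b"
        using E.tensor_universal[OF Q2.Q.is_cring Q2.quot_map_hom A(1)] A(2) by metis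
      note A1 = ring_hom_one[OF A(1)] and h1 = ring_hom_one[OF Q2.quot_map_hom]
        and hc = ring_hom_closed[OF Q2.quot_map_hom]
      have \<Lambda>_u: "\<Lambda> u = Q2.\<theta>" unfolding u_def \<Lambda>(2)[OF Q.one_closed \<theta>] A(3) h1
        by (rule Q2.Q.l_one[OF Q2.theta_closed])
      have \<Lambda>_left: "\<Lambda> (E.t z \<one>\<^bsub>Q\<^esub>) = Q2.h z" if "z \<in> carrier Q" for z
        unfolding \<Lambda>(2)[OF that Q.one_closed] A1 by (rule Q2.Q.r_one[OF hc[OF that]])
      obtain as where as: "set as \<subseteq> carrier Q" "e = horner E.T u (map (\<lambda>s. E.t s \<one>\<^bsub>Q\<^esub>) as)"
        using E.spans[OF e(1)] unfolding u_def by blast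
      have as': "set (map (\<lambda>s. E.t s \<one>\<^bsub>Q\<^esub>) as) \<subseteq> carrier E.T" using as(1) by auto
      define N where "N = pconst Q d \<oplus>\<^bsub>V\<^esub> (y \<ominus>\<^bsub>V\<^esub> x) \<otimes>\<^bsub>V\<^esub> q"
      have N: "N \<in> carrier V" unfolding N_def using x y q pconst[OF d] by simp
      define D where "D = y \<ominus>\<^bsub>V\<^esub> x"
      have D: "D \<in> carrier V" unfolding D_def using x y by simp
      define B where "B = horner V y (map (pconst Q) as)"
      have B: "B \<in> carrier V" unfolding B_def using as(1) pconst by (intro V.P.horner_closed y) auto
      have "map \<Lambda> (map (\<lambda>s. E.t s \<one>\<^bsub>Q\<^esub>) as) = map Q2.h as" using as(1) \<Lambda>_left by auto
      then have \<Lambda>_e: "\<Lambda> e = poly_class Q fV B"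
        unfolding as(2) ring_hom_horner[OF E.T.is_cring Q2.Q.is_cring \<Lambda>(1) uw(1) as'] \<Lambda>_u B_def
          class_horner2[OF as(1)] by (simp only:)
      interpret \<Lambda>: ring_hom_cring E.T Q2.Q \<Lambda>
        by unfold_locales (rule \<Lambda>(1))
      have class2: "poly_class Q fV \<in> ring_hom V Q2.Q" using Q2.class_hom unfolding V_def .
      interpret C: ring_hom_cring V Q2.Q "poly_class Q fV"
        by unfold_locales (rule class2)
      have C_y: "poly_class Q fV y = \<Lambda> u" unfolding \<Lambda>_u y_def ..
      have C_x: "poly_class Q fV x = \<Lambda> w"
        unfolding w_def \<Lambda>_left[OF \<theta>] x_def quot_map_def[of Q fV] ..
      have "poly_class Q fV (D \<otimes>\<^bsub>V\<^esub> B) = \<Lambda> ((u \<ominus>\<^bsub>E.T\<^esub> w) \<otimes>\<^bsub>E.T\<^esub> e)"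
        using x y B uw e(1) unfolding D_def a_minus_def by (simp add: C_y C_x \<Lambda>_e)
      also have "\<dots> = \<zero>\<^bsub>Q2.Q\<^esub>" unfolding e(2) by (rule \<Lambda>.hom_zero)
      finally obtain K where K: "K \<in> carrier V" "D \<otimes>\<^bsub>V\<^esub> B = K \<otimes>\<^bsub>V\<^esub> fV"
        using Q2.class_zero_iff[of "D \<otimes>\<^bsub>V\<^esub> B"] D B unfolding V_def[symmetric] by auto
      have fVD: "fV = D \<otimes>\<^bsub>V\<^esub> N" unfolding fV_def factor D_def N_def ..
      \<comment> \<open>In \<open>D B = K fV = K D N\<close> the factor
        \<open>D = Z - \<theta>\<close> is monic of degree 1, so \<open>monic_mult_bound\<close>
        cancels it and leaves \<open>B = K N\<close>.\<close>
      have "(B \<ominus>\<^bsub>V\<^esub> K \<otimes>\<^bsub>V\<^esub> N) \<otimes>\<^bsub>V\<^esub> D = D \<otimes>\<^bsub>V\<^esub> B \<ominus>\<^bsub>V\<^esub> K \<otimes>\<^bsub>V\<^esub> (D \<otimes>\<^bsub>V\<^esub> N)"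
        using B K(1) N D by algebra
      also have "\<dots> = \<zero>\<^bsub>V\<^esub>" unfolding fVD[symmetric] K(2) using K(1) fV by (simp add: a_minus_def V.P.r_neg)
      finally have BKN: "(B \<ominus>\<^bsub>V\<^esub> K \<otimes>\<^bsub>V\<^esub> N) \<otimes>\<^bsub>V\<^esub> D = \<zero>\<^bsub>V\<^esub>" .
      have coeff_D: "up_ring.coeff V D k = up_ring.coeff V y k \<ominus>\<^bsub>Q\<^esub> up_ring.coeff V x k" for k
        unfolding D_def by (rule V.coeff_minus[OF y x])
      have coeff_y: "up_ring.coeff V y k = (if 1 = k then \<one>\<^bsub>Q\<^esub> else \<zero>\<^bsub>Q\<^esub>)" for k
        unfolding y_def pvar_def V_def[symmetric] by (rule V.coeff_monom[OF Q.one_closed])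
      have coeff_x: "up_ring.coeff V x k = (if 0 = k then \<theta> else \<zero>\<^bsub>Q\<^esub>)" for k
        unfolding x_def pconst_def V_def[symmetric] by (rule V.coeff_monom[OF \<theta>])
      have "B \<ominus>\<^bsub>V\<^esub> K \<otimes>\<^bsub>V\<^esub> N = \<zero>\<^bsub>V\<^esub>"
      proof (rule V.monic_mult_bound[OF D, of 1])
        show "B \<ominus>\<^bsub>V\<^esub> K \<otimes>\<^bsub>V\<^esub> N \<in> carrier V" using B K(1) N by simp
        show "up_ring.coeff V ((B \<ominus>\<^bsub>V\<^esub> K \<otimes>\<^bsub>V\<^esub> N) \<otimes>\<^bsub>V\<^esub> D) k = \<zero>\<^bsub>Q\<^esub>" for k
          unfolding BKN by simp
      qed (simp_all only: coeff_D coeff_y coeff_x, simp_all add: a_minus_def)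
      moreover have "B = (B \<ominus>\<^bsub>V\<^esub> K \<otimes>\<^bsub>V\<^esub> N) \<oplus>\<^bsub>V\<^esub> K \<otimes>\<^bsub>V\<^esub> N" using B K(1) N by algebra
      ultimately have B_eq: "B = K \<otimes>\<^bsub>V\<^esub> N" using K(1) N by simp
      have id_hom: "(\<lambda>z. z) \<in> ring_hom Q Q" by (rule ring_hom_memI) auto
      note I1 = UP_pre_univ_propI[OF Q.is_cring Q.is_cring id_hom]
      \<comment> \<open>Evaluation at \<open>\<theta>\<close> kills \<open>D\<close>, so it sends
        \<open>N\<close> to \<open>d\<close>, while its value at \<open>B\<close> is
        \<open>m e\<close>.\<close>
      define ev where "ev = UnivPoly.eval Q Q (\<lambda>z. z) \<theta>"
      interpret ev: ring_hom_cring V Q ev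
        by unfold_locales (simp only: ev_def V_def UP_pre_univ_prop.eval_ring_hom[OF I1 \<theta>])
      have ev_B: "ev B = horner Q \<theta> as"
        using eval_horner[OF Q.is_cring Q.is_cring id_hom \<theta> as(1), of B] unfolding ev_def B_def y_def V_def by simp
      have ev_y: "ev y = \<theta>" using UP_pre_univ_prop.eval_monom1[OF I1 \<theta>] unfolding ev_def y_def pvar_def V_def .
      have ev_const: "ev (pconst Q z) = z" if "z \<in> carrier Q" for z
        using UP_pre_univ_prop.eval_const[OF I1 \<theta> that] unfolding ev_def pconst_def V_def .
      have ev_x: "ev x = \<theta>" unfolding x_def by (rule ev_const[OF \<theta>])
      have "ev N = d \<oplus>\<^bsub>Q\<^esub> (\<theta> \<ominus>\<^bsub>Q\<^esub> \<theta>) \<otimes>\<^bsub>Q\<^esub> ev q"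
        unfolding N_def a_minus_def using x y q pconst[OF d]
        by (simp only: ev.hom_add ev.hom_mult ev.hom_a_inv V.P.a_closed V.P.m_closed V.P.a_inv_closed ev_y ev_x ev_const[OF d])
      then have ev_N: "ev N = d" using Q.r_neg[OF \<theta>] Q.l_null[OF ev.hom_closed[OF q]] Q.r_zero[OF d] by (simp only: a_minus_def)
      have mt: "map m (map (\<lambda>s. E.t s \<one>\<^bsub>Q\<^esub>) as) = as"
        unfolding map_map
      proof (rule map_idI)
        fix s assume "s \<in> set as"
        then have "s \<in> carrier Q" using as(1) by blast
        then show "(m \<circ> (\<lambda>s. E.t s \<one>\<^bsub>Q\<^esub>)) s = s" by (simp add: m(2))
      qed
      have mu: "m u = \<theta>" unfolding u_def m(2)[OF Q.one_closed \<theta>] by (rule Q.l_one[OF \<theta>])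
      have "m e = horner Q \<theta> as"
        unfolding as(2) ring_hom_horner[OF E.T.is_cring Q.is_cring m(1) uw(1) as'] mt mu ..
      also have "\<dots> = ev K \<otimes>\<^bsub>Q\<^esub> d"
        unfolding ev_B[symmetric] B_eq using K(1) N by (simp add: ev_N)
      also have "\<dots> = d \<otimes>\<^bsub>Q\<^esub> ev K" using d K(1) by (simp add: Q.m_comm)
      finally show ?thesis using K(1) by blast
    qed
    let ?F = "free_module E.T I"
    have carr: "g \<in> carrier ?F \<longleftrightarrow> g \<in> I \<rightarrow>\<^sub>E carrier E.T \<and> finite {j \<in> I. g j \<noteq> \<zero>\<^bsub>E.T\<^esub>}" for g
      by (simp add: free_module_def)
    have ops: "g \<oplus>\<^bsub>?F\<^esub> g' = (\<lambda>j\<in>I. g j \<oplus>\<^bsub>E.T\<^esub> g' j)" "r \<odot>\<^bsub>?F\<^esub> g = (\<lambda>j\<in>I. r \<otimes>\<^bsub>E.T\<^esub> g j)" for g g' r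
      by (simp_all add: free_module_def)
    have i_closed: "i z \<in> carrier ?F" if "z \<in> carrier Q" for z
      using i that by (auto simp: module_hom_def)
    have i_smult: "i (m r \<otimes>\<^bsub>Q\<^esub> z) = r \<odot>\<^bsub>?F\<^esub> i z" if "r \<in> carrier E.T" "z \<in> carrier Q" for r z
      using i that by (simp add: module_hom_def)
    have p_closed: "p g \<in> carrier Q" if "g \<in> carrier ?F" for g
      using p that by (auto simp: module_hom_def)
    have p_add: "p (g \<oplus>\<^bsub>?F\<^esub> g') = p g \<oplus>\<^bsub>Q\<^esub> p g'" if "g \<in> carrier ?F" "g' \<in> carrier ?F" for g g'
      using p that by (simp add: module_hom_def)
    have p_smult: "p (r \<odot>\<^bsub>?F\<^esub> g) = m r \<otimes>\<^bsub>Q\<^esub> p g" if "r \<in> carrier E.T" "g \<in> carrier ?F" for r g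
      using p that by (simp add: module_hom_def)
    \<comment> \<open>The image of 1 in the free module. Since \<open>m (u - w) = 0\<close>,
      linearity of \<open>i\<close> shows that \<open>u - w\<close> kills each coordinate of
      \<open>g1\<close>, so \<open>key\<close> applies to all of them.\<close>
    define g1 where "g1 = i \<one>\<^bsub>Q\<^esub>"
    have g1: "g1 \<in> carrier ?F" "p g1 = \<one>\<^bsub>Q\<^esub>" unfolding g1_def using i_closed pi by simp_all
    have "m (u \<ominus>\<^bsub>E.T\<^esub> w) = \<one>\<^bsub>Q\<^esub> \<otimes>\<^bsub>Q\<^esub> \<theta> \<ominus>\<^bsub>Q\<^esub> \<theta> \<otimes>\<^bsub>Q\<^esub> \<one>\<^bsub>Q\<^esub>"
      using uw m(2)[OF Q.one_closed \<theta>] m(2)[OF \<theta> Q.one_closed] by (simp only: a_minus_def m.hom_add m.hom_a_inv E.T.a_inv_closed u_def w_def)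
    also have "\<dots> = \<zero>\<^bsub>Q\<^esub>" using Q.r_neg[OF \<theta>] \<theta> by (simp only: a_minus_def Q.l_one Q.r_one)
    finally have muw: "m (u \<ominus>\<^bsub>E.T\<^esub> w) = m \<zero>\<^bsub>E.T\<^esub>" by simp
    have "(u \<ominus>\<^bsub>E.T\<^esub> w) \<odot>\<^bsub>?F\<^esub> g1 = \<zero>\<^bsub>E.T\<^esub> \<odot>\<^bsub>?F\<^esub> g1"
      unfolding g1_def using i_smult[of "u \<ominus>\<^bsub>E.T\<^esub> w" "\<one>\<^bsub>Q\<^esub>"] i_smult[of "\<zero>\<^bsub>E.T\<^esub>" "\<one>\<^bsub>Q\<^esub>"] uw muw by simp
    then have eq: "(\<lambda>j\<in>I. (u \<ominus>\<^bsub>E.T\<^esub> w) \<otimes>\<^bsub>E.T\<^esub> g1 j) = (\<lambda>j\<in>I. \<zero>\<^bsub>E.T\<^esub> \<otimes>\<^bsub>E.T\<^esub> g1 j)" unfolding ops .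
    have g1_closed: "g1 j \<in> carrier E.T" if "j \<in> I" for j using that g1(1) unfolding carr by blast
    have ann: "(u \<ominus>\<^bsub>E.T\<^esub> w) \<otimes>\<^bsub>E.T\<^esub> g1 j = \<zero>\<^bsub>E.T\<^esub>" if "j \<in> I" for j
      using fun_cong[OF eq, of j] that g1_closed[OF that] by simp
    \<comment> \<open>By linearity \<open>p g\<close> is a combination of the elements
      \<open>m (g j)\<close>, hence a multiple of \<open>d\<close>. The coordinates are split off
      one by one along a finite set \<open>A\<close> containing the support.\<close>
    have "\<exists>z\<in>carrier Q. p g = d \<otimes>\<^bsub>Q\<^esub> z"
      if "finite A" "g \<in> carrier ?F" "\<forall>j\<in>I. \<exists>z\<in>carrier Q. m (g j) = d \<otimes>\<^bsub>Q\<^esub> z" "{j \<in> I. g j \<noteq> \<zero>\<^bsub>E.T\<^esub>} \<subseteq> A" for A g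
      using that
    proof (induction A arbitrary: g rule: finite_induct)
      case empty
      then have "g j = \<zero>\<^bsub>E.T\<^esub> \<otimes>\<^bsub>E.T\<^esub> g j" if "j \<in> I" for j using that by auto
      then have "g = \<zero>\<^bsub>E.T\<^esub> \<odot>\<^bsub>?F\<^esub> g"
        using empty(1) unfolding ops carr by (intro extensionalityI[of _ I]) (auto simp: PiE_def)
      then have "p g = \<zero>\<^bsub>Q\<^esub>"
        using p_smult[OF E.T.zero_closed empty(1)] p_closed[OF empty(1)] by simp
      then show ?case using d by (intro bexI[of _ "\<zero>\<^bsub>Q\<^esub>"]) simp_all
    next
      case (insert j A)
      show ?case
      proof (cases "j \<in> I")
        case False
        then show ?thesis using insert by blast
      next
        case True
        define g' where "g' = g(j := \<zero>\<^bsub>E.T\<^esub>)"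
        define \<delta> where "\<delta> = (\<lambda>l\<in>I. if l = j then \<one>\<^bsub>E.T\<^esub> else \<zero>\<^bsub>E.T\<^esub>)"
        have gj: "g j \<in> carrier E.T" using insert.prems(1) True by (auto simp: carr)
        have sub: "{l \<in> I. g' l \<noteq> \<zero>\<^bsub>E.T\<^esub>} \<subseteq> {l \<in> I. g l \<noteq> \<zero>\<^bsub>E.T\<^esub>}" by (auto simp: g'_def)
        have g: "g \<in> I \<rightarrow>\<^sub>E carrier E.T" "finite {l \<in> I. g l \<noteq> \<zero>\<^bsub>E.T\<^esub>}"
          using insert.prems(1) unfolding carr by blast+
        have "g' \<in> I \<rightarrow>\<^sub>E carrier E.T"
          using PiE_fun_upd[OF E.T.zero_closed g(1), of j] True by (simp only: g'_def insert_absorb)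
        then have g': "g' \<in> carrier ?F" unfolding carr using finite_subset[OF sub g(2)] by blast
        have "finite {l \<in> I. \<delta> l \<noteq> \<zero>\<^bsub>E.T\<^esub>}"
          by (rule finite_subset[of _ "{j}"]) (auto simp: \<delta>_def)
        moreover have "\<delta> \<in> I \<rightarrow>\<^sub>E carrier E.T" unfolding \<delta>_def by simp
        ultimately have \<delta>: "\<delta> \<in> carrier ?F" unfolding carr by blast
        have "finite {l \<in> I. (g j \<odot>\<^bsub>?F\<^esub> \<delta>) l \<noteq> \<zero>\<^bsub>E.T\<^esub>}"
          by (rule finite_subset[of _ "{j}"]) (use gj in \<open>auto simp: ops \<delta>_def\<close>)
        moreover have "g j \<odot>\<^bsub>?F\<^esub> \<delta> \<in> I \<rightarrow>\<^sub>E carrier E.T" unfolding ops \<delta>_def using gj by simp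
        ultimately have g\<delta>: "g j \<odot>\<^bsub>?F\<^esub> \<delta> \<in> carrier ?F" unfolding carr by blast
        have "g = g' \<oplus>\<^bsub>?F\<^esub> (g j \<odot>\<^bsub>?F\<^esub> \<delta>)"
        proof
          fix l
          have "g l \<in> carrier E.T" if "l \<in> I" using g(1) that by blast
          then show "g l = (g' \<oplus>\<^bsub>?F\<^esub> (g j \<odot>\<^bsub>?F\<^esub> \<delta>)) l"
            using gj True PiE_arb[OF g(1), of l] unfolding ops by (cases "l \<in> I") (simp_all add: g'_def \<delta>_def)
        qed
        then have pg: "p g = p g' \<oplus>\<^bsub>Q\<^esub> m (g j) \<otimes>\<^bsub>Q\<^esub> p \<delta>"
          using p_add[OF g' g\<delta>] p_smult[OF gj \<delta>] by simp
        have "\<exists>z\<in>carrier Q. p g' = d \<otimes>\<^bsub>Q\<^esub> z"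
        proof (rule insert.IH[OF g'])
          show "\<forall>l\<in>I. \<exists>z\<in>carrier Q. m (g' l) = d \<otimes>\<^bsub>Q\<^esub> z"
          proof
            fix l assume "l \<in> I"
            then show "\<exists>z\<in>carrier Q. m (g' l) = d \<otimes>\<^bsub>Q\<^esub> z"
              using insert.prems(2) d by (cases "l = j") (auto simp: g'_def intro!: bexI[of _ "\<zero>\<^bsub>Q\<^esub>"])
          qed
          show "{l \<in> I. g' l \<noteq> \<zero>\<^bsub>E.T\<^esub>} \<subseteq> A" using insert.prems(3) by (auto simp: g'_def)
        qed
        then obtain z z' where z: "z \<in> carrier Q" "p g' = d \<otimes>\<^bsub>Q\<^esub> z" "z' \<in> carrier Q" "m (g j) = d \<otimes>\<^bsub>Q\<^esub> z'"
          using insert.prems(2) True by blast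
        have "p g = d \<otimes>\<^bsub>Q\<^esub> (z \<oplus>\<^bsub>Q\<^esub> z' \<otimes>\<^bsub>Q\<^esub> p \<delta>)"
          unfolding pg z(2,4) using z(1,3) d p_closed[OF \<delta>] by algebra
        then show ?thesis using z(1,3) p_closed[OF \<delta>] by blast
      qed
    qed
    from this[of "{j \<in> I. g1 j \<noteq> \<zero>\<^bsub>E.T\<^esub>}" g1] obtain z where "z \<in> carrier Q" "\<one>\<^bsub>Q\<^esub> = d \<otimes>\<^bsub>Q\<^esub> z"
      using g1 key ann g1_closed by (auto simp: carr)
    then show "d \<in> Units Q" using d by (intro Q.comm_UnitsI[of d z]) simp_all
  qed
qed

section \<open>The ring of integers generated by a root of unity\<close>

abbreviation Zset :: "complex \<Rightarrow> complex set" where "Zset \<rho> \<equiv> carrier (Zring \<rho>)"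

lemma Zring_simps [simp]:
  "x \<otimes>\<^bsub>Zring \<rho>\<^esub> y = x * y" "x \<oplus>\<^bsub>Zring \<rho>\<^esub> y = x + y" "\<one>\<^bsub>Zring \<rho>\<^esub> = 1" "\<zero>\<^bsub>Zring \<rho>\<^esub> = 0"
  by (simp_all add: Zring_def ring_of_type_algebra_def)

lemma cring_Zring: "cring (Zring \<rho>)"
proof -
  interpret C: ring "ring_of_type_algebra :: complex ring" by (rule ring_from_type_algebra)
  have "ring (Zring \<rho>)"
    unfolding Zring_def by (rule C.generate_ring_is_ring) (simp add: ring_of_type_algebra_def)
  then interpret Z: ring "Zring \<rho>" .
  show ?thesis
    by unfold_locales (simp add: mult.commute)
qed

lemma Zset_one [simp]: "1 \<in> Zset \<rho>" and Zset_zero [simp]: "0 \<in> Zset \<rho>"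
  and Zset_add [simp]: "a \<in> Zset \<rho> \<Longrightarrow> b \<in> Zset \<rho> \<Longrightarrow> a + b \<in> Zset \<rho>"
  and Zset_mult [simp]: "a \<in> Zset \<rho> \<Longrightarrow> b \<in> Zset \<rho> \<Longrightarrow> a * b \<in> Zset \<rho>"
proof -
  interpret Z: cring "Zring \<rho>" by (rule cring_Zring)
  show "1 \<in> Zset \<rho>" "0 \<in> Zset \<rho>" using Z.one_closed Z.zero_closed by simp_all
  show "a \<in> Zset \<rho> \<Longrightarrow> b \<in> Zset \<rho> \<Longrightarrow> a + b \<in> Zset \<rho>" using Z.a_closed by simp
  show "a \<in> Zset \<rho> \<Longrightarrow> b \<in> Zset \<rho> \<Longrightarrow> a * b \<in> Zset \<rho>" using Z.m_closed by simp
qed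

lemma Zring_a_inv [simp]: "a \<in> Zset \<rho> \<Longrightarrow> \<ominus>\<^bsub>Zring \<rho>\<^esub> a = - a"
proof -
  interpret Z: cring "Zring \<rho>" by (rule cring_Zring)
  assume "a \<in> Zset \<rho>"
  then have "\<ominus>\<^bsub>Zring \<rho>\<^esub> a + a = 0" using Z.l_neg by simp
  then show ?thesis by (simp add: eq_neg_iff_add_eq_0)
qed

lemma Zset_uminus [simp]: "a \<in> Zset \<rho> \<Longrightarrow> - a \<in> Zset \<rho>"
  using abelian_group.a_inv_closed[OF ring.is_abelian_group[OF cring.axioms(1)[OF cring_Zring]]] Zring_a_inv
  by metis

lemma Zset_diff [simp]: "a \<in> Zset \<rho> \<Longrightarrow> b \<in> Zset \<rho> \<Longrightarrow> a - b \<in> Zset \<rho>"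
  using Zset_add[of a \<rho> "- b"] by simp

lemma Zset_root [simp]: "\<rho> \<in> Zset \<rho>"
  by (simp add: Zring_def generate_ring.incl)

lemma Zset_power [simp]: "a \<in> Zset \<rho> \<Longrightarrow> a ^ n \<in> Zset \<rho>"
  by (induction n) auto

lemma Zset_of_nat [simp]: "of_nat n \<in> Zset \<rho>"
  by (induction n) auto

lemma Zset_sum: "(\<And>i. i \<in> A \<Longrightarrow> f i \<in> Zset \<rho>) \<Longrightarrow> sum f A \<in> Zset \<rho>"
  by (induction A rule: infinite_finite_induct) auto

lemma Zset_prod: "(\<And>i. i \<in> A \<Longrightarrow> f i \<in> Zset \<rho>) \<Longrightarrow> prod f A \<in> Zset \<rho>"
  by (induction A rule: infinite_finite_induct) auto

section \<open>Cyclotomic units and the polynomial \<open>F\<close> over the complex numbers\<close>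

locale cyclotomic =
  fixes p :: nat and \<rho> :: complex
  assumes prime_p: "Factorial_Ring.prime p" and root: "primitive_root_of_one p \<rho>"
begin

abbreviation \<eta> where "\<eta> \<equiv> \<rho> - 1"

lemma p_ge_2: "2 \<le> p"
  using prime_ge_2_nat[OF prime_p] .

lemma root_power_p: "\<rho> ^ p = 1" and root_nontrivial: "0 < k \<Longrightarrow> k < p \<Longrightarrow> \<rho> ^ k \<noteq> 1"
  using root by (auto simp: primitive_root_of_one_def)

lemma eta_nonzero: "\<eta> \<noteq> 0"
  using root_nontrivial[of 1] p_ge_2 by auto

lemma eta_in: "\<eta> \<in> Zset \<rho>"
  by simp

text \<open>The sum \<open>1 + \<rho> + ... + \<rho>^(i-1)\<close>, which is the constant term of
  the \<open>i\<close>-th iterate of \<open>Z \<mapsto> \<rho>Z + 1\<close>.\<close>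

definition cyc_unit where "cyc_unit i = (\<rho> ^ i - 1) / \<eta>"

lemma cyc_unit_in: "cyc_unit i \<in> Zset \<rho>"
proof -
  have "cyc_unit i = (\<Sum>j<i. \<rho> ^ j)"
    using eta_nonzero by (simp add: cyc_unit_def sum_gp_strict field_simps)
  then show ?thesis by (auto intro: Zset_sum)
qed

text \<open>If \<open>i j\<close> is 1 modulo \<open>p\<close>, then
  \<open>\<rho> = (\<rho>^i)^j\<close>, so \<open>(\<rho> - 1)/(\<rho>^i - 1)\<close> is a geometric
  sum in \<open>\<rho>^i\<close>.\<close>

lemma cyc_unit_inverse:
  assumes "0 < i" "i < p"
  shows "cyc_unit i \<noteq> 0" "inverse (cyc_unit i) \<in> Zset \<rho>"
proof -
  show "cyc_unit i \<noteq> 0" using root_nontrivial[OF assms] eta_nonzero by (simp add: cyc_unit_def)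
  have "coprime i p"
    using prime_p assms by (metis coprime_commute dvd_imp_le not_le prime_imp_coprime)
  then obtain j q where q: "i * j = p * q + 1"
    using bezout_nat[of i p] assms by auto
  have "(\<rho> ^ i) ^ j = \<rho>" unfolding power_mult[symmetric] q by (simp add: power_add power_mult root_power_p)
  then have "inverse (cyc_unit i) = (\<Sum>l<j. (\<rho> ^ i) ^ l)"
    using eta_nonzero root_nontrivial[OF assms] by (simp add: cyc_unit_def sum_gp_strict field_simps)
  then show "inverse (cyc_unit i) \<in> Zset \<rho>" by (auto intro: Zset_sum)
qed

text \<open>For \<open>j < i\<close> the difference is \<open>\<rho>^j\<close> times
  \<open>cyc_unit (i - j)\<close>. The inverse is exhibited inside \<open>\<int>[\<rho>]\<close>, so
  that every ring homomorphism transports it.\<close>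

lemma cyc_unit_diff:
  assumes "i < p" "j < p" "i \<noteq> j"
  shows "\<exists>w\<in>Zset \<rho>. (cyc_unit i - cyc_unit j) * w = 1"
proof -
  have *: "\<exists>w\<in>Zset \<rho>. (cyc_unit i - cyc_unit j) * w = 1" if "j < i" "i < p" for i j
  proof -
    have "\<rho> ^ i = \<rho> ^ j * \<rho> ^ (i - j)" using that by (simp flip: power_add)
    then have "cyc_unit i - cyc_unit j = \<rho> ^ j * cyc_unit (i - j)"
      by (simp add: cyc_unit_def diff_divide_distrib[symmetric] algebra_simps)
    then have "(cyc_unit i - cyc_unit j) * (\<rho> ^ (p - j) * inverse (cyc_unit (i - j)))
        = (\<rho> ^ j * \<rho> ^ (p - j)) * (cyc_unit (i - j) * inverse (cyc_unit (i - j)))"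
      by (simp only: ac_simps)
    moreover have "\<rho> ^ j * \<rho> ^ (p - j) = 1" using that root_power_p by (simp flip: power_add)
    moreover have inv: "cyc_unit (i - j) * inverse (cyc_unit (i - j)) = 1" "inverse (cyc_unit (i - j)) \<in> Zset \<rho>"
      using cyc_unit_inverse[of "i - j"] that by simp_all
    ultimately have "(cyc_unit i - cyc_unit j) * (\<rho> ^ (p - j) * inverse (cyc_unit (i - j))) = 1"
      by (simp only: mult_1_right)
    then show ?thesis
      by (rule bexI) (use inv in simp)
  qed
  show ?thesis
  proof (cases "j < i")
    case True then show ?thesis using * assms by blast
  next
    case False
    then obtain w where "w \<in> Zset \<rho>" "(cyc_unit j - cyc_unit i) * w = 1" using *[of i j] assms by auto
    then show ?thesis by (intro bexI[of _ "- w"]) (auto simp: algebra_simps)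
  qed
qed

text \<open>Evaluate the factorization \<open>1 + Z + ... + Z^(p-1) = \<Prod>(Z - \<rho>^i)\<close>
  at 1.\<close>

lemma prod_one_minus_root: "(\<Prod>i\<in>{1..<p}. 1 - \<rho> ^ i) = of_nat p"
proof -
  note One_nat_def [simp del]
  let ?P = "\<Prod>i\<in>{1..<p}. [:- (\<rho> ^ i), 1:]" and ?S = "\<Sum>k<p. Polynomial.monom 1 k :: complex Polynomial.poly"
  have inj: "inj_on ((^) \<rho>) {1..<p}"
  proof (rule inj_onI)
    fix i j assume ij: "i \<in> {1..<p}" "j \<in> {1..<p}" "\<rho> ^ i = \<rho> ^ j"
    then have "cyc_unit i - cyc_unit j = 0" by (simp add: cyc_unit_def)
    then show "i = j" using cyc_unit_diff[of i j] ij by force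
  qed
  have deg: "Polynomial.degree ?P = p - 1"
    by (subst degree_prod_sum_eq) auto
  have "?P = ?S"
  \<comment> \<open>Both polynomials have degree at most \<open>p - 1\<close> and coefficient 1
    there, so agreement at the \<open>p - 1\<close> points \<open>\<rho>^i\<close> suffices.\<close>
  proof (rule poly_eqI_degree_lead_coeff[where n = "p - 1" and A = "(^) \<rho> ` {1..<p}"])
    have "Polynomial.lead_coeff ?P = 1" by (simp add: lead_coeff_prod)
    then have "poly.coeff ?P (p - 1) = 1" by (simp only: deg)
    moreover have "poly.coeff ?S (p - 1) = 1"
      using p_ge_2 by (simp add: Polynomial.coeff_sum Polynomial.coeff_monom)
    ultimately show "poly.coeff ?P (p - 1) = poly.coeff ?S (p - 1)" by simp
    show "p - 1 \<le> card ((^) \<rho> ` {1..<p})" by (simp add: card_image[OF inj])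
    show "Polynomial.degree ?P \<le> p - 1" by (simp add: deg)
    show "Polynomial.degree ?S \<le> p - 1"
      by (rule degree_sum_le) (auto intro: order.trans[OF Polynomial.degree_monom_le])
    fix z assume "z \<in> (^) \<rho> ` {1..<p}"
    then obtain i where i: "i \<in> {1..<p}" "z = \<rho> ^ i" by blast
    have "Polynomial.poly ?P z = 0" using i by (auto simp: poly_prod)
    moreover have "Polynomial.poly ?S z = (\<Sum>k<p. z ^ k)" by (simp add: poly_sum poly_monom)
    moreover have "\<dots> = (1 - z ^ p) / (1 - z)"
      using root_nontrivial[of i] i by (simp add: sum_gp_strict)
    moreover have "z ^ p = 1" unfolding i(2) by (simp add: power_mult[symmetric] mult.commute[of i] power_mult root_power_p)
    ultimately show "Polynomial.poly ?P z = Polynomial.poly ?S z" by simp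
  qed
  then have "Polynomial.poly ?P 1 = Polynomial.poly ?S 1" by simp
  then show ?thesis by (simp add: poly_prod poly_sum poly_monom)
qed

text \<open>Differentiating \<open>(1 + \<eta>Z)\<^sup>p = 1 + F(Z)\<eta>\<^sup>p\<close> gives \<open>F'(Z) = v (1 + \<eta>Z)\<^sup>p\<^sup>-\<^sup>1\<close>.\<close>

definition v where "v = of_nat p / \<eta> ^ (p - 1)"

text \<open>Each of the \<open>p - 1\<close> factors of \<open>p = \<Prod>(1 - \<rho>^i)\<close> is
  \<open>-\<eta>\<close> times \<open>cyc_unit i\<close>; dividing by the power of
  \<open>\<eta>\<close> leaves a sign and a product of cyclotomic units.\<close>

lemma v_eq: "v = (-1) ^ (p - 1) * (\<Prod>i\<in>{1..<p}. cyc_unit i)"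
proof -
  have eta: "\<eta> ^ (p - 1) \<noteq> 0" using eta_nonzero by (rule power_not_zero)
  have "\<eta> * cyc_unit i = \<rho> ^ i - 1" for i
    using eta_nonzero unfolding cyc_unit_def times_divide_eq_right by (rule nonzero_mult_div_cancel_left)
  then have "- \<eta> * cyc_unit i = 1 - \<rho> ^ i" for i
    unfolding mult_minus_left by (simp only: minus_diff_eq)
  then have "of_nat p = (\<Prod>i\<in>{1..<p}. - \<eta> * cyc_unit i)"
    using prod_one_minus_root by (simp only:)
  also have "\<dots> = (- \<eta>) ^ (p - 1) * (\<Prod>i\<in>{1..<p}. cyc_unit i)"
    by (simp only: prod.distrib prod_constant card_atLeastLessThan)
  finally show ?thesis
    unfolding v_def power_minus[of \<eta> "p - 1"] using nonzero_mult_div_cancel_left[OF eta]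
    by (simp only: mult.assoc mult.left_commute[of "(-1) ^ (p - 1)" "\<eta> ^ (p - 1)"])
qed

lemma v_in: "v \<in> Zset \<rho>"
  unfolding v_eq by (intro Zset_mult Zset_power Zset_prod cyc_unit_in Zset_uminus Zset_one)

lemma v_unit: "\<exists>w\<in>Zset \<rho>. v * w = 1"
proof -
  note One_nat_def [simp del]
  let ?w = "(-1) ^ (p - 1) * (\<Prod>i\<in>{1..<p}. inverse (cyc_unit i))"
  have "?w \<in> Zset \<rho>"
    by (intro Zset_mult Zset_power Zset_prod cyc_unit_inverse Zset_uminus Zset_one) auto
  moreover have "(\<Prod>i\<in>{1..<p}. cyc_unit i) * (\<Prod>i\<in>{1..<p}. inverse (cyc_unit i)) = 1"
    using cyc_unit_inverse by (simp add: prod.distrib[symmetric])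
  then have "v * ?w = 1"
    unfolding v_eq by (simp add: mult.assoc mult.left_commute power_mult_distrib[symmetric])
  ultimately show ?thesis by blast
qed

text \<open>Over the complex numbers \<open>\<eta>^p\<close> can simply be divided out; integrality
  is recovered in \<open>coeff_Fpoly_in\<close>.\<close>

definition Fpoly :: "complex Polynomial.poly" where
  "Fpoly = Polynomial.smult (1 / \<eta> ^ p) ([:1, \<eta>:] ^ p - 1)"

lemma Fpoly_eq: "[:1, \<eta>:] ^ p = 1 + Polynomial.smult (\<eta> ^ p) Fpoly"
  using eta_nonzero by (simp add: Fpoly_def)

lemma coeff_Fpoly: "poly.coeff Fpoly i = (if i = 0 then 0 else of_nat (p choose i) * \<eta> ^ i / \<eta> ^ p)"
proof -
  have "poly.coeff ([:1, \<eta>:] ^ p) i = of_nat (p choose i) * \<eta> ^ i"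
  proof (cases "i \<le> p")
    case True
    then show ?thesis by (subst coeff_linear_poly_power) simp_all
  next
    case False
    have "Polynomial.degree ([:1, \<eta>:] ^ p) \<le> p"
      by (rule order.trans[OF degree_power_le]) simp
    then show ?thesis using False by (simp add: Polynomial.coeff_eq_0 binomial_eq_0)
  qed
  then show ?thesis by (simp add: Fpoly_def)
qed

lemma coeff_Fpoly_p: "poly.coeff Fpoly p = 1"
  using eta_nonzero p_ge_2 by (simp add: coeff_Fpoly)

lemma coeff_Fpoly_above: "p < i \<Longrightarrow> poly.coeff Fpoly i = 0"
  by (simp add: coeff_Fpoly binomial_eq_0)

text \<open>For \<open>0 < i < p\<close> the binomial coefficient is a multiple of
  \<open>p = v \<eta>^(p-1)\<close>. This cancels all but one factor \<open>\<eta>\<close> of the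
  denominator, and \<open>\<eta>^i\<close> supplies the last one.\<close>

lemma coeff_Fpoly_in: "poly.coeff Fpoly i \<in> Zset \<rho>"
proof -
  consider "i = 0" | "i = p" | "p < i" | "0 < i" "i < p" by linarith
  then show ?thesis
  proof cases
    case 4
    then have "p dvd (p choose i)" by (intro dvd_choose_prime) (auto simp: prime_p)
    then obtain m where m: "p choose i = p * m" by blast
    have "\<eta> ^ p = \<eta> ^ (p - 1) * \<eta>" using p_ge_2 by (metis One_nat_def Suc_diff_Suc diff_zero less_le_trans pos2 power_Suc2)
    moreover have "\<eta> ^ i = \<eta> ^ (i - 1) * \<eta>" using 4 by (metis One_nat_def Suc_pred power_Suc2)
    ultimately have "poly.coeff Fpoly i = of_nat m * v * \<eta> ^ (i - 1)"
      using 4 eta_nonzero by (simp add: coeff_Fpoly m v_def)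
    then show ?thesis using v_in by simp
  qed (simp_all add: coeff_Fpoly_p coeff_Fpoly_above, simp add: coeff_Fpoly)
qed

text \<open>The substitution of \<open>1 + \<rho>Z\<close> for \<open>Z\<close> sends
  \<open>1 + \<eta>Z\<close> to \<open>\<rho>(1 + \<eta>Z)\<close>, whose \<open>p\<close>-th power
  is the same.\<close>

lemma Fpoly_shift: "Polynomial.pcompose Fpoly [:1, \<rho>:] = Fpoly"
proof -
  have power: "Polynomial.pcompose (P ^ n) Q = Polynomial.pcompose P Q ^ n" for P Q :: "complex Polynomial.poly" and n
    by (induction n) (simp_all add: Polynomial.pcompose_mult Polynomial.pcompose_1)
  have "Polynomial.pcompose [:1, \<eta>:] [:1, \<rho>:] = Polynomial.smult \<rho> [:1, \<eta>:]"
    by (simp add: Polynomial.pcompose_pCons)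
  then have "Polynomial.pcompose ([:1, \<eta>:] ^ p) [:1, \<rho>:] = [:1, \<eta>:] ^ p"
    unfolding power by (metis smult_power root_power_p Polynomial.smult_1_left)
  then show ?thesis
    unfolding Fpoly_def Polynomial.pcompose_smult Polynomial.pcompose_diff Polynomial.pcompose_1
    by (simp only:)
qed

lemma pderiv_Fpoly: "Polynomial.pderiv Fpoly = Polynomial.smult v ([:1, \<eta>:] ^ (p - 1))"
proof -
  have "\<eta> ^ p = \<eta> ^ (p - 1) * \<eta>" using p_ge_2 by (metis One_nat_def Suc_diff_Suc diff_zero less_le_trans pos2 power_Suc2)
  moreover have "Polynomial.pderiv [:1, \<eta>:] = [:\<eta>:]" by (simp add: Polynomial.pderiv_pCons)
  ultimately show ?thesis
    using eta_nonzero
    by (simp add: Fpoly_def Polynomial.pderiv_smult Polynomial.pderiv_diff Polynomial.pderiv_power v_def)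
qed

end

section \<open>Evaluating integral polynomials in an algebra\<close>

text \<open>Integral polynomials stay in the type of complex polynomials, where composition,
  derivative and division by \<open>\<eta>^p\<close> are at hand. The predicate records that an
  algebra over \<open>\<int>[\<rho>]\<close> can evaluate them.\<close>

definition poly_in :: "complex \<Rightarrow> complex Polynomial.poly \<Rightarrow> bool" where
  "poly_in \<rho> P \<longleftrightarrow> (\<forall>i. poly.coeff P i \<in> Zset \<rho>)"

lemma poly_in_pCons [simp]: "poly_in \<rho> (pCons a P) \<longleftrightarrow> a \<in> Zset \<rho> \<and> poly_in \<rho> P"
  by (auto simp: poly_in_def Polynomial.coeff_pCons split: nat.splits)

lemma poly_in_0 [simp]: "poly_in \<rho> 0" by (simp add: poly_in_def)

lemma poly_in_1 [simp]: "poly_in \<rho> 1" by (simp add: one_pCons)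

lemma poly_in_add: "poly_in \<rho> P \<Longrightarrow> poly_in \<rho> Q \<Longrightarrow> poly_in \<rho> (P + Q)"
  by (simp add: poly_in_def)

lemma poly_in_smult: "a \<in> Zset \<rho> \<Longrightarrow> poly_in \<rho> P \<Longrightarrow> poly_in \<rho> (Polynomial.smult a P)"
  by (simp add: poly_in_def)

lemma poly_in_mult: "poly_in \<rho> P \<Longrightarrow> poly_in \<rho> Q \<Longrightarrow> poly_in \<rho> (P * Q)"
  by (induction P) (auto simp: poly_in_add poly_in_smult)

lemma poly_in_power: "poly_in \<rho> P \<Longrightarrow> poly_in \<rho> (P ^ n)"
  by (induction n) (auto simp: poly_in_mult)

lemma poly_in_pcompose: "poly_in \<rho> P \<Longrightarrow> poly_in \<rho> Q \<Longrightarrow> poly_in \<rho> (Polynomial.pcompose P Q)"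
  by (induction P) (auto simp: Polynomial.pcompose_pCons poly_in_add poly_in_mult)

lemma poly_in_pderiv: "poly_in \<rho> P \<Longrightarrow> poly_in \<rho> (Polynomial.pderiv P)"
  by (induction P) (auto simp: Polynomial.pderiv_pCons poly_in_add)

definition ev :: "('a, 'l) ring_scheme \<Rightarrow> (complex \<Rightarrow> 'a) \<Rightarrow> 'a \<Rightarrow> complex Polynomial.poly \<Rightarrow> 'a" where
  "ev A \<phi> x P = horner A x (map \<phi> (Polynomial.coeffs P))"

locale Z_algebra = A: cring A for A :: "('a, 'l) ring_scheme" and \<rho> :: complex and \<phi> +
  assumes \<phi>: "\<phi> \<in> ring_hom (Zring \<rho>) A"
begin

lemma \<phi>_closed [simp]: "a \<in> Zset \<rho> \<Longrightarrow> \<phi> a \<in> carrier A"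
  by (rule ring_hom_closed[OF \<phi>])

lemma \<phi>_simps: "\<phi> 0 = \<zero>\<^bsub>A\<^esub>" "\<phi> 1 = \<one>\<^bsub>A\<^esub>"
  "a \<in> Zset \<rho> \<Longrightarrow> b \<in> Zset \<rho> \<Longrightarrow> \<phi> (a + b) = \<phi> a \<oplus>\<^bsub>A\<^esub> \<phi> b"
  "a \<in> Zset \<rho> \<Longrightarrow> b \<in> Zset \<rho> \<Longrightarrow> \<phi> (a * b) = \<phi> a \<otimes>\<^bsub>A\<^esub> \<phi> b"
  using ring_hom_zero[OF \<phi> cring.axioms(1)[OF cring_Zring] A.ring_axioms]
    ring_hom_one[OF \<phi>] ring_hom_add[OF \<phi>] ring_hom_mult[OF \<phi>] by simp_all

lemma \<phi>_power: "a \<in> Zset \<rho> \<Longrightarrow> \<phi> (a ^ n) = \<phi> a [^]\<^bsub>A\<^esub> n"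
  by (induction n) (simp_all add: \<phi>_simps A.m_comm)

lemma ev_0 [simp]: "ev A \<phi> x 0 = \<zero>\<^bsub>A\<^esub>"
  by (simp add: ev_def)

lemma ev_pCons [simp]: "x \<in> carrier A \<Longrightarrow> ev A \<phi> x (pCons a P) = \<phi> a \<oplus>\<^bsub>A\<^esub> x \<otimes>\<^bsub>A\<^esub> ev A \<phi> x P"
  by (auto simp: ev_def coeffs_pCons_eq_cCons cCons_def \<phi>_simps)

lemma ev_closed [simp]: "x \<in> carrier A \<Longrightarrow> poly_in \<rho> P \<Longrightarrow> ev A \<phi> x P \<in> carrier A"
  by (induction P) auto

lemma ev_1: "x \<in> carrier A \<Longrightarrow> ev A \<phi> x 1 = \<one>\<^bsub>A\<^esub>"
  by (simp add: one_pCons \<phi>_simps)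

lemma ev_add:
  assumes x: "x \<in> carrier A"
  shows "poly_in \<rho> P \<Longrightarrow> poly_in \<rho> Q \<Longrightarrow> ev A \<phi> x (P + Q) = ev A \<phi> x P \<oplus>\<^bsub>A\<^esub> ev A \<phi> x Q"
proof (induction P arbitrary: Q)
  case (pCons a P)
  obtain b R where Q: "Q = pCons b R" by (rule pCons_cases)
  have in_Z: "a \<in> Zset \<rho>" "b \<in> Zset \<rho>" "poly_in \<rho> P" "poly_in \<rho> R" using pCons.prems Q by auto
  have c: "\<phi> a \<in> carrier A" "\<phi> b \<in> carrier A" "ev A \<phi> x P \<in> carrier A" "ev A \<phi> x R \<in> carrier A"
    using in_Z x by auto
  show ?case
    unfolding Q add_pCons ev_pCons[OF x] pCons.IH[OF in_Z(3,4)] \<phi>_simps(3)[OF in_Z(1,2)]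
    using c x by algebra
qed (use x in simp)

lemma ev_smult:
  assumes x: "x \<in> carrier A" and c: "c \<in> Zset \<rho>"
  shows "poly_in \<rho> P \<Longrightarrow> ev A \<phi> x (Polynomial.smult c P) = \<phi> c \<otimes>\<^bsub>A\<^esub> ev A \<phi> x P"
proof (induction P)
  case (pCons a P)
  have in_Z: "a \<in> Zset \<rho>" "poly_in \<rho> P" using pCons.prems by auto
  have cl: "\<phi> a \<in> carrier A" "\<phi> c \<in> carrier A" "ev A \<phi> x P \<in> carrier A" using in_Z x c by auto
  show ?case
    unfolding smult_pCons ev_pCons[OF x] pCons.IH[OF in_Z(2)] \<phi>_simps(4)[OF c in_Z(1)]
    using cl x by algebra
qed (use c in simp)

lemma ev_mult:
  assumes x: "x \<in> carrier A" and Q: "poly_in \<rho> Q"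
  shows "poly_in \<rho> P \<Longrightarrow> ev A \<phi> x (P * Q) = ev A \<phi> x P \<otimes>\<^bsub>A\<^esub> ev A \<phi> x Q"
proof (induction P)
  case (pCons a P)
  have in_Z: "a \<in> Zset \<rho>" "poly_in \<rho> P" using pCons.prems by auto
  have cl: "\<phi> a \<in> carrier A" "ev A \<phi> x P \<in> carrier A" "ev A \<phi> x Q \<in> carrier A" using in_Z x Q by auto
  have "ev A \<phi> x (pCons a P * Q) = \<phi> a \<otimes>\<^bsub>A\<^esub> ev A \<phi> x Q \<oplus>\<^bsub>A\<^esub> (\<zero>\<^bsub>A\<^esub> \<oplus>\<^bsub>A\<^esub> x \<otimes>\<^bsub>A\<^esub> (ev A \<phi> x P \<otimes>\<^bsub>A\<^esub> ev A \<phi> x Q))"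
    using in_Z Q x pCons.IH by (simp add: mult_pCons_left ev_add ev_smult poly_in_smult poly_in_mult \<phi>_simps)
  also have "\<dots> = (\<phi> a \<oplus>\<^bsub>A\<^esub> x \<otimes>\<^bsub>A\<^esub> ev A \<phi> x P) \<otimes>\<^bsub>A\<^esub> ev A \<phi> x Q"
    using cl x by algebra
  finally show ?case by (simp only: ev_pCons[OF x])
qed (use x Q in simp)

lemma ev_power:
  assumes "x \<in> carrier A" "poly_in \<rho> P"
  shows "ev A \<phi> x (P ^ n) = ev A \<phi> x P [^]\<^bsub>A\<^esub> n"
  using assms by (induction n) (simp_all add: ev_1 ev_mult poly_in_power A.m_comm)

lemma ev_pcompose:
  assumes x: "x \<in> carrier A" and Q: "poly_in \<rho> Q"
  shows "poly_in \<rho> P \<Longrightarrow> ev A \<phi> x (Polynomial.pcompose P Q) = ev A \<phi> (ev A \<phi> x Q) P"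
  using x Q by (induction P)
    (simp_all add: Polynomial.pcompose_pCons ev_add ev_mult poly_in_mult poly_in_pcompose)

text \<open>An expansion to second order free of factorials, hence valid in every characteristic.
  Passing from \<open>P\<close> to \<open>a + Z P\<close>, one writes \<open>y = x + (y - x)\<close>
  in the product \<open>y P(y)\<close>; the new remainder coefficient is
  \<open>P'(x) + y q\<close>.\<close>

lemma ev_taylor:
  assumes x: "x \<in> carrier A" and y: "y \<in> carrier A"
  shows "poly_in \<rho> P \<Longrightarrow> \<exists>q\<in>carrier A. ev A \<phi> y P =
    ev A \<phi> x P \<oplus>\<^bsub>A\<^esub> (y \<ominus>\<^bsub>A\<^esub> x) \<otimes>\<^bsub>A\<^esub> (ev A \<phi> x (Polynomial.pderiv P) \<oplus>\<^bsub>A\<^esub> (y \<ominus>\<^bsub>A\<^esub> x) \<otimes>\<^bsub>A\<^esub> q)"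
proof (induction P)
  case 0
  show ?case using x y by (intro bexI[of _ "\<zero>\<^bsub>A\<^esub>"]) simp_all
next
  case (pCons a P)
  have in_Z: "a \<in> Zset \<rho>" "poly_in \<rho> P" using pCons.prems by auto
  then obtain q where q: "q \<in> carrier A" "ev A \<phi> y P =
    ev A \<phi> x P \<oplus>\<^bsub>A\<^esub> (y \<ominus>\<^bsub>A\<^esub> x) \<otimes>\<^bsub>A\<^esub> (ev A \<phi> x (Polynomial.pderiv P) \<oplus>\<^bsub>A\<^esub> (y \<ominus>\<^bsub>A\<^esub> x) \<otimes>\<^bsub>A\<^esub> q)"
    using pCons.IH by blast
  have cl: "\<phi> a \<in> carrier A" "ev A \<phi> x P \<in> carrier A" "ev A \<phi> x (Polynomial.pderiv P) \<in> carrier A"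
    using in_Z x by (auto simp: poly_in_pderiv)
  have D: "ev A \<phi> x (Polynomial.pderiv (pCons a P)) = ev A \<phi> x P \<oplus>\<^bsub>A\<^esub> (\<zero>\<^bsub>A\<^esub> \<oplus>\<^bsub>A\<^esub> x \<otimes>\<^bsub>A\<^esub> ev A \<phi> x (Polynomial.pderiv P))"
    using in_Z x by (simp add: Polynomial.pderiv_pCons ev_add poly_in_pderiv \<phi>_simps)
  show ?case
  proof
    show "ev A \<phi> x (Polynomial.pderiv P) \<oplus>\<^bsub>A\<^esub> y \<otimes>\<^bsub>A\<^esub> q \<in> carrier A" using cl y q by simp
    show "ev A \<phi> y (pCons a P) = ev A \<phi> x (pCons a P) \<oplus>\<^bsub>A\<^esub> (y \<ominus>\<^bsub>A\<^esub> x) \<otimes>\<^bsub>A\<^esub>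
        (ev A \<phi> x (Polynomial.pderiv (pCons a P)) \<oplus>\<^bsub>A\<^esub> (y \<ominus>\<^bsub>A\<^esub> x) \<otimes>\<^bsub>A\<^esub>
          (ev A \<phi> x (Polynomial.pderiv P) \<oplus>\<^bsub>A\<^esub> y \<otimes>\<^bsub>A\<^esub> q))"
      unfolding D ev_pCons[OF x] ev_pCons[OF y] q(2) using cl x y q(1) by algebra
  qed
qed

lemma ring_hom_ev:
  assumes "cring B" "f \<in> ring_hom A B" "x \<in> carrier A" "poly_in \<rho> P"
  shows "f (ev A \<phi> x P) = ev B (\<lambda>c. f (\<phi> c)) (f x) P"
proof -
  have "set (Polynomial.coeffs P) \<subseteq> Zset \<rho>"
    using assms(4) by (auto simp: poly_in_def Polynomial.coeffs_def)
  then have "set (map \<phi> (Polynomial.coeffs P)) \<subseteq> carrier A" by auto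
  then show ?thesis
    unfolding ev_def using ring_hom_horner[OF A.is_cring assms(1,2,3)] by (simp add: comp_def)
qed

end

section \<open>The cyclic polynomial\<close>

text \<open>Structure maps are total functions on the complex numbers, and two that agree on
  \<open>\<int>[\<rho>]\<close> may differ elsewhere; evaluating an integral polynomial does not see
  this.\<close>

lemma ev_cong:
  assumes "poly_in \<rho> P" "\<And>c. c \<in> Zset \<rho> \<Longrightarrow> k c = l c"
  shows "ev A k x P = ev A l x P"
proof -
  have "set (Polynomial.coeffs P) \<subseteq> Zset \<rho>"
    using assms(1) by (auto simp: poly_in_def Polynomial.coeffs_def)
  then have "map k (Polynomial.coeffs P) = map l (Polynomial.coeffs P)" using assms(2) by auto
  then show ?thesis by (simp only: ev_def)
qed

lemma (in cyclotomic) poly_in_Fpoly: "poly_in \<rho> Fpoly"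
  by (simp add: poly_in_def coeff_Fpoly_in)

lemma (in comm_monoid) Units_pow_iff:
  assumes "x \<in> carrier G" "0 < (n::nat)"
  shows "x [^] n \<in> Units G \<longleftrightarrow> x \<in> Units G"
proof
  assume u: "x [^] n \<in> Units G"
  have "x [^] n = x \<otimes> x [^] (n - 1)"
    using assms nat_pow_Suc2[of x "n - 1"] by simp
  then have "x \<otimes> (x [^] (n - 1) \<otimes> inv (x [^] n)) = \<one>"
    using u assms by (simp add: m_assoc[symmetric])
  then show "x \<in> Units G" by (rule comm_UnitsI) (use u assms in simp_all)
qed (rule Units_pow_closed)

lemma ring_hom_Units:
  assumes "ring A" "ring B" "f \<in> ring_hom A B" "x \<in> Units A"
  shows "f x \<in> Units B"
proof -
  interpret A: ring A by fact
  interpret B: ring B by fact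
  have "f x \<otimes>\<^bsub>B\<^esub> f (inv\<^bsub>A\<^esub> x) = \<one>\<^bsub>B\<^esub>" "f (inv\<^bsub>A\<^esub> x) \<otimes>\<^bsub>B\<^esub> f x = \<one>\<^bsub>B\<^esub>"
    using assms(4) ring_hom_mult[OF assms(3)] ring_hom_one[OF assms(3)]
    by (metis A.Units_closed A.Units_inv_closed A.Units_r_inv A.Units_l_inv)+
  moreover have "f x \<in> carrier B" "f (inv\<^bsub>A\<^esub> x) \<in> carrier B"
    using assms(4) ring_hom_closed[OF assms(3)] by auto
  ultimately show ?thesis unfolding Units_def by blast
qed

locale cyc_algebra = cyclotomic p \<rho> + Z_algebra A \<rho> \<phi>
  for p \<rho> and A :: "('a, 'l) ring_scheme" and \<phi>
begin

abbreviation FA where "FA x \<equiv> ev A \<phi> x Fpoly"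
abbreviation wA where "wA x \<equiv> \<one>\<^bsub>A\<^esub> \<oplus>\<^bsub>A\<^esub> x \<otimes>\<^bsub>A\<^esub> \<phi> \<eta>"

lemma FA_closed: "x \<in> carrier A \<Longrightarrow> FA x \<in> carrier A"
  by (rule ev_closed[OF _ poly_in_Fpoly])

lemma wA_closed: "x \<in> carrier A \<Longrightarrow> wA x \<in> carrier A"
  by simp

lemma ev_linear:
  assumes "x \<in> carrier A" "c \<in> Zset \<rho>"
  shows "ev A \<phi> x [:1, c:] = \<one>\<^bsub>A\<^esub> \<oplus>\<^bsub>A\<^esub> x \<otimes>\<^bsub>A\<^esub> \<phi> c"
  using assms by (simp add: \<phi>_simps)

lemma FA_power:
  assumes x: "x \<in> carrier A"
  shows "wA x [^]\<^bsub>A\<^esub> p = cyc_elt p \<rho> A \<phi> (FA x)"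
proof -
  have "wA x [^]\<^bsub>A\<^esub> p = ev A \<phi> x ([:1, \<eta>:] ^ p)"
    using x by (subst ev_power) (simp_all only: poly_in_pCons poly_in_0 Zset_one eta_in simp_thms ev_linear)
  also have "\<dots> = \<one>\<^bsub>A\<^esub> \<oplus>\<^bsub>A\<^esub> \<phi> \<eta> [^]\<^bsub>A\<^esub> p \<otimes>\<^bsub>A\<^esub> FA x"
    unfolding Fpoly_eq
    by (simp only: ev_add[OF x poly_in_1 poly_in_smult[OF Zset_power[OF eta_in] poly_in_Fpoly]]
        ev_smult[OF x Zset_power[OF eta_in] poly_in_Fpoly] ev_1[OF x] \<phi>_power[OF eta_in])
  also have "\<dots> = cyc_elt p \<rho> A \<phi> (FA x)"
    using FA_closed[OF x] A.nat_pow_closed[OF \<phi>_closed[OF eta_in]] unfolding cyc_elt_def by (simp only: A.m_comm)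
  finally show ?thesis .
qed

lemma FA_shift:
  assumes x: "x \<in> carrier A"
  shows "FA (\<phi> \<rho> \<otimes>\<^bsub>A\<^esub> x \<oplus>\<^bsub>A\<^esub> \<one>\<^bsub>A\<^esub>) = FA x"
proof -
  have "FA x = FA (ev A \<phi> x [:1, \<rho>:])"
    using ev_pcompose[OF x _ poly_in_Fpoly, of "[:1, \<rho>:]"] Fpoly_shift by simp
  also have "ev A \<phi> x [:1, \<rho>:] = \<phi> \<rho> \<otimes>\<^bsub>A\<^esub> x \<oplus>\<^bsub>A\<^esub> \<one>\<^bsub>A\<^esub>"
    using x by (simp only: ev_linear Zset_root A.m_comm \<phi>_closed A.a_comm A.one_closed A.m_closed)
  finally show ?thesis by simp
qed

text \<open>This is \<open>F'(x)\<close>, in the form given by \<open>pderiv_Fpoly\<close>.\<close>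

definition dA where "dA x = \<phi> v \<otimes>\<^bsub>A\<^esub> wA x [^]\<^bsub>A\<^esub> (p - 1)"

lemma dA_closed: "x \<in> carrier A \<Longrightarrow> dA x \<in> carrier A"
  by (simp add: dA_def v_in del: One_nat_def)

lemma FA_taylor:
  assumes "x \<in> carrier A" "y \<in> carrier A"
  shows "\<exists>q\<in>carrier A. FA y = FA x \<oplus>\<^bsub>A\<^esub> (y \<ominus>\<^bsub>A\<^esub> x) \<otimes>\<^bsub>A\<^esub> (dA x \<oplus>\<^bsub>A\<^esub> (y \<ominus>\<^bsub>A\<^esub> x) \<otimes>\<^bsub>A\<^esub> q)"
proof -
  have lin: "poly_in \<rho> [:1, \<eta>:]" by simp
  have "ev A \<phi> x (Polynomial.pderiv Fpoly) = dA x"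
    unfolding pderiv_Fpoly dA_def ev_smult[OF assms(1) v_in poly_in_power[OF lin]]
      ev_power[OF assms(1) lin] ev_linear[OF assms(1) eta_in] ..
  then show ?thesis using ev_taylor[OF assms poly_in_Fpoly] by simp
qed

text \<open>As \<open>\<phi> v\<close> is a unit and both \<open>p - 1\<close> and \<open>p\<close>
  are positive, \<open>F'(x)\<close>, \<open>1 + \<eta>x\<close> and the \<open>p\<close>-th power
  of the latter are units together.\<close>

lemma dA_unit_iff:
  assumes x: "x \<in> carrier A"
  shows "dA x \<in> Units A \<longleftrightarrow> cyc_elt p \<rho> A \<phi> (FA x) \<in> Units A"
proof -
  obtain w where w: "w \<in> Zset \<rho>" "v * w = 1" using v_unit by blast
  have vu: "\<phi> v \<in> Units A"
    using \<phi>_simps(4)[OF v_in w(1)] w \<phi>_simps(2) v_in by (intro A.comm_UnitsI[of _ "\<phi> w"]) simp_all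
  have wp: "wA x [^]\<^bsub>A\<^esub> (p - 1) \<in> carrier A" using wA_closed[OF x] by (rule A.nat_pow_closed)
  have "dA x \<in> Units A \<longleftrightarrow> wA x [^]\<^bsub>A\<^esub> (p - 1) \<in> Units A"
  proof
    assume d: "dA x \<in> Units A"
    have "wA x [^]\<^bsub>A\<^esub> (p - 1) \<otimes>\<^bsub>A\<^esub> (\<phi> v \<otimes>\<^bsub>A\<^esub> inv\<^bsub>A\<^esub> dA x) = dA x \<otimes>\<^bsub>A\<^esub> inv\<^bsub>A\<^esub> dA x"
      unfolding dA_def using wp vu d[unfolded dA_def] A.Units_inv_closed[OF d[unfolded dA_def]]
      by (simp only: A.m_comm[OF A.Units_closed[OF vu] wp] A.m_assoc[OF wp A.Units_closed[OF vu]])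
    then have "wA x [^]\<^bsub>A\<^esub> (p - 1) \<otimes>\<^bsub>A\<^esub> (\<phi> v \<otimes>\<^bsub>A\<^esub> inv\<^bsub>A\<^esub> dA x) = \<one>\<^bsub>A\<^esub>"
      unfolding A.Units_r_inv[OF d] .
    then show "wA x [^]\<^bsub>A\<^esub> (p - 1) \<in> Units A"
      by (rule A.comm_UnitsI) (use d wp vu in \<open>simp_all add: A.Units_closed\<close>)
  qed (use vu in \<open>simp only: dA_def A.Units_m_closed\<close>)
  also have "\<dots> \<longleftrightarrow> wA x \<in> Units A"
    using p_ge_2 by (intro A.Units_pow_iff wA_closed[OF x]) simp
  also have "\<dots> \<longleftrightarrow> wA x [^]\<^bsub>A\<^esub> p \<in> Units A"
    using p_ge_2 by (intro A.Units_pow_iff[symmetric] wA_closed[OF x]) simp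
  finally show ?thesis unfolding FA_power[OF x] .
qed

lemma wA_unit:
  assumes "x \<in> carrier A" "cyc_elt p \<rho> A \<phi> (FA x) \<in> Units A"
  shows "wA x \<in> Units A"
  using assms p_ge_2 FA_power[OF assms(1)] A.Units_pow_iff[OF wA_closed[OF assms(1)], of p] by simp

lemma ring_hom_cyc_algebra: "cring B \<Longrightarrow> k \<in> ring_hom A B \<Longrightarrow> cyc_algebra p \<rho> B (\<lambda>c. k (\<phi> c))"
  using ring_hom_trans[OF \<phi>, of k B]
  by (simp add: cyc_algebra_def Z_algebra_def Z_algebra_axioms_def cyclotomic_axioms comp_def)

lemma ring_hom_cyc_elt:
  assumes "cring B" "k \<in> ring_hom A B" "x \<in> carrier A"
  shows "k (cyc_elt p \<rho> A \<phi> x) = cyc_elt p \<rho> B (\<lambda>c. k (\<phi> c)) (k x)"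
proof -
  interpret k: ring_hom_cring A B k
    using assms by (simp add: ring_hom_cring_def ring_hom_cring_axioms_def A.is_cring)
  show ?thesis using assms(3) eta_in by (simp add: cyc_elt_def del: Zset_diff)
qed

sublocale U: UP_cring A "UP A"
  by (simp add: UP_cring_def A.is_cring)

lemma pconst_hom: "pconst A \<in> ring_hom A (UP A)"
  using U.const_ring_hom by (simp add: pconst_def[abs_def])

lemma pvar_closed: "pvar A \<in> carrier (UP A)"
  by (simp add: pvar_def)

lemma coeff_ev_pvar:
  assumes "poly_in \<rho> P"
  shows "up_ring.coeff (UP A) (ev (UP A) (\<lambda>c. pconst A (\<phi> c)) (pvar A) P) n = \<phi> (poly.coeff P n)"
proof -
  have c: "set (map \<phi> (Polynomial.coeffs P)) \<subseteq> carrier A"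
    using assms by (auto simp: poly_in_def Polynomial.coeffs_def)
  have "ev (UP A) (\<lambda>c. pconst A (\<phi> c)) (pvar A) P
      = horner (UP A) (pvar A) (map (pconst A) (map \<phi> (Polynomial.coeffs P)))"
    by (simp add: ev_def comp_def)
  then have "up_ring.coeff (UP A) (ev (UP A) (\<lambda>c. pconst A (\<phi> c)) (pvar A) P) n
      = (if n < length (map \<phi> (Polynomial.coeffs P)) then map \<phi> (Polynomial.coeffs P) ! n else \<zero>\<^bsub>A\<^esub>)"
    using U.coeff_horner_var[OF c, of n] unfolding pvar_def pconst_def[abs_def] by simp
  moreover have "poly.coeff P n = (if n < length (Polynomial.coeffs P) then Polynomial.coeffs P ! n else 0)"
    by (simp add: nth_default_coeffs_eq[symmetric] nth_default_def)
  ultimately show ?thesis by (simp add: \<phi>_simps)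
qed

lemma UP_cyc_algebra: "cyc_algebra p \<rho> (UP A) (\<lambda>c. pconst A (\<phi> c))"
  by (rule ring_hom_cyc_algebra[OF U.P.is_cring pconst_hom])

text \<open>\<open>F\<close> with coefficients in \<open>A\<close>, obtained by evaluating at the
  variable of \<open>UP A\<close>. Since \<open>UP A\<close> is itself an algebra over
  \<open>\<int>[\<rho>]\<close>, what is known about \<open>FA\<close> applies to it.\<close>

definition FUP where "FUP = ev (UP A) (\<lambda>c. pconst A (\<phi> c)) (pvar A) Fpoly"

lemma FUP_closed: "FUP \<in> carrier (UP A)"
  unfolding FUP_def by (rule cyc_algebra.FA_closed[OF UP_cyc_algebra pvar_closed])

lemma coeff_FUP: "up_ring.coeff (UP A) FUP n = \<phi> (poly.coeff Fpoly n)"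
  unfolding FUP_def by (rule coeff_ev_pvar[OF poly_in_Fpoly])

definition gUP where "gUP = ev (UP A) (\<lambda>c. pconst A (\<phi> c)) (pvar A) (Fpoly - Polynomial.monom 1 p)"

lemma poly_in_G: "poly_in \<rho> (Fpoly - Polynomial.monom 1 p)"
  by (auto simp: poly_in_def coeff_Fpoly_in Polynomial.coeff_monom)

lemma gUP_closed: "gUP \<in> carrier (UP A)"
proof -
  interpret P: cyc_algebra p \<rho> "UP A" "\<lambda>c. pconst A (\<phi> c)" by (rule UP_cyc_algebra)
  show ?thesis unfolding gUP_def by (rule P.ev_closed[OF pvar_closed poly_in_G])
qed

lemma coeff_gUP: "up_ring.coeff (UP A) gUP n = \<phi> (poly.coeff (Fpoly - Polynomial.monom 1 p) n)"
  unfolding gUP_def by (rule coeff_ev_pvar[OF poly_in_G])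

lemma gUP_FUP: "gUP \<oplus>\<^bsub>UP A\<^esub> pvar A [^]\<^bsub>UP A\<^esub> p = FUP"
proof (rule U.up_eqI)
  fix n
  have "pvar A [^]\<^bsub>UP A\<^esub> p = up_ring.monom (UP A) \<one>\<^bsub>A\<^esub> p"
    unfolding pvar_def using U.monom_pow[OF A.one_closed, of 1 p] by simp
  then have c: "up_ring.coeff (UP A) (pvar A [^]\<^bsub>UP A\<^esub> p) n = (if p = n then \<one>\<^bsub>A\<^esub> else \<zero>\<^bsub>A\<^esub>)" by simp
  have "up_ring.coeff (UP A) (gUP \<oplus>\<^bsub>UP A\<^esub> pvar A [^]\<^bsub>UP A\<^esub> p) n
      = up_ring.coeff (UP A) gUP n \<oplus>\<^bsub>A\<^esub> (if p = n then \<one>\<^bsub>A\<^esub> else \<zero>\<^bsub>A\<^esub>)"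
    unfolding c[symmetric] by (rule U.coeff_add[OF gUP_closed U.P.nat_pow_closed[OF pvar_closed]])
  then show "up_ring.coeff (UP A) (gUP \<oplus>\<^bsub>UP A\<^esub> pvar A [^]\<^bsub>UP A\<^esub> p) n = up_ring.coeff (UP A) FUP n"
  proof (rule trans)
    let ?a = "poly.coeff Fpoly n" and ?m = "if p = n then 1 else 0 :: complex"
    have "\<phi> (?a - ?m) \<oplus>\<^bsub>A\<^esub> \<phi> ?m = \<phi> ?a"
      using \<phi>_simps(3)[of "?a - ?m" ?m] coeff_Fpoly_in[of n] by simp
    moreover have "\<phi> ?m = (if p = n then \<one>\<^bsub>A\<^esub> else \<zero>\<^bsub>A\<^esub>)" by (simp add: \<phi>_simps)
    ultimately show "up_ring.coeff (UP A) gUP n \<oplus>\<^bsub>A\<^esub> (if p = n then \<one>\<^bsub>A\<^esub> else \<zero>\<^bsub>A\<^esub>) = up_ring.coeff (UP A) FUP n"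
      by (simp only: coeff_gUP coeff_FUP Polynomial.coeff_diff Polynomial.coeff_monom)
  qed
qed (use gUP_closed FUP_closed pvar_closed in simp_all)

end

section \<open>The polynomial \<open>g\<close> and the cyclic polynomial\<close>

context cyclotomic
begin

lemma Z_cyc_algebra: "cyc_algebra p \<rho> (Zring \<rho>) (\<lambda>c. c)"
proof -
  have "(\<lambda>c. c) \<in> ring_hom (Zring \<rho>) (Zring \<rho>)" by (rule ring_hom_memI) auto
  then show ?thesis
    by (simp add: cyc_algebra_def Z_algebra_def Z_algebra_axioms_def cyclotomic_axioms cring_Zring)
qed

text \<open>Existence is the power identity for \<open>F\<close>, read in
  \<open>\<int>[\<rho>][Z]\<close>, with the leading term taken away. For uniqueness, the defining
  equation determines \<open>\<eta>^p g\<close>, and \<open>\<eta>^p\<close> is a nonzero complex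
  number, which cancels in each coefficient.\<close>

lemma coeff_g_poly: "up_ring.coeff (UP (Zring \<rho>)) (g_poly p \<rho>) n = poly.coeff (Fpoly - Polynomial.monom 1 p) n"
proof -
  note ZA = Z_cyc_algebra
  let ?Z = "Zring \<rho>" and ?P = "UP (Zring \<rho>)"
  interpret U: UP_cring ?Z ?P by (simp add: UP_cring_def cring_Zring)
  interpret P: cyc_algebra p \<rho> ?P "\<lambda>c. pconst ?Z c" by (rule cyc_algebra.UP_cyc_algebra[OF ZA])
  let ?z = "pvar ?Z" and ?e = "pconst ?Z \<eta>"
  define g where "g = cyc_algebra.gUP p \<rho> ?Z (\<lambda>c. c)"
  define F where "F = cyc_algebra.FUP p \<rho> ?Z (\<lambda>c. c)"
  have g: "g \<in> carrier ?P" unfolding g_def by (rule cyc_algebra.gUP_closed[OF ZA])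
  have F: "F \<in> carrier ?P" unfolding F_def by (rule cyc_algebra.FUP_closed[OF ZA])
  have gF: "g \<oplus>\<^bsub>?P\<^esub> ?z [^]\<^bsub>?P\<^esub> p = F" unfolding g_def F_def by (rule cyc_algebra.gUP_FUP[OF ZA])
  have coeff_g: "up_ring.coeff ?P g n = poly.coeff (Fpoly - Polynomial.monom 1 p) n" for n
    unfolding g_def by (rule cyc_algebra.coeff_gUP[OF ZA])
  have z: "?z \<in> carrier ?P" by (rule cyc_algebra.pvar_closed[OF ZA])
  have e: "?e \<in> carrier ?P" by (rule P.\<phi>_closed[OF eta_in])
  have "(\<one>\<^bsub>?P\<^esub> \<oplus>\<^bsub>?P\<^esub> ?z \<otimes>\<^bsub>?P\<^esub> ?e) [^]\<^bsub>?P\<^esub> p = \<one>\<^bsub>?P\<^esub> \<oplus>\<^bsub>?P\<^esub> F \<otimes>\<^bsub>?P\<^esub> ?e [^]\<^bsub>?P\<^esub> p"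
    using P.FA_power[OF z] unfolding cyc_elt_def F_def cyc_algebra.FUP_def[OF ZA] .
  then have id: "(\<one>\<^bsub>?P\<^esub> \<oplus>\<^bsub>?P\<^esub> ?e \<otimes>\<^bsub>?P\<^esub> ?z) [^]\<^bsub>?P\<^esub> p = \<one>\<^bsub>?P\<^esub> \<oplus>\<^bsub>?P\<^esub> F \<otimes>\<^bsub>?P\<^esub> ?e [^]\<^bsub>?P\<^esub> p"
    unfolding U.P.m_comm[OF z e] .
  have deg: "deg ?Z g < p"
  proof -
    have "deg ?Z g \<le> p - 1"
    proof (rule U.deg_aboveI[OF _ g])
      fix m assume "p - 1 < m"
      then have "m = p \<or> p < m" using p_ge_2 by linarith
      then show "up_ring.coeff ?P g m = \<zero>\<^bsub>?Z\<^esub>"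
        by (auto simp: coeff_g coeff_Fpoly_p coeff_Fpoly_above Polynomial.coeff_monom)
    qed
    then show ?thesis using p_ge_2 by linarith
  qed
  have e_pow: "?e [^]\<^bsub>?P\<^esub> p = up_ring.monom ?P (\<eta> ^ p) 0"
    using P.\<phi>_power[OF eta_in, of p] by (simp add: pconst_def)
  have "g_poly p \<rho> = g"
    unfolding g_poly_def Let_def
  proof (rule the_equality)
    show "g \<in> carrier ?P \<and> deg ?Z g < p \<and> (\<one>\<^bsub>?P\<^esub> \<oplus>\<^bsub>?P\<^esub> ?e \<otimes>\<^bsub>?P\<^esub> ?z) [^]\<^bsub>?P\<^esub> p =
        \<one>\<^bsub>?P\<^esub> \<oplus>\<^bsub>?P\<^esub> (g \<oplus>\<^bsub>?P\<^esub> ?z [^]\<^bsub>?P\<^esub> p) \<otimes>\<^bsub>?P\<^esub> ?e [^]\<^bsub>?P\<^esub> p"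
      unfolding gF using g deg id by blast
  next
    fix g' assume g': "g' \<in> carrier ?P \<and> deg ?Z g' < p \<and> (\<one>\<^bsub>?P\<^esub> \<oplus>\<^bsub>?P\<^esub> ?e \<otimes>\<^bsub>?P\<^esub> ?z) [^]\<^bsub>?P\<^esub> p =
        \<one>\<^bsub>?P\<^esub> \<oplus>\<^bsub>?P\<^esub> (g' \<oplus>\<^bsub>?P\<^esub> ?z [^]\<^bsub>?P\<^esub> p) \<otimes>\<^bsub>?P\<^esub> ?e [^]\<^bsub>?P\<^esub> p"
    have zp: "?z [^]\<^bsub>?P\<^esub> p \<in> carrier ?P" and ep: "?e [^]\<^bsub>?P\<^esub> p \<in> carrier ?P"
      using z e by (simp_all only: U.P.nat_pow_closed)
    have ep0: "\<eta> ^ p \<in> Zset \<rho>" by (rule Zset_power[OF eta_in])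
    have g'P: "g' \<in> carrier ?P" using g' by blast
    have sum: "\<one>\<^bsub>?P\<^esub> \<oplus>\<^bsub>?P\<^esub> (g' \<oplus>\<^bsub>?P\<^esub> ?z [^]\<^bsub>?P\<^esub> p) \<otimes>\<^bsub>?P\<^esub> ?e [^]\<^bsub>?P\<^esub> p
        = \<one>\<^bsub>?P\<^esub> \<oplus>\<^bsub>?P\<^esub> (g \<oplus>\<^bsub>?P\<^esub> ?z [^]\<^bsub>?P\<^esub> p) \<otimes>\<^bsub>?P\<^esub> ?e [^]\<^bsub>?P\<^esub> p"
      using g' id unfolding gF by argo
    define Y where "Y = ?z [^]\<^bsub>?P\<^esub> p"
    define K where "K = ?e [^]\<^bsub>?P\<^esub> p"
    have YK: "Y \<in> carrier ?P" "K \<in> carrier ?P" unfolding Y_def K_def by (rule zp, rule ep)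
    \<comment> \<open>The right-hand side is the defining expression minus terms free of
      \<open>q\<close>; equal expressions thus give equal products \<open>K q\<close>.\<close>
    have rec: "K \<otimes>\<^bsub>?P\<^esub> q = (\<one>\<^bsub>?P\<^esub> \<oplus>\<^bsub>?P\<^esub> (q \<oplus>\<^bsub>?P\<^esub> Y) \<otimes>\<^bsub>?P\<^esub> K) \<ominus>\<^bsub>?P\<^esub> \<one>\<^bsub>?P\<^esub> \<ominus>\<^bsub>?P\<^esub> Y \<otimes>\<^bsub>?P\<^esub> K"
      if "q \<in> carrier ?P" for q
      using that YK by algebra
    have "?e [^]\<^bsub>?P\<^esub> p \<otimes>\<^bsub>?P\<^esub> g' = ?e [^]\<^bsub>?P\<^esub> p \<otimes>\<^bsub>?P\<^esub> g"
      using rec[OF g'P] rec[OF g] sum unfolding Y_def K_def by argo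
    then have eq: "\<eta> ^ p \<odot>\<^bsub>?P\<^esub> g' = \<eta> ^ p \<odot>\<^bsub>?P\<^esub> g"
      unfolding e_pow using U.monom_mult_is_smult[OF ep0] g' g by simp
    show "g' = g"
    proof (rule U.up_eqI)
      fix n
      have "up_ring.coeff ?P (\<eta> ^ p \<odot>\<^bsub>?P\<^esub> g') n = up_ring.coeff ?P (\<eta> ^ p \<odot>\<^bsub>?P\<^esub> g) n" using eq by simp
      then have "\<eta> ^ p * up_ring.coeff ?P g' n = \<eta> ^ p * up_ring.coeff ?P g n"
        using U.coeff_smult[OF ep0] g' g by simp
      then show "up_ring.coeff ?P g' n = up_ring.coeff ?P g n"
        using eta_nonzero by simp
    qed (use g' g in auto)
  qed
  then show ?thesis using coeff_g by simp
qed

end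

context cyc_algebra
begin

lemma cyc_poly_eq:
  assumes "b \<in> carrier A"
  shows "cyc_poly p \<rho> A \<phi> b = FUP \<ominus>\<^bsub>UP A\<^esub> pconst A b"
proof -
  have "map_coeffs (Zring \<rho>) \<phi> (g_poly p \<rho>) = gUP"
  proof
    fix n
    show "map_coeffs (Zring \<rho>) \<phi> (g_poly p \<rho>) n = gUP n"
      unfolding map_coeffs_def coeff_g_poly coeff_gUP[symmetric] by (rule UP_coeff_eq[OF gUP_closed])
  qed
  then have "cyc_poly p \<rho> A \<phi> b = pvar A [^]\<^bsub>UP A\<^esub> p \<oplus>\<^bsub>UP A\<^esub> gUP \<ominus>\<^bsub>UP A\<^esub> pconst A b"
    by (simp only: cyc_poly_def)
  then show ?thesis
    using gUP_FUP U.P.a_comm[OF U.P.nat_pow_closed[OF pvar_closed] gUP_closed] by simp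
qed

lemma monic_cyc_poly:
  assumes b: "b \<in> carrier A"
  shows "monic_quotient A (cyc_poly p \<rho> A \<phi> b) p"
proof -
  have pb: "pconst A b \<in> carrier (UP A)" using ring_hom_closed[OF pconst_hom b] .
  have c: "up_ring.coeff (UP A) (cyc_poly p \<rho> A \<phi> b) n = \<phi> (poly.coeff Fpoly n) \<ominus>\<^bsub>A\<^esub> (if 0 = n then b else \<zero>\<^bsub>A\<^esub>)" for n
    unfolding cyc_poly_eq[OF b] U.coeff_minus[OF FUP_closed pb] coeff_FUP
    unfolding pconst_def U.coeff_monom[OF b] ..
  show ?thesis
  proof unfold_locales
    show "cyc_poly p \<rho> A \<phi> b \<in> carrier (UP A)"
      unfolding cyc_poly_eq[OF b] using FUP_closed pb by simp
    show "up_ring.coeff (UP A) (cyc_poly p \<rho> A \<phi> b) p = \<one>\<^bsub>A\<^esub>"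
      unfolding c using p_ge_2 by (simp add: coeff_Fpoly_p \<phi>_simps a_minus_def)
    show "up_ring.coeff (UP A) (cyc_poly p \<rho> A \<phi> b) i = \<zero>\<^bsub>A\<^esub>" if "p < i" for i
      unfolding c using that by (simp add: coeff_Fpoly_above \<phi>_simps a_minus_def)
    show "0 < p" using p_ge_2 by simp
  qed
qed

lemma eval_cyc_poly:
  assumes b: "b \<in> carrier A" and B: "cring B" and k: "k \<in> ring_hom A B" and s: "s \<in> carrier B"
  shows "UnivPoly.eval A B k s (cyc_poly p \<rho> A \<phi> b) = ev B (\<lambda>c. k (\<phi> c)) s Fpoly \<ominus>\<^bsub>B\<^esub> k b"
proof -
  interpret E: UP_pre_univ_prop A B k "UP A" by (rule UP_pre_univ_propI[OF A.is_cring B k])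
  interpret P: cyc_algebra p \<rho> "UP A" "\<lambda>c. pconst A (\<phi> c)" by (rule UP_cyc_algebra)
  have hom: "UnivPoly.eval A B k s \<in> ring_hom (UP A) B" by (rule E.eval_ring_hom[OF s])
  interpret H: ring_hom_cring "UP A" B "UnivPoly.eval A B k s"
    by unfold_locales (rule hom)
  have const: "UnivPoly.eval A B k s (pconst A a) = k a" if "a \<in> carrier A" for a
    unfolding pconst_def by (rule E.eval_const[OF s that])
  have "UnivPoly.eval A B k s FUP = ev B (\<lambda>c. UnivPoly.eval A B k s (pconst A (\<phi> c))) (UnivPoly.eval A B k s (pvar A)) Fpoly"
    unfolding FUP_def by (rule P.ring_hom_ev[OF B hom pvar_closed poly_in_Fpoly])
  also have "UnivPoly.eval A B k s (pvar A) = s" unfolding pvar_def by (rule E.eval_monom1[OF s])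
  also have "ev B (\<lambda>c. UnivPoly.eval A B k s (pconst A (\<phi> c))) s Fpoly = ev B (\<lambda>c. k (\<phi> c)) s Fpoly"
    by (rule ev_cong[OF poly_in_Fpoly]) (simp add: const)
  finally show ?thesis
    unfolding cyc_poly_eq[OF b] a_minus_def
    using FUP_closed ring_hom_closed[OF pconst_hom b] const[OF b] by simp
qed

end

section \<open>The algebra \<open>A[Z]/(F - b)\<close>\<close>

locale cyc_extension = cyc_algebra p \<rho> A \<phi>
  for p \<rho> and A :: "('a, 'l) ring_scheme" and \<phi> +
  fixes b assumes b: "b \<in> carrier A"
begin

sublocale M: monic_quotient A "cyc_poly p \<rho> A \<phi> b" p
  by (rule monic_cyc_poly[OF b])

sublocale Q: cyc_algebra p \<rho> M.Q "\<lambda>c. M.h (\<phi> c)"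
  by (rule ring_hom_cyc_algebra[OF M.Q.is_cring M.h])

lemma FA_theta: "Q.FA M.\<theta> = M.h b"
proof -
  interpret P: cyc_algebra p \<rho> "UP A" "\<lambda>c. pconst A (\<phi> c)" by (rule UP_cyc_algebra)
  interpret C: ring_hom_cring "UP A" M.Q "poly_class A (cyc_poly p \<rho> A \<phi> b)"
    by unfold_locales (rule M.class_hom)
  have pb: "pconst A b \<in> carrier (UP A)" using ring_hom_closed[OF pconst_hom b] .
  have "poly_class A (cyc_poly p \<rho> A \<phi> b) (cyc_poly p \<rho> A \<phi> b) = \<zero>\<^bsub>M.Q\<^esub>"
    unfolding M.class_zero_iff[OF M.f] using U.P.l_one[OF M.f] U.P.one_closed by metis
  moreover have "poly_class A (cyc_poly p \<rho> A \<phi> b) (FUP \<ominus>\<^bsub>UP A\<^esub> pconst A b) = Q.FA M.\<theta> \<ominus>\<^bsub>M.Q\<^esub> M.h b"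
    unfolding a_minus_def C.hom_add[OF FUP_closed U.P.a_inv_closed[OF pb]] C.hom_a_inv[OF pb]
    unfolding FUP_def P.ring_hom_ev[OF M.Q.is_cring M.class_hom pvar_closed poly_in_Fpoly]
    by (simp only: quot_map_def)
  ultimately have "Q.FA M.\<theta> \<ominus>\<^bsub>M.Q\<^esub> M.h b = \<zero>\<^bsub>M.Q\<^esub>"
    unfolding cyc_poly_eq[OF b, symmetric] by simp
  then show ?thesis
    using Q.FA_closed[OF M.\<theta>] M.h.hom_closed[OF b] by simp
qed

text \<open>A root of \<open>F - b\<close> in \<open>B\<close> is all that is needed for a
  homomorphism out of the quotient. It is the source of \<open>\<sigma>\<close>, of the comparison
  with the quotient over the new base, and of the Kummer isomorphism.\<close>

lemma universal:
  assumes B: "cring B" and k: "k \<in> ring_hom A B" and s: "s \<in> carrier B"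
    and root: "ev B (\<lambda>c. k (\<phi> c)) s Fpoly = k b"
  shows "\<exists>H\<in>ring_hom M.Q B. (\<forall>a\<in>carrier A. H (M.h a) = k a) \<and> H M.\<theta> = s"
proof (rule M.quotient_universal[OF B k s])
  interpret B: cring B by fact
  show "UnivPoly.eval A B k s (cyc_poly p \<rho> A \<phi> b) = \<zero>\<^bsub>B\<^esub>"
    unfolding eval_cyc_poly[OF b B k s] root using ring_hom_closed[OF k b] by (simp add: a_minus_def B.r_neg)
qed

end

text \<open>Compare first coordinates in \<open>u s = 1\<close>: multiplication by \<open>u\<close>
  acts on each coordinate, and 1 has the coordinates \<open>1, 0, ..., 0\<close>.\<close>

lemma (in power_basis) unit_descends:
  assumes n: "0 < n" and u: "u \<in> carrier R" "h u \<in> Units S"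
  shows "u \<in> Units R"
proof -
  define s where "s = inv\<^bsub>S\<^esub> h u"
  have s: "s \<in> carrier S" "h u \<otimes>\<^bsub>S\<^esub> s = \<one>\<^bsub>S\<^esub>" using u(2) by (simp_all add: s_def)
  have "coords \<one>\<^bsub>S\<^esub> = map ((\<otimes>\<^bsub>R\<^esub>) u) (coords s)"
    using coords_smult[OF u(1) s(1)] unfolding s(2) .
  moreover have "coords \<one>\<^bsub>S\<^esub> = \<one>\<^bsub>R\<^esub> # replicate (n - 1) \<zero>\<^bsub>R\<^esub>" (is "_ = ?as")
  proof -
    have "coords (horner S \<theta> (map h ?as)) = ?as"
      by (rule coords_horner) (use n in auto)
    moreover have "horner S \<theta> (map h ?as) = \<one>\<^bsub>S\<^esub>"
      by (simp add: S.horner_replicate_zero)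
    ultimately show ?thesis by simp
  qed
  ultimately obtain c cs where "coords s = c # cs" "u \<otimes>\<^bsub>R\<^esub> c = \<one>\<^bsub>R\<^esub>" by (cases "coords s") auto
  then show ?thesis using coords(2)[OF s(1)] u(1) by (intro R.comm_UnitsI[of u c]) auto
qed

context cyc_extension
begin

lemma cyc_elt_closed: "cyc_elt p \<rho> A \<phi> b \<in> carrier A"
  using b \<phi>_closed[OF eta_in] by (simp add: cyc_elt_def del: Zset_diff)

lemma cyc_elt_theta: "cyc_elt p \<rho> M.Q (\<lambda>c. M.h (\<phi> c)) (Q.FA M.\<theta>) = M.h (cyc_elt p \<rho> A \<phi> b)"
  unfolding FA_theta by (rule ring_hom_cyc_elt[OF M.Q.is_cring M.h b, symmetric])

text \<open>Expand \<open>F\<close> at the constant \<open>\<theta>\<close> in the polynomial ring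
  over the quotient. Since \<open>F(\<theta>) = b\<close>, subtracting \<open>b\<close> leaves
  exactly the factorization that \<open>separable_poly_iff\<close> asks for, with
  \<open>d = F'(\<theta>)\<close>.\<close>

lemma separable_cyc_poly: "separable_poly A (cyc_poly p \<rho> A \<phi> b) \<longleftrightarrow> cyc_elt p \<rho> A \<phi> b \<in> Units A"
proof -
  let ?V = "UP M.Q" and ?y = "pvar M.Q" and ?x = "pconst M.Q M.\<theta>"
  interpret V: cyc_algebra p \<rho> ?V "\<lambda>c. pconst M.Q (M.h (\<phi> c))" by (rule Q.UP_cyc_algebra)
  interpret C: ring_hom_cring M.Q ?V "pconst M.Q"
    by unfold_locales (rule Q.pconst_hom)
  have x: "?x \<in> carrier ?V" by (rule C.hom_closed[OF M.\<theta>])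
  have y: "?y \<in> carrier ?V" by (rule Q.pvar_closed)
  have pb: "pconst M.Q (M.h b) \<in> carrier ?V" by (rule C.hom_closed[OF M.h.hom_closed[OF b]])
  obtain q where q: "q \<in> carrier ?V" "V.FA ?y = V.FA ?x \<oplus>\<^bsub>?V\<^esub> (?y \<ominus>\<^bsub>?V\<^esub> ?x) \<otimes>\<^bsub>?V\<^esub> (V.dA ?x \<oplus>\<^bsub>?V\<^esub> (?y \<ominus>\<^bsub>?V\<^esub> ?x) \<otimes>\<^bsub>?V\<^esub> q)"
    using V.FA_taylor[OF x y] by blast
  have FAx: "V.FA ?x = pconst M.Q (M.h b)"
    using Q.ring_hom_ev[OF Q.U.P.is_cring Q.pconst_hom M.\<theta> poly_in_Fpoly] unfolding FA_theta by simp
  have dAx: "V.dA ?x = pconst M.Q (Q.dA M.\<theta>)"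
    unfolding V.dA_def Q.dA_def
    using Q.\<phi>_closed[OF v_in] Q.\<phi>_closed[OF eta_in] Q.wA_closed[OF M.\<theta>] M.\<theta>
    by (simp only: C.hom_mult C.hom_pow C.hom_add C.hom_one M.Q.m_closed M.Q.one_closed M.Q.nat_pow_closed)
  have d: "Q.dA M.\<theta> \<in> carrier M.Q" by (rule Q.dA_closed[OF M.\<theta>])
  have const_hom: "(\<lambda>r. pconst M.Q (M.h r)) \<in> ring_hom A ?V"
    using ring_hom_trans[OF M.h Q.pconst_hom] by (simp add: comp_def)
  define Z where "Z = (?y \<ominus>\<^bsub>?V\<^esub> ?x) \<otimes>\<^bsub>?V\<^esub> (pconst M.Q (Q.dA M.\<theta>) \<oplus>\<^bsub>?V\<^esub> (?y \<ominus>\<^bsub>?V\<^esub> ?x) \<otimes>\<^bsub>?V\<^esub> q)"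
  have Z: "Z \<in> carrier ?V" unfolding Z_def using x y q(1) C.hom_closed[OF d] by simp
  have "UnivPoly.eval A ?V (\<lambda>r. pconst M.Q (M.h r)) ?y (cyc_poly p \<rho> A \<phi> b)
      = (pconst M.Q (M.h b) \<oplus>\<^bsub>?V\<^esub> Z) \<ominus>\<^bsub>?V\<^esub> pconst M.Q (M.h b)"
    unfolding eval_cyc_poly[OF b Q.U.P.is_cring const_hom y] q(2) FAx dAx Z_def ..
  also have "\<dots> = Z" using Z pb by algebra
  finally have "separable_poly A (cyc_poly p \<rho> A \<phi> b) \<longleftrightarrow> Q.dA M.\<theta> \<in> Units M.Q"
    unfolding Z_def by (rule M.separable_poly_iff[OF d q(1)])
  also have "\<dots> \<longleftrightarrow> M.h (cyc_elt p \<rho> A \<phi> b) \<in> Units M.Q"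
    unfolding Q.dA_unit_iff[OF M.\<theta>] cyc_elt_theta ..
  also have "\<dots> \<longleftrightarrow> cyc_elt p \<rho> A \<phi> b \<in> Units A"
    using M.unit_descends[OF M.n cyc_elt_closed] ring_hom_Units[OF A.ring_axioms M.Q.ring_axioms M.h] by blast
  finally show ?thesis .
qed

section \<open>The automorphism \<open>\<sigma>\<close>\<close>

text \<open>Closed form of the \<open>i\<close>-th iterate of \<open>Z \<mapsto> \<rho>Z + 1\<close>
  at \<open>\<theta>\<close>.\<close>

definition sigma_image where
  "sigma_image i = M.h (\<phi> (\<rho> ^ i)) \<otimes>\<^bsub>M.Q\<^esub> M.\<theta> \<oplus>\<^bsub>M.Q\<^esub> M.h (\<phi> (cyc_unit i))"

definition is_generator where
  "is_generator \<sigma> \<longleftrightarrow> \<sigma> \<in> algebra_automorphisms A M.Q M.h \<and> \<sigma> M.\<theta> = M.h (\<phi> \<rho>) \<otimes>\<^bsub>M.Q\<^esub> M.\<theta> \<oplus>\<^bsub>M.Q\<^esub> \<one>\<^bsub>M.Q\<^esub>"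

text \<open>Rests on \<open>cyc_unit (Suc i) = \<rho> cyc_unit i + 1\<close>. The map
  \<open>f\<close> is arbitrary because the iterates occur in two forms: as powers in
  \<open>BijGroup\<close>, and as function powers of an endomorphism not yet known to be
  bijective.\<close>

lemma sigma_step:
  assumes "f \<in> ring_hom M.Q M.Q" "\<And>a. a \<in> carrier A \<Longrightarrow> f (M.h a) = M.h a" "f M.\<theta> = sigma_image i"
  shows "f (M.h (\<phi> \<rho>) \<otimes>\<^bsub>M.Q\<^esub> M.\<theta> \<oplus>\<^bsub>M.Q\<^esub> \<one>\<^bsub>M.Q\<^esub>) = sigma_image (Suc i)"
proof -
  interpret f: ring_hom_cring M.Q M.Q f
    by unfold_locales (rule assms(1))
  let ?r = "M.h (\<phi> \<rho>)" and ?ri = "M.h (\<phi> (\<rho> ^ i))" and ?c = "M.h (\<phi> (cyc_unit i))"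
  have cl: "?r \<in> carrier M.Q" "?ri \<in> carrier M.Q" "?c \<in> carrier M.Q"
    using Q.\<phi>_closed cyc_unit_in by simp_all
  have cu: "cyc_unit (Suc i) = \<rho> * cyc_unit i + 1"
    using eta_nonzero by (simp add: cyc_unit_def field_simps)
  have "f (?r \<otimes>\<^bsub>M.Q\<^esub> M.\<theta> \<oplus>\<^bsub>M.Q\<^esub> \<one>\<^bsub>M.Q\<^esub>) = ?r \<otimes>\<^bsub>M.Q\<^esub> (?ri \<otimes>\<^bsub>M.Q\<^esub> M.\<theta> \<oplus>\<^bsub>M.Q\<^esub> ?c) \<oplus>\<^bsub>M.Q\<^esub> \<one>\<^bsub>M.Q\<^esub>"
    using cl(1) M.\<theta> assms(2)[OF \<phi>_closed[OF Zset_root]]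
    by (simp only: f.hom_add f.hom_mult f.hom_one M.Q.m_closed M.Q.one_closed assms(3) sigma_image_def)
  also have "\<dots> = (?r \<otimes>\<^bsub>M.Q\<^esub> ?ri) \<otimes>\<^bsub>M.Q\<^esub> M.\<theta> \<oplus>\<^bsub>M.Q\<^esub> (?r \<otimes>\<^bsub>M.Q\<^esub> ?c \<oplus>\<^bsub>M.Q\<^esub> \<one>\<^bsub>M.Q\<^esub>)"
    using cl M.\<theta> by algebra
  also have "\<dots> = sigma_image (Suc i)"
    unfolding sigma_image_def cu power_Suc
    using Q.\<phi>_simps(4)[OF Zset_root Zset_power[OF Zset_root]] Q.\<phi>_simps(2)
      Q.\<phi>_simps(4)[OF Zset_root cyc_unit_in] Q.\<phi>_simps(3)[OF Zset_mult[OF Zset_root cyc_unit_in] Zset_one]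
    by (simp only:)
  finally show ?thesis .
qed

lemma sigma_image_0: "sigma_image 0 = M.\<theta>" and sigma_image_p: "sigma_image p = M.\<theta>"
  using Q.\<phi>_simps(1,2) M.\<theta> unfolding sigma_image_def cyc_unit_def root_power_p
  by (simp_all only: power_0 diff_self div_0 M.Q.l_one M.Q.r_zero)

lemma generator_pow:
  assumes \<sigma>: "is_generator \<sigma>"
  shows "\<sigma> [^]\<^bsub>BijGroup (carrier M.Q)\<^esub> (i::nat) \<in> algebra_automorphisms A M.Q M.h"
    and "(\<sigma> [^]\<^bsub>BijGroup (carrier M.Q)\<^esub> i) M.\<theta> = sigma_image i"
proof -
  let ?B = "BijGroup (carrier M.Q)"
  interpret B: group ?B by (rule group_BijGroup)
  have s: "\<sigma> \<in> carrier ?B" "\<sigma> \<in> ring_hom M.Q M.Q" "\<And>a. a \<in> carrier A \<Longrightarrow> \<sigma> (M.h a) = M.h a"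
    "\<sigma> M.\<theta> = M.h (\<phi> \<rho>) \<otimes>\<^bsub>M.Q\<^esub> M.\<theta> \<oplus>\<^bsub>M.Q\<^esub> \<one>\<^bsub>M.Q\<^esub>"
    using \<sigma> unfolding is_generator_def algebra_automorphisms_def mem_Collect_eq by blast+
  have "\<sigma> [^]\<^bsub>?B\<^esub> i \<in> algebra_automorphisms A M.Q M.h \<and> (\<sigma> [^]\<^bsub>?B\<^esub> i) M.\<theta> = sigma_image i"
  proof (induction i)
    case 0
    have "(\<lambda>x\<in>carrier M.Q. x) \<in> ring_hom M.Q M.Q"
      by (rule ring_hom_memI) auto
    then have "\<one>\<^bsub>?B\<^esub> \<in> ring_hom M.Q M.Q" by (simp only: BijGroup_def monoid.simps)
    moreover have id: "\<one>\<^bsub>?B\<^esub> x = x" if "x \<in> carrier M.Q" for x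
      using that by (simp add: BijGroup_def)
    ultimately have "\<one>\<^bsub>?B\<^esub> \<in> algebra_automorphisms A M.Q M.h"
      unfolding algebra_automorphisms_def by (intro CollectI conjI ballI B.one_closed id[OF M.h.hom_closed])
    then show ?case unfolding B.nat_pow_0 sigma_image_0 using id[OF M.\<theta>] by (rule conjI)
  next
    case (Suc i)
    let ?f = "\<sigma> [^]\<^bsub>?B\<^esub> i"
    have f: "?f \<in> carrier ?B" "?f \<in> ring_hom M.Q M.Q" "\<And>a. a \<in> carrier A \<Longrightarrow> ?f (M.h a) = M.h a" "?f M.\<theta> = sigma_image i"
      using Suc unfolding algebra_automorphisms_def mem_Collect_eq by blast+
    have val: "(\<sigma> [^]\<^bsub>?B\<^esub> Suc i) x = ?f (\<sigma> x)" if "x \<in> carrier M.Q" for x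
    proof -
      have "\<sigma> [^]\<^bsub>?B\<^esub> Suc i = compose (carrier M.Q) ?f \<sigma>"
        unfolding B.nat_pow_Suc using f(1) s(1) by (simp only: BijGroup_def monoid.simps partial_object.simps restrict_apply if_True)
      then show ?thesis using that by (simp only: compose_eq)
    qed
    have "\<sigma> [^]\<^bsub>?B\<^esub> Suc i \<in> ring_hom M.Q M.Q"
    proof (rule ring_hom_memI)
      show "(\<sigma> [^]\<^bsub>?B\<^esub> Suc i) x \<in> carrier M.Q" if "x \<in> carrier M.Q" for x
        unfolding val[OF that] by (intro ring_hom_closed[OF f(2)] ring_hom_closed[OF s(2)] that)
      show "(\<sigma> [^]\<^bsub>?B\<^esub> Suc i) \<one>\<^bsub>M.Q\<^esub> = \<one>\<^bsub>M.Q\<^esub>"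
        unfolding val[OF M.Q.one_closed] ring_hom_one[OF s(2)] by (rule ring_hom_one[OF f(2)])
      fix x y assume xy: "x \<in> carrier M.Q" "y \<in> carrier M.Q"
      note c = ring_hom_closed[OF s(2) xy(1)] ring_hom_closed[OF s(2) xy(2)]
      show "(\<sigma> [^]\<^bsub>?B\<^esub> Suc i) (x \<otimes>\<^bsub>M.Q\<^esub> y) = (\<sigma> [^]\<^bsub>?B\<^esub> Suc i) x \<otimes>\<^bsub>M.Q\<^esub> (\<sigma> [^]\<^bsub>?B\<^esub> Suc i) y"
        unfolding val[OF xy(1)] val[OF xy(2)] val[OF M.Q.m_closed[OF xy]] ring_hom_mult[OF s(2) xy]
        by (rule ring_hom_mult[OF f(2) c])
      show "(\<sigma> [^]\<^bsub>?B\<^esub> Suc i) (x \<oplus>\<^bsub>M.Q\<^esub> y) = (\<sigma> [^]\<^bsub>?B\<^esub> Suc i) x \<oplus>\<^bsub>M.Q\<^esub> (\<sigma> [^]\<^bsub>?B\<^esub> Suc i) y"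
        unfolding val[OF xy(1)] val[OF xy(2)] val[OF M.Q.a_closed[OF xy]] ring_hom_add[OF s(2) xy]
        by (rule ring_hom_add[OF f(2) c])
    qed
    moreover have "(\<sigma> [^]\<^bsub>?B\<^esub> Suc i) (M.h a) = M.h a" if "a \<in> carrier A" for a
      unfolding val[OF M.h.hom_closed[OF that]] s(3)[OF that] by (rule f(3)[OF that])
    moreover have "(\<sigma> [^]\<^bsub>?B\<^esub> Suc i) M.\<theta> = sigma_image (Suc i)"
      unfolding val[OF M.\<theta>] s(4) by (rule sigma_step[OF f(2-4)])
    ultimately show ?case
      using B.nat_pow_closed[OF s(1), of "Suc i"] unfolding algebra_automorphisms_def by blast
  qed
  then show "\<sigma> [^]\<^bsub>?B\<^esub> i \<in> algebra_automorphisms A M.Q M.h" "(\<sigma> [^]\<^bsub>?B\<^esub> i) M.\<theta> = sigma_image i" by auto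
qed

text \<open>Members of \<open>BijGroup\<close> are extensional, so agreement on the carrier, which
  the value at \<open>\<theta>\<close> decides, is equality of functions.\<close>

lemma automorphism_eqI:
  assumes "f \<in> algebra_automorphisms A M.Q M.h" "g \<in> algebra_automorphisms A M.Q M.h" "f M.\<theta> = g M.\<theta>"
  shows "f = g"
proof (rule extensionalityI[of _ "carrier M.Q"])
  show "f \<in> extensional (carrier M.Q)" "g \<in> extensional (carrier M.Q)"
    using assms(1,2) Bij_imp_extensional by (auto simp: algebra_automorphisms_def BijGroup_def)
  fix x assume "x \<in> carrier M.Q"
  then show "f x = g x"
    using M.ring_hom_eqI[OF M.Q.is_cring, of f g x] assms by (auto simp: algebra_automorphisms_def)
qed

text \<open>By \<open>FA_shift\<close> the element \<open>\<rho>\<theta> + 1\<close> is again a root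
  of \<open>F - b\<close>, which yields an endomorphism \<open>H\<close>. Its \<open>p\<close>-th
  iterate fixes \<open>\<theta>\<close>, hence is the identity, so \<open>H\<close> is bijective
  with inverse \<open>H ^^ (p - 1)\<close>.\<close>

lemma generator_unique: "\<exists>!\<sigma>. is_generator \<sigma>"
proof -
  let ?s = "M.h (\<phi> \<rho>) \<otimes>\<^bsub>M.Q\<^esub> M.\<theta> \<oplus>\<^bsub>M.Q\<^esub> \<one>\<^bsub>M.Q\<^esub>"
  have s: "?s \<in> carrier M.Q" using Q.\<phi>_closed[OF Zset_root] M.\<theta> by simp
  obtain H where H: "H \<in> ring_hom M.Q M.Q" "\<And>a. a \<in> carrier A \<Longrightarrow> H (M.h a) = M.h a" "H M.\<theta> = ?s"
    using universal[OF M.Q.is_cring M.h s] Q.FA_shift[OF M.\<theta>] FA_theta by auto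
  have pow: "(H ^^ i) \<in> ring_hom M.Q M.Q \<and> (\<forall>a\<in>carrier A. (H ^^ i) (M.h a) = M.h a) \<and> (H ^^ i) M.\<theta> = sigma_image i" for i
  proof (induction i)
    case 0
    have "id \<in> ring_hom M.Q M.Q" by (rule ring_hom_memI) auto
    then show ?case unfolding funpow.simps(1) by (intro conjI ballI) (assumption | simp only: id_apply sigma_image_0)+
  next
    case (Suc i)
    then have i: "H ^^ i \<in> ring_hom M.Q M.Q" "\<And>a. a \<in> carrier A \<Longrightarrow> (H ^^ i) (M.h a) = M.h a"
      "(H ^^ i) M.\<theta> = sigma_image i" by blast+
    show ?case
      unfolding funpow_Suc_right
    proof (intro conjI ballI)
      show "H ^^ i \<circ> H \<in> ring_hom M.Q M.Q" by (rule ring_hom_trans[OF H(1) i(1)])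
      show "(H ^^ i \<circ> H) (M.h a) = M.h a" if "a \<in> carrier A" for a
        unfolding comp_apply H(2)[OF that] by (rule i(2)[OF that])
      show "(H ^^ i \<circ> H) M.\<theta> = sigma_image (Suc i)"
        unfolding comp_apply H(3) by (rule sigma_step[OF i])
    qed
  qed
  have id: "(H ^^ p) x = x" if "x \<in> carrier M.Q" for x
  proof -
    have "id \<in> ring_hom M.Q M.Q" by (rule ring_hom_memI) auto
    from M.ring_hom_eqI[OF M.Q.is_cring _ this, of "H ^^ p" x] pow[of p] that
    show ?thesis by (simp add: sigma_image_p)
  qed
  have p: "p = Suc (p - 1)" using p_ge_2 by simp
  \<comment> \<open>The restriction makes the map extensional, as membership in
    \<open>BijGroup\<close> demands.\<close>
  define \<sigma> where "\<sigma> = restrict H (carrier M.Q)"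
  have bij: "bij_betw H (carrier M.Q) (carrier M.Q)"
  proof (rule bij_betw_byWitness[where f' = "H ^^ (p - 1)"])
    show "\<forall>x\<in>carrier M.Q. (H ^^ (p - 1)) (H x) = x"
      using id p funpow_Suc_right[of "p - 1" H] by (metis comp_apply)
    show "\<forall>x\<in>carrier M.Q. H ((H ^^ (p - 1)) x) = x"
      using id p by (metis comp_apply funpow.simps(2))
    show "H ` carrier M.Q \<subseteq> carrier M.Q" using ring_hom_closed[OF H(1)] by blast
    show "(H ^^ (p - 1)) ` carrier M.Q \<subseteq> carrier M.Q" 
      by (rule image_subsetI) (rule ring_hom_closed[OF conjunct1[OF pow]])
  qed
  have "\<sigma> \<in> carrier (BijGroup (carrier M.Q))"
    using bij by (auto simp: BijGroup_def Bij_def \<sigma>_def cong: bij_betw_cong)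
  moreover have "\<sigma> \<in> ring_hom M.Q M.Q"
    using H(1) by (auto simp: ring_hom_def \<sigma>_def Pi_def)
  ultimately have "is_generator \<sigma>"
    using H M.h.hom_closed M.\<theta> by (simp add: is_generator_def algebra_automorphisms_def \<sigma>_def)
  moreover have "\<sigma>' = \<sigma>''" if "is_generator \<sigma>'" "is_generator \<sigma>''" for \<sigma>' \<sigma>''
    using automorphism_eqI that by (simp add: is_generator_def)
  ultimately show ?thesis by blast
qed

end

text \<open>The action is \<open>act g \<otimes> id\<close>, from the universal property. The laws
  of an action hold on pure tensors and hence everywhere; bijectivity comes from inverses in
  \<open>G\<close>.\<close>

lemma (in tensor_product) action_on_left_factor:
  assumes action: "group_action G (carrier A) act"
    and hom: "\<And>g. g \<in> carrier G \<Longrightarrow> act g \<in> ring_hom A A"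
    and fix_R: "\<And>g r. g \<in> carrier G \<Longrightarrow> r \<in> carrier R \<Longrightarrow> act g (h r) = h r"
  obtains act' where "group_action G (carrier T) act'"
    and "\<And>g. g \<in> carrier G \<Longrightarrow> act' g \<in> ring_hom T T"
    and "\<And>g a b. g \<in> carrier G \<Longrightarrow> a \<in> carrier A \<Longrightarrow> b \<in> carrier B \<Longrightarrow> act' g (t a b) = t (act g a) b"
proof -
  interpret act: group_action G "carrier A" act by fact
  interpret G: group G using act.group_hom by (rule group_hom.axioms)
  have act_closed: "act g a \<in> carrier A" if "g \<in> carrier G" "a \<in> carrier A" for g a
    by (rule ring_hom_closed[OF hom[OF that(1)] that(2)])
  have "\<exists>F. F \<in> ring_hom T T \<and> (\<forall>a\<in>carrier A. \<forall>b\<in>carrier B. F (t a b) = t (act g a) b)"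
    if g: "g \<in> carrier G" for g
  proof -
    have "(\<lambda>a. t (act g a) \<one>\<^bsub>B\<^esub>) \<in> ring_hom A T"
      using ring_hom_trans[OF hom[OF g] left_hom] by (simp add: comp_def)
    moreover have "t (act g (h r)) \<one>\<^bsub>B\<^esub> = t \<one>\<^bsub>A\<^esub> (k r)" if "r \<in> carrier R" for r
      unfolding fix_R[OF g that] by (rule pure_tensor_base[OF that])
    ultimately obtain F where F: "F \<in> ring_hom T T"
      "\<forall>a\<in>carrier A. \<forall>b\<in>carrier B. F (t a b) = t (act g a) \<one>\<^bsub>B\<^esub> \<otimes>\<^bsub>T\<^esub> t \<one>\<^bsub>A\<^esub> b"
      using tensor_universal[OF T.is_cring _ right_hom, of "\<lambda>a. t (act g a) \<one>\<^bsub>B\<^esub>"] by blast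
    moreover have "F (t a b) = t (act g a) b" if ab: "a \<in> carrier A" "b \<in> carrier B" for a b
      unfolding pure_tensor_eq_mult[OF act_closed[OF g ab(1)] ab(2)] by (rule bspec[OF bspec[OF F(2) ab(1)] ab(2)])
    ultimately show ?thesis by blast
  qed
  then obtain F where F: "\<And>g. g \<in> carrier G \<Longrightarrow> F g \<in> ring_hom T T"
    "\<And>g a b. g \<in> carrier G \<Longrightarrow> a \<in> carrier A \<Longrightarrow> b \<in> carrier B \<Longrightarrow> F g (t a b) = t (act g a) b"
    by metis
  have F_closed: "F g x \<in> carrier T" if "g \<in> carrier G" "x \<in> carrier T" for g x
    by (rule ring_hom_closed[OF F(1)[OF that(1)] that(2)])
  have F_mult: "F (g \<otimes>\<^bsub>G\<^esub> g') x = F g (F g' x)" if g: "g \<in> carrier G" "g' \<in> carrier G" and x: "x \<in> carrier T" for g g' x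
  proof -
    have "F (g \<otimes>\<^bsub>G\<^esub> g') x = (F g \<circ> F g') x"
    proof (rule ring_hom_tensor_eqI[OF T.ring_axioms F(1) ring_hom_trans[OF F(1) F(1)] _ x])
      fix a b assume ab: "a \<in> carrier A" "b \<in> carrier B"
      show "F (g \<otimes>\<^bsub>G\<^esub> g') (t a b) = (F g \<circ> F g') (t a b)"
        unfolding comp_apply F(2)[OF g(2) ab] F(2)[OF g(1) act_closed[OF g(2) ab(1)] ab(2)]
          F(2)[OF G.m_closed[OF g] ab] act.composition_rule[OF ab(1) g] ..
    qed (use g in simp_all)
    then show ?thesis unfolding comp_apply .
  qed
  have id: "id \<in> ring_hom T T" by (rule ring_hom_memI) simp_all
  have F_one: "F \<one>\<^bsub>G\<^esub> x = x" if "x \<in> carrier T" for x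
  proof -
    have "F \<one>\<^bsub>G\<^esub> x = id x"
    proof (rule ring_hom_tensor_eqI[OF T.ring_axioms F(1)[OF G.one_closed] id _ that])
      fix a b assume ab: "a \<in> carrier A" "b \<in> carrier B"
      have "act \<one>\<^bsub>G\<^esub> a = a" using fun_cong[OF act.id_eq_one, of a] ab(1) by (simp only: restrict_apply if_True)
      then show "F \<one>\<^bsub>G\<^esub> (t a b) = id (t a b)" unfolding F(2)[OF G.one_closed ab] by simp
    qed
    then show ?thesis unfolding id_apply .
  qed
  \<comment> \<open>\<open>F g\<close> is unconstrained outside the carrier, whereas
    \<open>BijGroup\<close> contains only extensional maps.\<close>
  define act' where "act' g = restrict (F g) (carrier T)" for g
  have act': "act' g x = F g x" if "x \<in> carrier T" for g x using that by (simp only: act'_def restrict_apply if_True)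
  have bij: "act' g \<in> Bij (carrier T)" if g: "g \<in> carrier G" for g
  proof -
    have "bij_betw (act' g) (carrier T) (carrier T)"
    proof (rule bij_betw_byWitness[where f' = "F (inv\<^bsub>G\<^esub> g)"])
      show "\<forall>x\<in>carrier T. F (inv\<^bsub>G\<^esub> g) (act' g x) = x"
        using F_mult[OF G.inv_closed[OF g] g] F_one G.l_inv[OF g] act' by metis
      show "\<forall>x\<in>carrier T. act' g (F (inv\<^bsub>G\<^esub> g) x) = x"
        using F_mult[OF g G.inv_closed[OF g]] F_one G.r_inv[OF g] act' F_closed[OF G.inv_closed[OF g]] by metis
      show "act' g ` carrier T \<subseteq> carrier T" using F_closed[OF g] act' by (intro image_subsetI) metis
      show "F (inv\<^bsub>G\<^esub> g) ` carrier T \<subseteq> carrier T" using F_closed[OF G.inv_closed[OF g]] by (intro image_subsetI)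
    qed
    then show ?thesis by (simp only: Bij_def Int_iff mem_Collect_eq act'_def restrict_extensional simp_thms)
  qed
  have "group_action G (carrier T) act'"
  proof (intro group_action.intro group_hom.intro group_hom_axioms.intro G.group_axioms group_BijGroup)
    have "act' (g \<otimes>\<^bsub>G\<^esub> g') = act' g \<otimes>\<^bsub>BijGroup (carrier T)\<^esub> act' g'" if g: "g \<in> carrier G" "g' \<in> carrier G" for g g'
    proof -
      have "act' (g \<otimes>\<^bsub>G\<^esub> g') = compose (carrier T) (act' g) (act' g')"
      proof (rule extensionalityI[of _ "carrier T"])
        fix x assume x: "x \<in> carrier T"
        show "act' (g \<otimes>\<^bsub>G\<^esub> g') x = compose (carrier T) (act' g) (act' g') x"
          unfolding compose_eq[OF x] act'[OF x] act'[OF F_closed[OF g(2) x]] by (rule F_mult[OF g x])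
      qed (simp_all only: act'_def restrict_extensional compose_extensional)
      then show ?thesis
        using bij[OF g(1)] bij[OF g(2)] by (simp only: BijGroup_def monoid.simps partial_object.simps restrict_apply if_True)
    qed
    then show "act' \<in> hom G (BijGroup (carrier T))"
      using bij by (intro homI) (simp_all only: BijGroup_def partial_object.simps)
  qed
  moreover have "act' g \<in> ring_hom T T" if g: "g \<in> carrier G" for g
  proof (rule ring_hom_memI)
    fix x y assume xy: "x \<in> carrier T" "y \<in> carrier T"
    show "act' g x \<in> carrier T" unfolding act'[OF xy(1)] by (rule F_closed[OF g xy(1)])
    show "act' g (x \<otimes>\<^bsub>T\<^esub> y) = act' g x \<otimes>\<^bsub>T\<^esub> act' g y"
      unfolding act'[OF xy(1)] act'[OF xy(2)] act'[OF T.m_closed[OF xy]] by (rule ring_hom_mult[OF F(1)[OF g] xy])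
    show "act' g (x \<oplus>\<^bsub>T\<^esub> y) = act' g x \<oplus>\<^bsub>T\<^esub> act' g y"
      unfolding act'[OF xy(1)] act'[OF xy(2)] act'[OF T.a_closed[OF xy]] by (rule ring_hom_add[OF F(1)[OF g] xy])
  next
    show "act' g \<one>\<^bsub>T\<^esub> = \<one>\<^bsub>T\<^esub>" unfolding act'[OF T.one_closed] by (rule ring_hom_one[OF F(1)[OF g]])
  qed
  moreover have "act' g (t a b) = t (act g a) b" if "g \<in> carrier G" "a \<in> carrier A" "b \<in> carrier B" for g a b
    unfolding act'[OF pure_tensor_closed[OF that(2,3)]] by (rule F(2)[OF that])
  ultimately show thesis by (rule that)
qed

section \<open>Unit differences of conjugates and the Galois group of order \<open>p\<close>\<close>

context cyc_extension
begin

lemma sigma_image_closed: "sigma_image i \<in> carrier M.Q"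
  using Q.\<phi>_closed[OF Zset_power[OF Zset_root]] Q.\<phi>_closed[OF cyc_unit_in] M.\<theta> by (simp add: sigma_image_def)

text \<open>With \<open>\<rho>^i = 1 + \<eta> cyc_unit i\<close> the \<open>i\<close>-th conjugate
  becomes \<open>\<theta> + cyc_unit i (1 + \<eta>\<theta>)\<close>, and \<open>\<theta>\<close>
  drops out of differences.\<close>

lemma sigma_image_diff:
  "sigma_image i \<ominus>\<^bsub>M.Q\<^esub> sigma_image j = M.h (\<phi> (cyc_unit i - cyc_unit j)) \<otimes>\<^bsub>M.Q\<^esub> Q.wA M.\<theta>"
proof -
  let ?c = "\<lambda>i. M.h (\<phi> (cyc_unit i))" and ?e = "M.h (\<phi> \<eta>)" and ?d = "M.h (\<phi> (cyc_unit i - cyc_unit j))"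
  have d_in: "cyc_unit i - cyc_unit j \<in> Zset \<rho>" by (intro Zset_diff cyc_unit_in)
  have cl: "?c i \<in> carrier M.Q" for i by (rule Q.\<phi>_closed[OF cyc_unit_in])
  have cl': "?e \<in> carrier M.Q" "?d \<in> carrier M.Q"
    by (rule Q.\<phi>_closed[OF eta_in], rule Q.\<phi>_closed[OF d_in])
  have root: "M.h (\<phi> (\<rho> ^ i)) = \<one>\<^bsub>M.Q\<^esub> \<oplus>\<^bsub>M.Q\<^esub> ?e \<otimes>\<^bsub>M.Q\<^esub> ?c i" for i
  proof -
    have "\<rho> ^ i = 1 + \<eta> * cyc_unit i" using eta_nonzero by (simp add: cyc_unit_def)
    then show ?thesis
      using Q.\<phi>_simps(3)[OF Zset_one Zset_mult[OF eta_in cyc_unit_in]]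
      unfolding Q.\<phi>_simps(2) Q.\<phi>_simps(4)[OF eta_in cyc_unit_in] by metis
  qed
  have ci: "?c i = ?d \<oplus>\<^bsub>M.Q\<^esub> ?c j"
    using Q.\<phi>_simps(3)[OF d_in cyc_unit_in, of j] by (simp only: diff_add_cancel)
  show ?thesis unfolding sigma_image_def root ci
    using cl[of j] cl' M.\<theta> by algebra
qed

lemma sigma_image_diff_unit:
  assumes unit: "cyc_elt p \<rho> A \<phi> b \<in> Units A" and ij: "i < p" "j < p" "i \<noteq> j"
  shows "sigma_image i \<ominus>\<^bsub>M.Q\<^esub> sigma_image j \<in> Units M.Q"
proof -
  obtain w where w: "w \<in> Zset \<rho>" "(cyc_unit i - cyc_unit j) * w = 1"
    using cyc_unit_diff[OF ij] by blast
  have d_in: "cyc_unit i - cyc_unit j \<in> Zset \<rho>" by (intro Zset_diff cyc_unit_in)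
  have "M.h (\<phi> (cyc_unit i - cyc_unit j)) \<otimes>\<^bsub>M.Q\<^esub> M.h (\<phi> w) = \<one>\<^bsub>M.Q\<^esub>"
    using Q.\<phi>_simps(4)[OF d_in w(1)] unfolding w(2) Q.\<phi>_simps(2) by (rule sym)
  then have "M.h (\<phi> (cyc_unit i - cyc_unit j)) \<in> Units M.Q"
    by (rule M.Q.comm_UnitsI[OF _ Q.\<phi>_closed[OF d_in] Q.\<phi>_closed[OF w(1)]])
  moreover have "Q.wA M.\<theta> \<in> Units M.Q"
    by (rule Q.wA_unit[OF M.\<theta>])
      (unfold cyc_elt_theta, rule ring_hom_Units[OF A.ring_axioms M.Q.ring_axioms M.h unit])
  ultimately show ?thesis unfolding sigma_image_diff by (rule M.Q.Units_m_closed)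
qed

text \<open>The \<open>p\<close>-th power of \<open>\<sigma>\<close> fixes \<open>\<theta>\<close>,
  so the order divides the prime \<open>p\<close>. It is not 1, for otherwise the unit
  \<open>\<sigma>\<theta> - \<theta>\<close> would be zero, against \<open>1 \<noteq> 0\<close> in
  \<open>A\<close> and the injectivity of the structure map.\<close>

lemma generated_group:
  assumes \<sigma>: "is_generator \<sigma>" and unit: "cyc_elt p \<rho> A \<phi> b \<in> Units A" and nontrivial: "\<one>\<^bsub>A\<^esub> \<noteq> \<zero>\<^bsub>A\<^esub>"
  shows "card (carrier (generated_group M.Q \<sigma>)) = p"
    and "group_action (generated_group M.Q \<sigma>) (carrier M.Q) (\<lambda>g. g)"
    and "g \<in> carrier (generated_group M.Q \<sigma>) \<Longrightarrow>
      \<exists>i<p. g = \<sigma> [^]\<^bsub>BijGroup (carrier M.Q)\<^esub> i"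
proof -
  let ?B = "BijGroup (carrier M.Q)"
  interpret B: group ?B by (rule group_BijGroup)
  have s: "\<sigma> \<in> carrier ?B" using \<sigma> unfolding is_generator_def algebra_automorphisms_def by blast
  have "\<sigma> [^]\<^bsub>?B\<^esub> p = \<sigma> [^]\<^bsub>?B\<^esub> (0::nat)"
    by (rule automorphism_eqI[OF generator_pow(1)[OF \<sigma>] generator_pow(1)[OF \<sigma>]])
      (unfold generator_pow(2)[OF \<sigma>] sigma_image_p sigma_image_0, rule refl)
  then have "B.ord \<sigma> dvd p" using B.pow_eq_id[OF s, of p] by (simp only: B.nat_pow_0 simp_thms)
  moreover have "B.ord \<sigma> \<noteq> 1"
  proof
    assume ord: "B.ord \<sigma> = 1"
    have "\<sigma> [^]\<^bsub>?B\<^esub> (1::nat) = \<sigma> [^]\<^bsub>?B\<^esub> (0::nat)" 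
      unfolding B.nat_pow_0 by (rule B.pow_ord_eq_1[OF s, unfolded ord])
    then have "sigma_image 1 = sigma_image 0" using generator_pow(2)[OF \<sigma>] by metis
    then have "sigma_image 1 \<ominus>\<^bsub>M.Q\<^esub> sigma_image 0 = \<zero>\<^bsub>M.Q\<^esub>"
      using M.Q.r_neg[OF sigma_image_closed, of 0] by (simp only: a_minus_def)
    then have "\<zero>\<^bsub>M.Q\<^esub> \<in> Units M.Q" using sigma_image_diff_unit[OF unit, of 1 0] p_ge_2 by simp
    then have "M.h \<one>\<^bsub>A\<^esub> = M.h \<zero>\<^bsub>A\<^esub>"
      unfolding ring_hom_one[OF M.h] M.h.hom_zero using M.Q.Units_r_inv[of "\<zero>\<^bsub>M.Q\<^esub>"] M.Q.Units_inv_closed[of "\<zero>\<^bsub>M.Q\<^esub>"] M.Q.l_null by metis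
    then show False using M.inj_h[OF M.n] nontrivial by (simp add: inj_on_def)
  qed
  ultimately have ord: "B.ord \<sigma> = p" using prime_p by (metis prime_nat_iff)
  then show "card (carrier (generated_group M.Q \<sigma>)) = p"
    using B.cyclic_order_is_ord[OF s] unfolding generated_group_def Coset.order_def by simp
  show "group_action (generated_group M.Q \<sigma>) (carrier M.Q) (\<lambda>g. g)"
  proof (intro group_action.intro group_hom.intro group_hom_axioms.intro B.group_axioms)
    show "group (generated_group M.Q \<sigma>)" unfolding generated_group_def by (rule B.group_subgroup_generated)
    have sub: "carrier (generated_group M.Q \<sigma>) \<subseteq> carrier ?B"
      unfolding generated_group_def by (rule B.carrier_subgroup_generated_subset)
    show "(\<lambda>g. g) \<in> hom (generated_group M.Q \<sigma>) ?B"
      using sub by (intro homI) (auto simp: generated_group_def)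
  qed
  assume "g \<in> carrier (generated_group M.Q \<sigma>)"
  then obtain k :: int where k: "g = \<sigma> [^]\<^bsub>?B\<^esub> k"
    unfolding generated_group_def B.carrier_subgroup_generated_by_singleton[OF s] by blast
  \<comment> \<open>The generated group consists of integer powers; as the order is
    \<open>p\<close>, an exponent may be reduced to a natural number below \<open>p\<close>.\<close>
  have "int p dvd k mod int p - k" by (simp flip: dvd_diff_commute add: minus_mod_eq_mult_div)
  then have "\<sigma> [^]\<^bsub>?B\<^esub> k = \<sigma> [^]\<^bsub>?B\<^esub> (k mod int p)"
    using B.int_pow_eq[OF s, of k "k mod int p"] unfolding ord by blast
  also have "\<dots> = \<sigma> [^]\<^bsub>?B\<^esub> nat (k mod int p)" using p_ge_2 by (simp flip: int_pow_int)
  finally show "\<exists>i<p. g = \<sigma> [^]\<^bsub>?B\<^esub> i"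
    unfolding k using p_ge_2 by (intro exI[of _ "nat (k mod int p)"]) (simp add: nat_less_iff)
qed

lemma generated_group_diff_unit:
  assumes \<sigma>: "is_generator \<sigma>" and unit: "cyc_elt p \<rho> A \<phi> b \<in> Units A" and nontrivial: "\<one>\<^bsub>A\<^esub> \<noteq> \<zero>\<^bsub>A\<^esub>"
    and g: "g \<in> carrier (generated_group M.Q \<sigma>)"
  shows "g \<in> algebra_automorphisms A M.Q M.h"
    and "g' \<in> carrier (generated_group M.Q \<sigma>) \<Longrightarrow> g \<noteq> g' \<Longrightarrow> g M.\<theta> \<ominus>\<^bsub>M.Q\<^esub> g' M.\<theta> \<in> Units M.Q"
proof -
  let ?B = "BijGroup (carrier M.Q)"
  obtain i where i: "i < p" "g = \<sigma> [^]\<^bsub>?B\<^esub> i" using generated_group(3)[OF \<sigma> unit nontrivial g] by blast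
  show "g \<in> algebra_automorphisms A M.Q M.h" unfolding i(2) by (rule generator_pow(1)[OF \<sigma>])
  assume g': "g' \<in> carrier (generated_group M.Q \<sigma>)" "g \<noteq> g'"
  obtain j where j: "j < p" "g' = \<sigma> [^]\<^bsub>?B\<^esub> j" using generated_group(3)[OF \<sigma> unit nontrivial g'(1)] by blast
  have "i \<noteq> j" using g'(2) i(2) j(2) by blast
  then show "g M.\<theta> \<ominus>\<^bsub>M.Q\<^esub> g' M.\<theta> \<in> Units M.Q"
    unfolding i(2) j(2) generator_pow(2)[OF \<sigma>] by (rule sigma_image_diff_unit[OF unit i(1) j(1)])
qed

lemma galois_cyc_extension:
  assumes "is_generator \<sigma>" "cyc_elt p \<rho> A \<phi> b \<in> Units A" "\<one>\<^bsub>A\<^esub> \<noteq> \<zero>\<^bsub>A\<^esub>"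
  shows "galois_extension A M.Q M.h (generated_group M.Q \<sigma>) (\<lambda>g. g)"
proof (rule M.galois_extensionI[OF M.n])
  show "finite (carrier (generated_group M.Q \<sigma>))"
    using generated_group(1)[OF assms] p_ge_2 by (intro card_ge_0_finite) simp
  show "g \<in> ring_hom M.Q M.Q" if "g \<in> carrier (generated_group M.Q \<sigma>)" for g
    using generated_group_diff_unit(1)[OF assms that] unfolding algebra_automorphisms_def by blast
  show "g (M.h r) = M.h r" if "g \<in> carrier (generated_group M.Q \<sigma>)" "r \<in> carrier A" for g r
    using generated_group_diff_unit(1)[OF assms that(1)] that(2) unfolding algebra_automorphisms_def by blast
qed (intro generated_group[OF assms] generated_group_diff_unit[OF assms]; assumption)+

end

section \<open>Base change\<close>

lemma (in ring_hom_cring) hom_minus: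
  "x \<in> carrier R \<Longrightarrow> y \<in> carrier R \<Longrightarrow> h (x \<ominus>\<^bsub>R\<^esub> y) = h x \<ominus>\<^bsub>S\<^esub> h y"
  by (simp add: a_minus_def)

lemma (in cring) Units_cancel_right:
  assumes "u \<in> Units R" "x \<in> carrier R" "y \<in> carrier R" "x \<otimes> u = y \<otimes> u"
  shows "x = y"
proof -
  have "u \<otimes> x = u \<otimes> y"
    using assms(4) m_comm[OF Units_closed[OF assms(1)] assms(2)] m_comm[OF Units_closed[OF assms(1)] assms(3)] by simp
  then show ?thesis using Units_l_cancel[OF assms(1-3)] by blast
qed

text \<open>With \<open>\<eta>\<close> invertible, \<open>b\<close> can be recovered from
  \<open>1 + b\<eta>^p\<close>; this is what turns a \<open>p\<close>-th root into a root of
  \<open>F - b\<close>.\<close>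

lemma (in cyc_algebra) cyc_elt_cancel:
  assumes e: "\<phi> \<eta> \<in> Units A" and c: "x \<in> carrier A" "y \<in> carrier A"
    and eq: "cyc_elt p \<rho> A \<phi> x = cyc_elt p \<rho> A \<phi> y"
  shows "x = y"
proof -
  have ep: "\<phi> \<eta> [^]\<^bsub>A\<^esub> p \<in> Units A" by (rule A.Units_pow_closed[OF e])
  then have "x \<otimes>\<^bsub>A\<^esub> \<phi> \<eta> [^]\<^bsub>A\<^esub> p = y \<otimes>\<^bsub>A\<^esub> \<phi> \<eta> [^]\<^bsub>A\<^esub> p"
    using c by (intro A.add.l_cancel[OF eq[unfolded cyc_elt_def]]) (auto dest: A.Units_closed)
  then show ?thesis by (rule A.Units_cancel_right[OF ep c])
qed

section \<open>The Kummer algebra \<open>R[Z]/(Z^n - u)\<close>\<close>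

locale binomial_quotient = R: cring R for R :: "('r, 'k) ring_scheme" +
  fixes u and n :: nat assumes u: "u \<in> carrier R" and n_pos: "0 < n"
begin

abbreviation binom where "binom \<equiv> pvar R [^]\<^bsub>UP R\<^esub> n \<ominus>\<^bsub>UP R\<^esub> pconst R u"

interpretation U: UP_cring R "UP R"
  by (simp add: UP_cring_def R.is_cring)

lemma pvar_closed: "pvar R \<in> carrier (UP R)" and pconst_closed: "pconst R u \<in> carrier (UP R)"
  using u by (simp_all add: pvar_def pconst_def)

lemma pvar_power: "pvar R [^]\<^bsub>UP R\<^esub> (i::nat) = up_ring.monom (UP R) \<one>\<^bsub>R\<^esub> i"
  unfolding pvar_def using U.monom_pow[of "\<one>\<^bsub>R\<^esub>" 1 i] by simp

sublocale monic_quotient R binom n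
proof unfold_locales
  have c: "up_ring.coeff (UP R) binom i = (if n = i then \<one>\<^bsub>R\<^esub> else \<zero>\<^bsub>R\<^esub>) \<ominus>\<^bsub>R\<^esub> (if 0 = i then u else \<zero>\<^bsub>R\<^esub>)" for i
    unfolding U.coeff_minus[OF U.P.nat_pow_closed[OF pvar_closed] pconst_closed]
    unfolding pvar_power pconst_def U.coeff_monom[OF u] U.coeff_monom[OF R.one_closed] ..
  show "binom \<in> carrier (UP R)"
    by (intro U.P.minus_closed U.P.nat_pow_closed pvar_closed pconst_closed)
  show "up_ring.coeff (UP R) binom n = \<one>\<^bsub>R\<^esub>" unfolding c using n_pos by (simp add: a_minus_def)
  show "up_ring.coeff (UP R) binom i = \<zero>\<^bsub>R\<^esub>" if "n < i" for i unfolding c using that by (simp add: a_minus_def)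
qed (rule n_pos)

lemma binomial_theta_power: "\<theta> [^]\<^bsub>Q\<^esub> n = h u"
proof -
  interpret C: ring_hom_cring "UP R" Q "poly_class R binom"
    by unfold_locales (rule class_hom)
  have "poly_class R binom binom = \<zero>\<^bsub>Q\<^esub>"
    unfolding class_zero_iff[OF f] using U.P.l_one[OF f] U.P.one_closed by metis
  moreover have "poly_class R binom binom = \<theta> [^]\<^bsub>Q\<^esub> n \<ominus>\<^bsub>Q\<^esub> h u"
    unfolding quot_map_def C.hom_pow[OF pvar_closed, symmetric]
    by (rule C.hom_minus[OF U.P.nat_pow_closed[OF pvar_closed] pconst_closed])
  ultimately have "\<theta> [^]\<^bsub>Q\<^esub> n \<ominus>\<^bsub>Q\<^esub> h u = \<zero>\<^bsub>Q\<^esub>" by simp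
  then show ?thesis
    using Q.nat_pow_closed[OF \<theta>] h.hom_closed[OF u] by simp
qed

lemma binomial_universal:
  assumes S: "cring S" and k: "k \<in> ring_hom R S" and s: "s \<in> carrier S" "s [^]\<^bsub>S\<^esub> n = k u"
  shows "\<exists>F \<in> ring_hom Q S. (\<forall>r\<in>carrier R. F (h r) = k r) \<and> F \<theta> = s"
proof (rule quotient_universal[OF S k s(1)])
  interpret S: cring S by fact
  interpret E: UP_pre_univ_prop R S k "UP R" by (rule UP_pre_univ_propI[OF R.is_cring S k])
  interpret H: ring_hom_cring "UP R" S "UnivPoly.eval R S k s"
    by unfold_locales (rule E.eval_ring_hom[OF s(1)])
  have "UnivPoly.eval R S k s (pvar R) = s" unfolding pvar_def by (rule E.eval_monom1[OF s(1)])
  moreover have "UnivPoly.eval R S k s (pconst R u) = k u" unfolding pconst_def by (rule E.eval_const[OF s(1) u])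
  ultimately have "UnivPoly.eval R S k s binom = k u \<ominus>\<^bsub>S\<^esub> k u"
    unfolding H.hom_minus[OF U.P.nat_pow_closed[OF pvar_closed] pconst_closed] H.hom_pow[OF pvar_closed]
    by (simp only: s(2))
  then show "UnivPoly.eval R S k s binom = \<zero>\<^bsub>S\<^esub>"
    using ring_hom_closed[OF k u] by (simp add: a_minus_def S.r_neg)
qed

end

locale cyc_base_change = cyc_extension p \<rho> A \<phi> b + B: cring B
  for p \<rho> and A :: "('a, 'l) ring_scheme" and \<phi> b and B :: "('b, 'm) ring_scheme" +
  fixes k assumes k: "k \<in> ring_hom A B"
begin

sublocale D: tensor_product A M.Q M.h B k
  by unfold_locales (rule M.h, rule k)

lemma cyc_extension_base: "cyc_extension p \<rho> B (\<lambda>c. k (\<phi> c)) (k b)"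
  by (intro cyc_extension.intro cyc_extension_axioms.intro ring_hom_cyc_algebra[OF B.is_cring k] ring_hom_closed[OF k b])

text \<open>Spanning is inherited from the left factor. Independence is tested in
  \<open>B[Z]/(F - k b)\<close>: the universal properties give a homomorphism to it from the tensor
  product that maps powers to powers and is compatible with \<open>B\<close>, and there the powers
  are known to be independent.\<close>

sublocale W: power_basis B D.T "\<lambda>x. D.t \<one>\<^bsub>M.Q\<^esub> x" "D.t M.\<theta> \<one>\<^bsub>B\<^esub>" p
proof (rule power_basis.intro[OF D.power_span_left_factor[OF M.power_span_axioms]], rule power_basis_axioms.intro)
  fix as assume as: "length as = p" "set as \<subseteq> carrier B"
    "horner D.T (D.t M.\<theta> \<one>\<^bsub>B\<^esub>) (map (\<lambda>x. D.t \<one>\<^bsub>M.Q\<^esub> x) as) = \<zero>\<^bsub>D.T\<^esub>"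
  interpret E: cyc_extension p \<rho> B "\<lambda>c. k (\<phi> c)" "k b" by (rule cyc_extension_base)
  have hom: "(\<lambda>a. E.M.h (k a)) \<in> ring_hom A E.M.Q"
    using ring_hom_trans[OF k E.M.h] by (simp add: comp_def)
  obtain H where H: "H \<in> ring_hom M.Q E.M.Q" "\<And>a. a \<in> carrier A \<Longrightarrow> H (M.h a) = E.M.h (k a)" "H M.\<theta> = E.M.\<theta>"
    using universal[OF E.M.Q.is_cring hom E.M.\<theta> E.FA_theta] by blast
  obtain F where F: "F \<in> ring_hom D.T E.M.Q"
    "\<And>a x. a \<in> carrier M.Q \<Longrightarrow> x \<in> carrier B \<Longrightarrow> F (D.t a x) = H a \<otimes>\<^bsub>E.M.Q\<^esub> E.M.h x"
    using D.tensor_universal[OF E.M.Q.is_cring H(1) E.M.h H(2)] by blast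
  have F_base: "F (D.t \<one>\<^bsub>M.Q\<^esub> x) = E.M.h x" if "x \<in> carrier B" for x
    unfolding F(2)[OF M.Q.one_closed that] ring_hom_one[OF H(1)] by (rule E.M.Q.l_one[OF E.M.h.hom_closed[OF that]])
  have F_theta: "F (D.t M.\<theta> \<one>\<^bsub>B\<^esub>) = E.M.\<theta>"
    unfolding F(2)[OF M.\<theta> B.one_closed] H(3) ring_hom_one[OF E.M.h] by (rule E.M.Q.r_one[OF E.M.\<theta>])
  have "set (map (\<lambda>x. D.t \<one>\<^bsub>M.Q\<^esub> x) as) \<subseteq> carrier D.T"
    using as(2) ring_hom_closed[OF D.right_hom] unfolding set_map by (intro image_subsetI) blast
  from ring_hom_horner[OF D.T.is_cring E.M.Q.is_cring F(1) D.pure_tensor_closed[OF M.\<theta> B.one_closed] this]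
  have "F \<zero>\<^bsub>D.T\<^esub> = horner E.M.Q E.M.\<theta> (map (\<lambda>x. F (D.t \<one>\<^bsub>M.Q\<^esub> x)) as)"
    unfolding as(3) F_theta map_map comp_def .
  also have "map (\<lambda>x. F (D.t \<one>\<^bsub>M.Q\<^esub> x)) as = map E.M.h as"
    by (intro map_cong refl F_base) (use as(2) in blast)
  finally have "horner E.M.Q E.M.\<theta> (map E.M.h as) = \<zero>\<^bsub>E.M.Q\<^esub>"
    unfolding ring_hom_zero[OF F(1) D.T.ring_axioms E.M.Q.ring_axioms] by (rule sym)
  then show "set as \<subseteq> {\<zero>\<^bsub>B\<^esub>}" by (rule E.M.indep[OF as(1,2)])
qed

text \<open>The left inclusion carries the unit differences \<open>g\<theta> - g'\<theta>\<close>
  into the tensor product. The order \<open>p\<close> of the group comes from \<open>A\<close>, so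
  \<open>B\<close> may be the zero ring, where the action is far from faithful.\<close>

theorem galois_base_change:
  assumes gen: "is_generator \<sigma>" "cyc_elt p \<rho> A \<phi> b \<in> Units A" "\<one>\<^bsub>A\<^esub> \<noteq> \<zero>\<^bsub>A\<^esub>"
  shows "\<exists>act. (\<forall>g\<in>carrier (generated_group M.Q \<sigma>). \<forall>a\<in>carrier M.Q. \<forall>x\<in>carrier B.
      act g (D.t a x) = D.t (g a) x) \<and>
    galois_extension B D.T (\<lambda>x. D.t \<one>\<^bsub>M.Q\<^esub> x) (generated_group M.Q \<sigma>) act"
proof -
  let ?G = "generated_group M.Q \<sigma>"
  have aut: "g \<in> ring_hom M.Q M.Q" "r \<in> carrier A \<Longrightarrow> g (M.h r) = M.h r" if "g \<in> carrier ?G" for g r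
    using generated_group_diff_unit(1)[OF gen that] unfolding algebra_automorphisms_def by blast+
  obtain act where act: "group_action ?G (carrier D.T) act" "\<And>g. g \<in> carrier ?G \<Longrightarrow> act g \<in> ring_hom D.T D.T"
    "\<And>g a x. g \<in> carrier ?G \<Longrightarrow> a \<in> carrier M.Q \<Longrightarrow> x \<in> carrier B \<Longrightarrow> act g (D.t a x) = D.t (g a) x"
    by (rule D.action_on_left_factor[where act = "\<lambda>g. g", OF generated_group(2)[OF gen]]) (erule aut(1), erule(1) aut(2), blast)
  interpret L: ring_hom_cring M.Q D.T "\<lambda>a. D.t a \<one>\<^bsub>B\<^esub>"
    by unfold_locales (rule D.left_hom)
  have "galois_extension B D.T (\<lambda>x. D.t \<one>\<^bsub>M.Q\<^esub> x) ?G act"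
  proof (rule W.galois_extensionI[OF M.n _ generated_group(1)[OF gen] act(1,2)])
    show "finite (carrier ?G)"
      using generated_group(1)[OF gen] p_ge_2 by (intro card_ge_0_finite) simp
    show "act g (D.t \<one>\<^bsub>M.Q\<^esub> x) = D.t \<one>\<^bsub>M.Q\<^esub> x" if "g \<in> carrier ?G" "x \<in> carrier B" for g x
      unfolding act(3)[OF that(1) M.Q.one_closed that(2)] ring_hom_one[OF aut(1)[OF that(1)]] ..
    show "act g (D.t M.\<theta> \<one>\<^bsub>B\<^esub>) \<ominus>\<^bsub>D.T\<^esub> act g' (D.t M.\<theta> \<one>\<^bsub>B\<^esub>) \<in> Units D.T"
      if g: "g \<in> carrier ?G" "g' \<in> carrier ?G" "g \<noteq> g'" for g g'
    proof -
      have c: "g M.\<theta> \<in> carrier M.Q" "g' M.\<theta> \<in> carrier M.Q"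
        by (rule ring_hom_closed[OF aut(1)[OF g(1)] M.\<theta>], rule ring_hom_closed[OF aut(1)[OF g(2)] M.\<theta>])
      have "D.t (g M.\<theta> \<ominus>\<^bsub>M.Q\<^esub> g' M.\<theta>) \<one>\<^bsub>B\<^esub> \<in> Units D.T"
        by (rule ring_hom_Units[OF M.Q.ring_axioms D.T.ring_axioms D.left_hom generated_group_diff_unit(2)[OF gen g]])
      then show ?thesis
        unfolding act(3)[OF g(1) M.\<theta> B.one_closed] act(3)[OF g(2) M.\<theta> B.one_closed]
          L.hom_minus[OF c] .
    qed
  qed
  with act(3) show ?thesis by blast
qed

text \<open>\<open>w = 1 + \<eta>\<theta>\<close> is a \<open>p\<close>-th root of
  \<open>1 + b\<eta>^p\<close>, and conversely \<open>(w - 1)/\<eta>\<close> recovers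
  \<open>\<theta>\<close>. Each substitution defines a homomorphism by a universal property, and
  they are inverse to each other on generators.\<close>

theorem kummer_base_change:
  assumes unit: "k (\<phi> \<eta>) \<in> Units B"
  defines "f \<equiv> pvar B [^]\<^bsub>UP B\<^esub> p \<ominus>\<^bsub>UP B\<^esub> pconst B (k (cyc_elt p \<rho> A \<phi> b))"
  shows "algebra_isomorphic B D.T (\<lambda>x. D.t \<one>\<^bsub>M.Q\<^esub> x) (poly_quot B f) (quot_map B f)"
proof -
  let ?u = "k (cyc_elt p \<rho> A \<phi> b)"
  interpret N: binomial_quotient B ?u p
    by unfold_locales (rule ring_hom_closed[OF k cyc_elt_closed], rule M.n)
  have hom: "(\<lambda>a. N.h (k a)) \<in> ring_hom A N.Q"
    using ring_hom_trans[OF k N.h] by (simp add: comp_def)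
  interpret NA: cyc_algebra p \<rho> N.Q "\<lambda>c. N.h (k (\<phi> c))"
    by (rule ring_hom_cyc_algebra[OF N.Q.is_cring hom])
  let ?e = "N.h (k (\<phi> \<eta>))"
  have e: "?e \<in> Units N.Q" by (rule ring_hom_Units[OF B.ring_axioms N.Q.ring_axioms N.h unit])
  \<comment> \<open>The solution of \<open>1 + \<eta>s = Z\<close> for the class of the variable,
    which plays the part of \<open>w\<close>.\<close>
  define s where "s = (N.\<theta> \<ominus>\<^bsub>N.Q\<^esub> \<one>\<^bsub>N.Q\<^esub>) \<otimes>\<^bsub>N.Q\<^esub> inv\<^bsub>N.Q\<^esub> ?e"
  note c = N.Q.Units_closed[OF e] N.Q.Units_inv_closed[OF e] N.\<theta>
  have s: "s \<in> carrier N.Q" unfolding s_def by (intro N.Q.m_closed N.Q.minus_closed N.Q.one_closed c)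
  have "s \<otimes>\<^bsub>N.Q\<^esub> ?e = (N.\<theta> \<ominus>\<^bsub>N.Q\<^esub> \<one>\<^bsub>N.Q\<^esub>) \<otimes>\<^bsub>N.Q\<^esub> (inv\<^bsub>N.Q\<^esub> ?e \<otimes>\<^bsub>N.Q\<^esub> ?e)"
    unfolding s_def by (intro N.Q.m_assoc N.Q.minus_closed N.Q.one_closed c)
  then have se: "s \<otimes>\<^bsub>N.Q\<^esub> ?e = N.\<theta> \<ominus>\<^bsub>N.Q\<^esub> \<one>\<^bsub>N.Q\<^esub>"
    unfolding N.Q.Units_l_inv[OF e] N.Q.r_one[OF N.Q.minus_closed[OF N.\<theta> N.Q.one_closed]] .
  have ws: "NA.wA s = N.\<theta>" unfolding se using N.\<theta> by algebra
  have FAs: "NA.FA s \<in> carrier N.Q" by (rule NA.FA_closed[OF s])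
  have kb: "N.h (k b) \<in> carrier N.Q" by (rule ring_hom_closed[OF hom b])
  \<comment> \<open>The left side is the \<open>p\<close>-th power of \<open>1 + \<eta>s\<close>,
    that is, of the class of the variable, and the defining relation makes it the image of
    \<open>1 + b\<eta>^p\<close>.\<close>
  have "cyc_elt p \<rho> N.Q (\<lambda>c. N.h (k (\<phi> c))) (NA.FA s) = cyc_elt p \<rho> N.Q (\<lambda>c. N.h (k (\<phi> c))) (N.h (k b))"
    unfolding NA.FA_power[OF s, symmetric] ws N.binomial_theta_power
    by (rule ring_hom_cyc_elt[OF N.Q.is_cring hom b])
  then have root: "NA.FA s = N.h (k b)" by (rule NA.cyc_elt_cancel[OF e FAs kb])
  obtain H where H: "H \<in> ring_hom M.Q N.Q" "\<And>a. a \<in> carrier A \<Longrightarrow> H (M.h a) = N.h (k a)" "H M.\<theta> = s"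
    using universal[OF N.Q.is_cring hom s root] by blast
  obtain F where F: "F \<in> ring_hom D.T N.Q"
    "\<And>a x. a \<in> carrier M.Q \<Longrightarrow> x \<in> carrier B \<Longrightarrow> F (D.t a x) = H a \<otimes>\<^bsub>N.Q\<^esub> N.h x"
    using D.tensor_universal[OF N.Q.is_cring H(1) N.h H(2)] by blast
  have F_base: "F (D.t \<one>\<^bsub>M.Q\<^esub> x) = N.h x" if "x \<in> carrier B" for x
    unfolding F(2)[OF M.Q.one_closed that] ring_hom_one[OF H(1)] by (rule N.Q.l_one[OF N.h.hom_closed[OF that]])
  have F_left: "F (D.t a \<one>\<^bsub>B\<^esub>) = H a" if "a \<in> carrier M.Q" for a
    unfolding F(2)[OF that B.one_closed] ring_hom_one[OF N.h] by (rule N.Q.r_one[OF ring_hom_closed[OF H(1) that]])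
  interpret L: ring_hom_cring M.Q D.T "\<lambda>a. D.t a \<one>\<^bsub>B\<^esub>"
    by unfold_locales (rule D.left_hom)
  interpret H: ring_hom_cring M.Q N.Q H
    by unfold_locales (rule H(1))
  have w: "Q.wA M.\<theta> \<in> carrier M.Q" by (rule Q.wA_closed[OF M.\<theta>])
  have "D.t (Q.wA M.\<theta>) \<one>\<^bsub>B\<^esub> [^]\<^bsub>D.T\<^esub> p = D.t (Q.wA M.\<theta> [^]\<^bsub>M.Q\<^esub> p) \<one>\<^bsub>B\<^esub>"
    by (rule L.hom_pow[OF w, symmetric])
  also have "\<dots> = D.t (M.h (cyc_elt p \<rho> A \<phi> b)) \<one>\<^bsub>B\<^esub>"
    unfolding Q.FA_power[OF M.\<theta>] cyc_elt_theta ..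
  also have "\<dots> = D.t \<one>\<^bsub>M.Q\<^esub> ?u" by (rule D.pure_tensor_base[OF cyc_elt_closed])
  finally obtain G where G: "G \<in> ring_hom N.Q D.T" "\<And>x. x \<in> carrier B \<Longrightarrow> G (N.h x) = D.t \<one>\<^bsub>M.Q\<^esub> x"
    "G N.\<theta> = D.t (Q.wA M.\<theta>) \<one>\<^bsub>B\<^esub>"
    using N.binomial_universal[OF D.T.is_cring D.right_hom L.hom_closed[OF w]] by blast
  interpret G: ring_hom_cring N.Q D.T G
    by unfold_locales (rule G(1))
  have FG: "F (G y) = y" if y: "y \<in> carrier N.Q" for y
  proof -
    have "(F \<circ> G) y = id y"
    proof (rule N.ring_hom_eqI[OF N.Q.is_cring ring_hom_trans[OF G(1) F(1)] _ _ _ y])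
      show "id \<in> ring_hom N.Q N.Q" by (rule ring_hom_memI) simp_all
      show "(F \<circ> G) (N.h r) = id (N.h r)" if "r \<in> carrier B" for r
        unfolding comp_apply id_apply G(2)[OF that] by (rule F_base[OF that])
      have "H (Q.wA M.\<theta>) = NA.wA s"
        unfolding H.hom_add[OF M.Q.one_closed M.Q.m_closed[OF M.\<theta> Q.\<phi>_closed[OF eta_in]]]
          H.hom_mult[OF M.\<theta> Q.\<phi>_closed[OF eta_in]] H.hom_one H(3) H(2)[OF \<phi>_closed[OF eta_in]] ..
      then show "(F \<circ> G) N.\<theta> = id N.\<theta>"
        unfolding comp_apply id_apply G(3) F_left[OF w] ws .
    qed
    then show ?thesis unfolding comp_apply id_apply .
  qed
  let ?x = "D.t M.\<theta> \<one>\<^bsub>B\<^esub>" and ?d = "D.t (M.h (\<phi> \<eta>)) \<one>\<^bsub>B\<^esub>"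
  have d: "G ?e = ?d" unfolding G(2)[OF ring_hom_closed[OF k \<phi>_closed[OF eta_in]]]
    by (rule D.pure_tensor_base[OF \<phi>_closed[OF eta_in], symmetric])
  have d_unit: "?d \<in> Units D.T" unfolding d[symmetric] by (rule ring_hom_Units[OF N.Q.ring_axioms D.T.ring_axioms G(1) e])
  have x: "?x \<in> carrier D.T" by (rule L.hom_closed[OF M.\<theta>])
  \<comment> \<open>\<open>G s = \<theta> \<otimes> 1\<close> is checked after multiplication by the
    unit \<open>\<eta>\<close>, where both sides become \<open>w - 1\<close>.\<close>
  have "G s \<otimes>\<^bsub>D.T\<^esub> ?d = G (N.\<theta> \<ominus>\<^bsub>N.Q\<^esub> \<one>\<^bsub>N.Q\<^esub>)"
    unfolding d[symmetric] se[symmetric] by (rule G.hom_mult[OF s c(1), symmetric])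
  also have "\<dots> = (\<one>\<^bsub>D.T\<^esub> \<oplus>\<^bsub>D.T\<^esub> ?x \<otimes>\<^bsub>D.T\<^esub> ?d) \<ominus>\<^bsub>D.T\<^esub> \<one>\<^bsub>D.T\<^esub>"
    unfolding G.hom_minus[OF N.\<theta> N.Q.one_closed] G.hom_one G(3) L.hom_add[OF M.Q.one_closed M.Q.m_closed[OF M.\<theta> Q.\<phi>_closed[OF eta_in]]]
      L.hom_mult[OF M.\<theta> Q.\<phi>_closed[OF eta_in]] L.hom_one ..
  also have "\<dots> = ?x \<otimes>\<^bsub>D.T\<^esub> ?d" using x D.T.Units_closed[OF d_unit] by algebra
  finally have Gs: "G s = ?x"
    by (rule D.T.Units_cancel_right[OF d_unit G.hom_closed[OF s] x])
  have GF: "G (F y) = y" if y: "y \<in> carrier D.T" for y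
  proof -
    have "(G \<circ> F) y = id y"
    proof (rule W.ring_hom_eqI[OF D.T.is_cring ring_hom_trans[OF F(1) G(1)] _ _ _ y])
      show "id \<in> ring_hom D.T D.T" by (rule ring_hom_memI) simp_all
      show "(G \<circ> F) (D.t \<one>\<^bsub>M.Q\<^esub> r) = id (D.t \<one>\<^bsub>M.Q\<^esub> r)" if "r \<in> carrier B" for r
        unfolding comp_apply id_apply F_base[OF that] by (rule G(2)[OF that])
      show "(G \<circ> F) ?x = id ?x"
        unfolding comp_apply id_apply F_left[OF M.\<theta>] H(3) by (rule Gs)
    qed
    then show ?thesis unfolding comp_apply id_apply .
  qed
  have "bij_betw F (carrier D.T) (carrier N.Q)"
    by (rule bij_betw_byWitness[where f' = G]) (intro ballI GF FG image_subsetI ring_hom_closed[OF F(1)] ring_hom_closed[OF G(1)]; assumption)+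
  then have "F \<in> ring_iso D.T N.Q" using F(1) by (simp only: ring_iso_def mem_Collect_eq simp_thms)
  then show ?thesis unfolding algebra_isomorphic_def f_def using F_base by blast
qed

end

section \<open>The universal extension\<close>

context cyclotomic
begin

lemma R0_cyc_algebra: "cyc_algebra p \<rho> (R0 \<rho>) (R0_const \<rho>)"
proof -
  have "(\<lambda>c. c) \<in> ring_hom (Zring \<rho>) (Zring \<rho>)" by (rule ring_hom_memI) simp_all
  then have "cyc_algebra p \<rho> (Zring \<rho>) (\<lambda>c. c)"
    by (intro cyc_algebra.intro Z_algebra.intro Z_algebra_axioms.intro cyclotomic_axioms cring_Zring)
  from cyc_algebra.UP_cyc_algebra[OF this] show ?thesis .
qed

lemma R0_var_closed: "R0_var \<rho> \<in> carrier (R0 \<rho>)"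
  and R0_const_closed: "c \<in> Zset \<rho> \<Longrightarrow> R0_const \<rho> c \<in> carrier (R0 \<rho>)"
  and uni_elt_closed: "uni_elt p \<rho> \<in> carrier (R0 \<rho>)"
proof -
  interpret P: cyc_algebra p \<rho> "R0 \<rho>" "R0_const \<rho>" by (rule R0_cyc_algebra)
  interpret Z: UP_cring "Zring \<rho>" "R0 \<rho>" by (simp add: UP_cring_def cring_Zring)
  show v: "R0_var \<rho> \<in> carrier (R0 \<rho>)" by (simp add: pvar_def)
  show "R0_const \<rho> c \<in> carrier (R0 \<rho>)" if "c \<in> Zset \<rho>" for c by (rule P.\<phi>_closed[OF that])
  show "uni_elt p \<rho> \<in> carrier (R0 \<rho>)"
    unfolding uni_elt_def cyc_elt_def
    by (intro P.A.a_closed P.A.m_closed P.A.one_closed P.A.nat_pow_closed v P.\<phi>_closed eta_in)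
qed

lemma localized_R0: "localized (R0 \<rho>) (uni_elt p \<rho>)"
proof -
  interpret P: cyc_algebra p \<rho> "R0 \<rho>" "R0_const \<rho>" by (rule R0_cyc_algebra)
  show ?thesis by (intro localized.intro localized_axioms.intro P.A.is_cring uni_elt_closed)
qed

lemma cring_uni_R: "cring (uni_R p \<rho>)"
proof -
  interpret L: localized "R0 \<rho>" "uni_elt p \<rho>" by (rule localized_R0)
  show ?thesis unfolding uni_R_def by (rule L.L.is_cring)
qed

lemma uni_loc_hom: "uni_loc p \<rho> \<in> ring_hom (R0 \<rho>) (uni_R p \<rho>)"
  unfolding uni_loc_def uni_R_def by (rule localized.loc_map_hom[OF localized_R0])

lemma uni_cyc_extension:
  "cyc_extension p \<rho> (uni_R p \<rho>) (\<lambda>c. uni_loc p \<rho> (R0_const \<rho> c)) (uni_loc p \<rho> (R0_var \<rho>))"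
  by (intro cyc_extension.intro cyc_extension_axioms.intro ring_hom_closed[OF uni_loc_hom R0_var_closed]
      cyc_algebra.ring_hom_cyc_algebra[OF R0_cyc_algebra cring_uni_R uni_loc_hom])

lemma uni_loc_uni_elt: "uni_loc p \<rho> (uni_elt p \<rho>) =
    cyc_elt p \<rho> (uni_R p \<rho>) (\<lambda>c. uni_loc p \<rho> (R0_const \<rho> c)) (uni_loc p \<rho> (R0_var \<rho>))"
  unfolding uni_elt_def
  by (rule cyc_algebra.ring_hom_cyc_elt[OF R0_cyc_algebra cring_uni_R uni_loc_hom R0_var_closed])

lemma uni_cyc_elt_unit:
  "cyc_elt p \<rho> (uni_R p \<rho>) (\<lambda>c. uni_loc p \<rho> (R0_const \<rho> c)) (uni_loc p \<rho> (R0_var \<rho>)) \<in> Units (uni_R p \<rho>)"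
  unfolding uni_loc_uni_elt[symmetric] unfolding uni_loc_def uni_R_def
  by (rule localized.loc_map_unit[OF localized_R0])

text \<open>The ring maps onto \<open>\<int>[\<rho>]\<close> by \<open>a \<mapsto> 0\<close>.\<close>

lemma uni_R_nontrivial: "\<one>\<^bsub>uni_R p \<rho>\<^esub> \<noteq> \<zero>\<^bsub>uni_R p \<rho>\<^esub>"
proof
  assume eq: "\<one>\<^bsub>uni_R p \<rho>\<^esub> = \<zero>\<^bsub>uni_R p \<rho>\<^esub>"
  interpret Z: cring "Zring \<rho>" by (rule cring_Zring)
  interpret P: cyc_algebra p \<rho> "R0 \<rho>" "R0_const \<rho>" by (rule R0_cyc_algebra)
  have id: "(\<lambda>c. c) \<in> ring_hom (Zring \<rho>) (Zring \<rho>)" by (rule ring_hom_memI) simp_all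
  interpret E: UP_pre_univ_prop "Zring \<rho>" "Zring \<rho>" "\<lambda>c. c" "R0 \<rho>"
    by (rule UP_pre_univ_propI[OF Z.is_cring Z.is_cring id])
  let ?F = "UnivPoly.eval (Zring \<rho>) (Zring \<rho>) (\<lambda>c. c) \<zero>\<^bsub>Zring \<rho>\<^esub>"
  have F: "?F \<in> ring_hom (R0 \<rho>) (Zring \<rho>)" by (rule E.eval_ring_hom[OF Z.zero_closed])
  have "?F (R0_var \<rho>) = \<zero>\<^bsub>Zring \<rho>\<^esub>" unfolding pvar_def by (rule E.eval_monom1[OF Z.zero_closed])
  moreover have "?F (R0_const \<rho> \<eta>) \<in> carrier (Zring \<rho>)"
    by (rule ring_hom_closed[OF F R0_const_closed[OF eta_in]])
  ultimately have "?F (uni_elt p \<rho>) = \<one>\<^bsub>Zring \<rho>\<^esub>"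
    unfolding uni_elt_def P.ring_hom_cyc_elt[OF Z.is_cring F R0_var_closed] unfolding cyc_elt_def
    using Z.l_null[OF Z.nat_pow_closed] Z.r_zero[OF Z.one_closed] by metis
  \<comment> \<open>The evaluation sends \<open>1 + a\<eta>^p\<close> to 1, so it extends to the
    localization; a ring in which \<open>1 = 0\<close> has no homomorphism to a nonzero
    ring.\<close>
  then obtain H where H: "H \<in> ring_hom (uni_R p \<rho>) (Zring \<rho>)"
    using localized.localization_universal[OF localized_R0 Z.is_cring F] Z.Units_one_closed
    unfolding uni_R_def by auto
  interpret U: cring "uni_R p \<rho>" by (rule cring_uni_R)
  show False
    using ring_hom_one[OF H] ring_hom_zero[OF H U.ring_axioms Z.ring_axioms] eq by (simp add: Zring_def ring_of_type_algebra_def)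
qed

end

theorem proposition5p1:
  fixes p :: nat and \<rho> :: complex
    and R' :: "('a, 'l) ring_scheme"
    and \<phi> :: "complex \<Rightarrow> 'a" and \<psi> :: "(nat \<Rightarrow> complex) \<Rightarrow> 'a" and b :: 'a
  assumes "Factorial_Ring.prime p" and "primitive_root_of_one p \<rho>"
    and "comm_algebra (Zring \<rho>) R' \<phi>"
    and "\<psi> \<in> ring_hom (R0 \<rho>) R'"
    and "\<forall>c\<in>carrier (Zring \<rho>). \<psi> (R0_const \<rho> c) = \<phi> c"
    and "b = \<psi> (R0_var \<rho>)"
  shows
    "(separable_poly R' (cyc_poly p \<rho> R' \<phi> b) \<longleftrightarrow> cyc_elt p \<rho> R' \<phi> b \<in> Units R') \<and>
     (\<exists>!\<sigma>. is_sigma p \<rho> \<sigma>) \<and>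
     (\<forall>\<sigma>. is_sigma p \<rho> \<sigma> \<longrightarrow>
        galois_extension (uni_R p \<rho>) (uni_T p \<rho>) (uni_map p \<rho>)
          (generated_group (uni_T p \<rho>) \<sigma>) (\<lambda>g. g)) \<and>
     (cyc_elt p \<rho> R' \<phi> b \<in> Units R' \<longrightarrow>
        (\<exists>\<Psi>. psi_extension p \<rho> R' \<psi> \<Psi>) \<and>
        (\<forall>\<Psi>. psi_extension p \<rho> R' \<psi> \<Psi> \<longrightarrow>
           (\<forall>\<sigma>. is_sigma p \<rho> \<sigma> \<longrightarrow>
              (\<exists>act.
                 (\<forall>g\<in>carrier (generated_group (uni_T p \<rho>) \<sigma>).
                    \<forall>t\<in>carrier (uni_T p \<rho>). \<forall>x\<in>carrier R'.
                      act g (bc_tensor p \<rho> R' \<Psi> t x) = bc_tensor p \<rho> R' \<Psi> (g t) x) \<and>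
                 galois_extension R' (base_change p \<rho> R' \<Psi>) (bc_map p \<rho> R' \<Psi>)
                   (generated_group (uni_T p \<rho>) \<sigma>) act)) \<and>
           (\<phi> (\<rho> - 1) \<in> Units R' \<longrightarrow>
              algebra_isomorphic R' (base_change p \<rho> R' \<Psi>) (bc_map p \<rho> R' \<Psi>)
                (poly_quot R' (pvar R' [^]\<^bsub>UP R'\<^esub> p \<ominus>\<^bsub>UP R'\<^esub> pconst R' (cyc_elt p \<rho> R' \<phi> b)))
                (quot_map R' (pvar R' [^]\<^bsub>UP R'\<^esub> p \<ominus>\<^bsub>UP R'\<^esub> pconst R' (cyc_elt p \<rho> R' \<phi> b))))))"
proof -
  interpret cyclotomic p \<rho> by (rule cyclotomic.intro) (rule assms(1,2))+
  interpret U: cyc_extension p \<rho> "uni_R p \<rho>" "\<lambda>c. uni_loc p \<rho> (R0_const \<rho> c)" "uni_loc p \<rho> (R0_var \<rho>)"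
    by (rule uni_cyc_extension)
  have R': "cring R'" and \<phi>: "\<phi> \<in> ring_hom (Zring \<rho>) R'"
    using assms(3) by (simp_all add: comm_algebra_def)
  interpret R': cyc_algebra p \<rho> R' \<phi>
    by (intro cyc_algebra.intro Z_algebra.intro Z_algebra_axioms.intro cyclotomic_axioms R' \<phi>)
  have b: "b \<in> carrier R'"
    unfolding assms(6) by (rule ring_hom_closed[OF assms(4) R0_var_closed])
  interpret E: cyc_extension p \<rho> R' \<phi> b
    by (intro cyc_extension.intro cyc_extension_axioms.intro R'.cyc_algebra_axioms b)
  have T: "uni_T p \<rho> = U.M.Q" and h: "uni_map p \<rho> = U.M.h" and \<theta>: "uni_theta p \<rho> = U.M.\<theta>"
    by (simp_all only: uni_T_def uni_map_def uni_theta_def uni_poly_def)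
  \<comment> \<open>The universal objects unfold to the extension over a general base, with
    \<open>uni_R\<close> as base and the image of \<open>a\<close> as \<open>b\<close>, so the
    results above can be instantiated.\<close>
  have sigma: "is_sigma p \<rho> = U.is_generator"
    unfolding is_sigma_def[abs_def] U.is_generator_def[abs_def] T h \<theta> ..
  have elt: "\<psi> (uni_elt p \<rho>) = cyc_elt p \<rho> R' \<phi> b"
  proof -
    interpret P: cyc_algebra p \<rho> "R0 \<rho>" "R0_const \<rho>" by (rule R0_cyc_algebra)
    show ?thesis
      unfolding uni_elt_def assms(6) P.ring_hom_cyc_elt[OF R' assms(4) R0_var_closed]
      by (simp only: cyc_elt_def bspec[OF assms(5) eta_in])
  qed
  have psi_extends: "\<exists>\<Psi>. psi_extension p \<rho> R' \<psi> \<Psi>" if "cyc_elt p \<rho> R' \<phi> b \<in> Units R'"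
    using localized.localization_universal[OF localized_R0 R' assms(4)] that unfolding elt
    by (auto simp: psi_extension_def uni_R_def uni_loc_def)
  have galois: "\<exists>act. (\<forall>g\<in>carrier (generated_group (uni_T p \<rho>) \<sigma>). \<forall>t\<in>carrier (uni_T p \<rho>). \<forall>x\<in>carrier R'.
        act g (bc_tensor p \<rho> R' \<Psi> t x) = bc_tensor p \<rho> R' \<Psi> (g t) x) \<and>
      galois_extension R' (base_change p \<rho> R' \<Psi>) (bc_map p \<rho> R' \<Psi>) (generated_group (uni_T p \<rho>) \<sigma>) act"
    and kummer: "\<phi> \<eta> \<in> Units R' \<Longrightarrow> algebra_isomorphic R' (base_change p \<rho> R' \<Psi>) (bc_map p \<rho> R' \<Psi>)
      (poly_quot R' (pvar R' [^]\<^bsub>UP R'\<^esub> p \<ominus>\<^bsub>UP R'\<^esub> pconst R' (cyc_elt p \<rho> R' \<phi> b)))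
      (quot_map R' (pvar R' [^]\<^bsub>UP R'\<^esub> p \<ominus>\<^bsub>UP R'\<^esub> pconst R' (cyc_elt p \<rho> R' \<phi> b)))"
    if \<Psi>: "psi_extension p \<rho> R' \<psi> \<Psi>" and \<sigma>: "is_sigma p \<rho> \<sigma>" for \<Psi> \<sigma>
  proof -
    have \<Psi>_hom: "\<Psi> \<in> ring_hom (uni_R p \<rho>) R'" and \<Psi>_loc: "\<And>x. x \<in> carrier (R0 \<rho>) \<Longrightarrow> \<Psi> (uni_loc p \<rho> x) = \<psi> x"
      using \<Psi> unfolding psi_extension_def by blast+
    interpret C: cyc_base_change p \<rho> "uni_R p \<rho>" "\<lambda>c. uni_loc p \<rho> (R0_const \<rho> c)" "uni_loc p \<rho> (R0_var \<rho>)" R' \<Psi>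
      by (intro cyc_base_change.intro cyc_base_change_axioms.intro U.cyc_extension_axioms R' \<Psi>_hom)
    have map: "bc_map p \<rho> R' \<Psi> = (\<lambda>x. C.D.t \<one>\<^bsub>U.M.Q\<^esub> x)"
      by (rule ext) (simp only: bc_map_def bc_tensor_def T h)
    show "\<exists>act. (\<forall>g\<in>carrier (generated_group (uni_T p \<rho>) \<sigma>). \<forall>t\<in>carrier (uni_T p \<rho>). \<forall>x\<in>carrier R'.
        act g (bc_tensor p \<rho> R' \<Psi> t x) = bc_tensor p \<rho> R' \<Psi> (g t) x) \<and>
      galois_extension R' (base_change p \<rho> R' \<Psi>) (bc_map p \<rho> R' \<Psi>) (generated_group (uni_T p \<rho>) \<sigma>) act"
      unfolding map unfolding base_change_def bc_tensor_def T h
      by (rule C.galois_base_change[OF \<sigma>[unfolded sigma] uni_cyc_elt_unit uni_R_nontrivial])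
    assume unit: "\<phi> \<eta> \<in> Units R'"
    have "\<Psi> (uni_loc p \<rho> (R0_const \<rho> \<eta>)) = \<phi> \<eta>"
      using \<Psi>_loc[OF R0_const_closed[OF eta_in]] bspec[OF assms(5) eta_in] by simp
    \<comment> \<open>\<open>\<Psi>\<close> carries the universal element to
      \<open>1 + b\<eta>^p\<close>, so the Kummer polynomial obtained by base change is the one in
      the claim.\<close>
    moreover have "\<Psi> (cyc_elt p \<rho> (uni_R p \<rho>) (\<lambda>c. uni_loc p \<rho> (R0_const \<rho> c)) (uni_loc p \<rho> (R0_var \<rho>)))
        = cyc_elt p \<rho> R' \<phi> b"
      unfolding uni_loc_uni_elt[symmetric] \<Psi>_loc[OF uni_elt_closed] by (rule elt)
    ultimately show "algebra_isomorphic R' (base_change p \<rho> R' \<Psi>) (bc_map p \<rho> R' \<Psi>)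
      (poly_quot R' (pvar R' [^]\<^bsub>UP R'\<^esub> p \<ominus>\<^bsub>UP R'\<^esub> pconst R' (cyc_elt p \<rho> R' \<phi> b)))
      (quot_map R' (pvar R' [^]\<^bsub>UP R'\<^esub> p \<ominus>\<^bsub>UP R'\<^esub> pconst R' (cyc_elt p \<rho> R' \<phi> b)))"
      using C.kummer_base_change unit unfolding map unfolding base_change_def T h by metis
  qed
  have unique: "\<exists>!\<sigma>. is_sigma p \<rho> \<sigma>" unfolding sigma by (rule U.generator_unique)
  \<comment> \<open>\<open>kummer\<close> was derived together with \<open>galois\<close> for a
    given \<open>\<sigma>\<close>; the existence of one discharges that premise.\<close>
  then obtain \<sigma>\<^sub>0 where \<sigma>\<^sub>0: "is_sigma p \<rho> \<sigma>\<^sub>0" by blast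
  show ?thesis
  proof (intro conjI allI impI)
    show "separable_poly R' (cyc_poly p \<rho> R' \<phi> b) \<longleftrightarrow> cyc_elt p \<rho> R' \<phi> b \<in> Units R'"
      by (rule E.separable_cyc_poly)
    show "galois_extension (uni_R p \<rho>) (uni_T p \<rho>) (uni_map p \<rho>) (generated_group (uni_T p \<rho>) \<sigma>) (\<lambda>g. g)"
      if "is_sigma p \<rho> \<sigma>" for \<sigma>
      using that unfolding sigma T h by (rule U.galois_cyc_extension[OF _ uni_cyc_elt_unit uni_R_nontrivial])
  qed (rule unique psi_extends galois kummer[OF _ \<sigma>\<^sub>0]; assumption)+
qed

end
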